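(* For all sufficiently small $\epsilon>0$ and $c>0$, and every sequence of positive integers $q_1<q_2<\cdots$ with $\lambda_{q_i}^2/\lambda_{q_{i+1}}<\epsilon$ for all $i$, the vector field $U$ on $\mathbb{T}^3$ constructed in the context from $c$ and $(q_j)$ has the following property. Let $\nu>0$, $T>0$, and let $u\in C_w([0,T);L^2(\mathbb{T}^3))\cap L^2([0,T);H^1(\mathbb{T}^3))$ be a weak solution to the Navier-Stokes equation $u_t+(u\cdot\nabla)u=\nu\Delta u-\nabla p$, $\operatorname{div}u=0$, on $\mathbb{T}^3$ with initial condition $u(0)=U$. Then there is $\delta=\delta(u)>0$ such that $$\limsup_{t\to 0^+}\|u(t)-U\|_{B^{-1}_{\infty,\infty}}\ge\delta .$$ If in addition $u$ is a Leray-Hopf solution satisfying the energy inequality $$\|u(t)\|_{L^2}^2+2\nu\int_0^t\|\nabla u(s)\|_{L^2}^2\,ds\le\|U\|_{L^2}^2\qquad\text{for all } t>0 \text{ in } [0,T),$$ then $\delta$ can be chosen independent of $u$.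
   Context: $\mathbb{T}^3=(\mathbb{R}/2\pi\mathbb{Z})^3$; $\lambda_q=2^q$; Fourier series are written $u=\sum_{k\in\mathbb{Z}^3}\hat u(k)e^{ik\cdot x}$; $C_w$ denotes weakly continuous functions of time; weak solution means solution in the sense of distributions. Construction of $U$. Given $c>0$ and $q_1<q_2<\cdots$, define for $j\ge 1$ the integer lattice blocks $$A_j=\big([(1-c)\lambda_{q_j},(1+c)\lambda_{q_j}]\times[-c\lambda_{q_j},c\lambda_{q_j}]^2\big)\cap\mathbb{Z}^3,$$ $$B_j=\big([-c\lambda_{q_j-1},c\lambda_{q_j-1}]^2\times[(1-c)\lambda_{q_j-1},(1+c)\lambda_{q_j-1}]\big)\cap\mathbb{Z}^3,$$ $$C_j=A_j+B_j,\qquad A_j^*=-A_j,\quad B_j^*=-B_j,\quad C_j^*=-C_j$$ (where $A_j+B_j$ is the sumset). Let $p(\xi)=I-\frac{\xi\otimes\xi}{|\xi|^2}$ be the symbol of the Leray-Hopf projection onto divergence-free fields, and let $\vec e_1(\xi)=p(\xi)\vec e_1$, $\vec e_2(\xi)=p(\xi)\vec e_2$, with $\vec e_1,\vec e_2$ the first two standard basis vectors of $\mathbb{R}^3$. For a set $S$ let $\chi_S$ be its indicator function. Define $$U=\sum_{j\ge 1}(U_{q_j}+U_{q_j-1}),$$ where $$\widehat{U_{q_j}}(\xi)=\frac{1}{\lambda_{q_j}^2}\Big(\vec e_2(\xi)\chi_{A_j\cup A_j^*}(\xi)+i(\vec e_2(\xi)-\vec e_1(\xi))\chi_{C_j}(\xi)-i(\vec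 e_2(\xi)-\vec e_1(\xi))\chi_{C_j^*}(\xi)\Big),$$ $$\widehat{U_{q_j-1}}(\xi)=\frac{1}{\lambda_{q_j}^2}\,\vec e_1(\xi)\chi_{B_j\cup B_j^*}(\xi).$$ Besov norm. Fix a nonnegative radial $\chi\in C_0^\infty(\mathbb{R}^3)$ with $\chi(\xi)=1$ for $|\xi|\le 1/2$ and $\chi(\xi)=0$ for $|\xi|\ge 1$. Put $\varphi(\xi)=\chi(\xi/2)-\chi(\xi)$, $\varphi_q(\xi)=\varphi(\lambda_q^{-1}\xi)$ for $q\ge 0$, $\varphi_{-1}=\chi$. For a distribution $v$ on $\mathbb{T}^3$, let $\Delta_q v=\sum_{k\in\mathbb{Z}^3}\hat v(k)\varphi_q(k)e^{ik\cdot x}$ for $q\ge -1$. Then $\|v\|_{B^{-1}_{\infty,\infty}}=\sup_{q\ge -1}\lambda_q^{-1}\|\Delta_q v\|_{L^\infty(\mathbb{T}^3)}$, taken to be $+\infty$ when $v\notin B^{-1}_{\infty,\infty}$. *)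

theory Defs
  imports "HOL-Probability.Essential_Supremum"
begin

section \<open>Smooth functions\<close>

fun iter_deriv :: "'a::real_normed_vector list \<Rightarrow> ('a \<Rightarrow> 'b::real_normed_vector) \<Rightarrow> 'a \<Rightarrow> 'b" where
  "iter_deriv [] f = f"
| "iter_deriv (v # vs) f = (\<lambda>x. frechet_derivative (iter_deriv vs f) (at x) v)"

text \<open>On a Euclidean space this is the class of infinitely differentiable functions: every iterated
  directional derivative is differentiable, hence continuous.\<close>

definition smooth :: "('a::real_normed_vector \<Rightarrow> 'b::real_normed_vector) \<Rightarrow> bool" where
  "smooth f \<longleftrightarrow> (\<forall>vs x. iter_deriv vs f differentiable (at x))"


section \<open>The torus\<close>

text \<open>The torus is represented by the cell \<open>[0, 2\<pi>]\<^sup>3\<close> with Lebesgue measure.  Elements of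
  \<open>L\<^sup>2\<close> are functions on \<open>\<real>\<^sup>3\<close> of which only the values at almost every point of the cell matter;
  smooth functions on the torus are smooth \<open>2\<pi>\<close>-periodic functions on \<open>\<real>\<^sup>3\<close>.\<close>

definition torus :: "(real^3) measure" where
  "torus = lebesgue_on (cbox 0 (\<chi> i. 2 * pi))"

definition periodic :: "(real^3 \<Rightarrow> 'b) \<Rightarrow> bool" where
  "periodic f \<longleftrightarrow> (\<forall>x i. f (x + axis i (2 * pi)) = f x)"

definition L2 :: "(real^3 \<Rightarrow> 'b::euclidean_space) \<Rightarrow> bool" where
  "L2 v \<longleftrightarrow> v \<in> borel_measurable torus \<and> integrable torus (\<lambda>x. (norm (v x))\<^sup>2)"

definition L2_norm_sq :: "(real^3 \<Rightarrow> 'b::euclidean_space) \<Rightarrow> ennreal" where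
  "L2_norm_sq v = (\<integral>\<^sup>+x. ennreal ((norm (v x))\<^sup>2) \<partial>torus)"

definition Linf_norm :: "(real^3 \<Rightarrow> 'b::real_normed_vector) \<Rightarrow> ennreal" where
  "Linf_norm v = esssup torus (\<lambda>x. ennreal (norm (v x)))"

text \<open>\<open>G x $ i $ j\<close> is the weak partial derivative of the \<open>i\<close>-th component in direction \<open>j\<close>.\<close>

definition is_weak_gradient :: "(real^3 \<Rightarrow> real^3) \<Rightarrow> (real^3 \<Rightarrow> real^3^3) \<Rightarrow> bool" where
  "is_weak_gradient v G \<longleftrightarrow> L2 G \<and>
     (\<forall>\<psi> :: real^3 \<Rightarrow> real. smooth \<psi> \<and> periodic \<psi> \<longrightarrow>
        (\<forall>i j. (\<integral>x. v x $ i * frechet_derivative \<psi> (at x) (axis j 1) \<partial>torus)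
             = - (\<integral>x. G x $ i $ j * \<psi> x \<partial>torus)))"

definition H1 :: "(real^3 \<Rightarrow> real^3) \<Rightarrow> bool" where
  "H1 v \<longleftrightarrow> L2 v \<and> (\<exists>G. is_weak_gradient v G)"

text \<open>Unique up to null sets when it exists.\<close>

definition weak_gradient :: "(real^3 \<Rightarrow> real^3) \<Rightarrow> real^3 \<Rightarrow> real^3^3" where
  "weak_gradient v = (SOME G. is_weak_gradient v G)"


section \<open>Fourier series and the Besov norm\<close>

definition rvec :: "int^3 \<Rightarrow> real^3" where
  "rvec k = (\<chi> i. real_of_int (k $ i))"

definition cvec :: "real^3 \<Rightarrow> complex^3" where
  "cvec v = (\<chi> i. complex_of_real (v $ i))"

definition fourier_coeff :: "(real^3 \<Rightarrow> real^3) \<Rightarrow> int^3 \<Rightarrow> complex^3" where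
  "fourier_coeff v k =
     (1 / (2 * pi) ^ 3) *\<^sub>R (\<integral>x. exp (- \<i> * complex_of_real (rvec k \<bullet> x)) *s cvec (v x) \<partial>torus)"

text \<open>Only used for finitely supported coefficients.\<close>

definition trig_poly :: "(int^3 \<Rightarrow> complex^3) \<Rightarrow> real^3 \<Rightarrow> complex^3" where
  "trig_poly a x = (\<Sum>k | a k \<noteq> 0. exp (\<i> * complex_of_real (rvec k \<bullet> x)) *s a k)"

definition lam :: "int \<Rightarrow> real" where
  "lam q = 2 powi q"

definition lp_cutoff :: "(real^3 \<Rightarrow> real) \<Rightarrow> bool" where
  "lp_cutoff chi \<longleftrightarrow> smooth chi \<and> (\<forall>\<xi>. 0 \<le> chi \<xi>) \<and>
     (\<forall>\<xi> \<eta>. norm \<xi> = norm \<eta> \<longrightarrow> chi \<xi> = chi \<eta>) \<and>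
     (\<forall>\<xi>. norm \<xi> \<le> 1 / 2 \<longrightarrow> chi \<xi> = 1) \<and> (\<forall>\<xi>. norm \<xi> \<ge> 1 \<longrightarrow> chi \<xi> = 0)"

definition lp_phi :: "(real^3 \<Rightarrow> real) \<Rightarrow> real^3 \<Rightarrow> real" where
  "lp_phi chi \<xi> = chi ((1 / 2) *\<^sub>R \<xi>) - chi \<xi>"

definition lp_symbol :: "(real^3 \<Rightarrow> real) \<Rightarrow> int \<Rightarrow> real^3 \<Rightarrow> real" where
  "lp_symbol chi q \<xi> = (if q = - 1 then chi \<xi> else lp_phi chi (inverse (lam q) *\<^sub>R \<xi>))"

definition lp_block :: "(real^3 \<Rightarrow> real) \<Rightarrow> int \<Rightarrow> (real^3 \<Rightarrow> real^3) \<Rightarrow> real^3 \<Rightarrow> complex^3" where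
  "lp_block chi q v = trig_poly (\<lambda>k. lp_symbol chi q (rvec k) *\<^sub>R fourier_coeff v k)"

definition besov_norm :: "(real^3 \<Rightarrow> real) \<Rightarrow> (real^3 \<Rightarrow> real^3) \<Rightarrow> ennreal" where
  "besov_norm chi v = (SUP q\<in>{-1..}. ennreal (inverse (lam q)) * Linf_norm (lp_block chi q v))"


section \<open>The initial datum\<close>

definition block_A :: "real \<Rightarrow> int \<Rightarrow> (int^3) set" where
  "block_A c n = {k. rvec k $ 1 \<in> {(1 - c) * lam n .. (1 + c) * lam n} \<and>
                     rvec k $ 2 \<in> {- c * lam n .. c * lam n} \<and>
                     rvec k $ 3 \<in> {- c * lam n .. c * lam n}}"

definition block_B :: "real \<Rightarrow> int \<Rightarrow> (int^3) set" where
  "block_B c n = {k. rvec k $ 1 \<in> {- c * lam (n - 1) .. c * lam (n - 1)} \<and>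
                     rvec k $ 2 \<in> {- c * lam (n - 1) .. c * lam (n - 1)} \<and>
                     rvec k $ 3 \<in> {(1 - c) * lam (n - 1) .. (1 + c) * lam (n - 1)}}"

definition block_C :: "real \<Rightarrow> int \<Rightarrow> (int^3) set" where
  "block_C c n = {a + b | a b. a \<in> block_A c n \<and> b \<in> block_B c n}"

definition leray_symbol :: "real^3 \<Rightarrow> real^3^3" where
  "leray_symbol \<xi> = mat 1 - (\<chi> i j. \<xi> $ i * \<xi> $ j / (norm \<xi>)\<^sup>2)"

definition e1 :: "int^3 \<Rightarrow> complex^3" where
  "e1 k = cvec (leray_symbol (rvec k) *v axis 1 1)"

definition e2 :: "int^3 \<Rightarrow> complex^3" where
  "e2 k = cvec (leray_symbol (rvec k) *v axis 2 1)"

text \<open>The coefficients of \<open>U\<^bsub>n\<^esub>\<close> and \<open>U\<^bsub>n-1\<^esub>\<close> for \<open>n = q\<^sub>j\<close>; both carry the factor \<open>\<lambda>\<^sub>n\<^sup>-\<^sup>2\<close>.\<close>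

definition U_high_hat :: "real \<Rightarrow> int \<Rightarrow> int^3 \<Rightarrow> complex^3" where
  "U_high_hat c n k = (1 / (lam n)\<^sup>2) *\<^sub>R
     (indicator (block_A c n \<union> uminus ` block_A c n) k *s e2 k
      + (\<i> * indicator (block_C c n) k) *s (e2 k - e1 k)
      - (\<i> * indicator (uminus ` block_C c n) k) *s (e2 k - e1 k))"

definition U_low_hat :: "real \<Rightarrow> int \<Rightarrow> int^3 \<Rightarrow> complex^3" where
  "U_low_hat c n k = (1 / (lam n)\<^sup>2) *\<^sub>R
     (indicator (block_B c n \<union> uminus ` block_B c n) k *s e1 k)"

text \<open>The sequence \<open>q\<close> is indexed from \<open>0\<close>.  The coefficients are Hermitian, so each summand is
  real-valued and taking \<open>Re\<close> only changes the type.  The \<open>L\<^sup>2\<close> norm of the \<open>j\<close>-th summand is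
  \<open>O(\<lambda>\<^bsub>q j\<^esub> powr (-1/2))\<close>, so the series converges in \<open>L\<^sup>2\<close> and absolutely almost everywhere.\<close>

definition U_field :: "real \<Rightarrow> (nat \<Rightarrow> int) \<Rightarrow> real^3 \<Rightarrow> real^3" where
  "U_field c q x =
     (\<Sum>j. \<chi> i. Re ((trig_poly (U_high_hat c (q j)) x + trig_poly (U_low_hat c (q j)) x) $ i))"


section \<open>Weak solutions of the Navier-Stokes equation\<close>

definition weakly_continuous :: "real \<Rightarrow> (real \<Rightarrow> real^3 \<Rightarrow> real^3) \<Rightarrow> bool" where
  "weakly_continuous T u \<longleftrightarrow> (\<forall>t\<in>{0..<T}. L2 (u t)) \<and>
     (\<forall>w. L2 w \<longrightarrow> continuous_on {0..<T} (\<lambda>t. \<integral>x. u t x \<bullet> w x \<partial>torus))"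

text \<open>For weakly continuous \<open>u\<close> measurability in time with values in \<open>H\<^sup>1\<close> is automatic.\<close>

definition L2_H1 :: "real \<Rightarrow> (real \<Rightarrow> real^3 \<Rightarrow> real^3) \<Rightarrow> bool" where
  "L2_H1 T u \<longleftrightarrow> (AE t in lborel. t \<in> {0..<T} \<longrightarrow> H1 (u t)) \<and>
     (\<integral>\<^sup>+t\<in>{0..<T}. (L2_norm_sq (u t) + L2_norm_sq (weak_gradient (u t))) \<partial>lborel) < \<infinity>"

text \<open>Test functions on \<open>(0,T) \<times> \<T>\<^sup>3\<close> supported in the time interval \<open>[a,b]\<close>.\<close>

definition test_supp :: "real \<Rightarrow> real \<Rightarrow> (real \<times> (real^3) \<Rightarrow> 'b::real_normed_vector) \<Rightarrow> bool" where
  "test_supp a b \<phi> \<longleftrightarrow> smooth \<phi> \<and> (\<forall>t. periodic (\<lambda>x. \<phi> (t, x))) \<and>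
     (\<forall>t x. t \<notin> {a..b} \<longrightarrow> \<phi> (t, x) = 0)"

definition test_fun :: "real \<Rightarrow> (real \<times> (real^3) \<Rightarrow> 'b::real_normed_vector) \<Rightarrow> bool" where
  "test_fun T \<phi> \<longleftrightarrow> (\<exists>a b. 0 < a \<and> b < T \<and> test_supp a b \<phi>)"

text \<open>Continuity is expressed by the usual estimate: on each compact time interval the functional is
  bounded by the \<open>C\<^sup>N\<close> norm for some \<open>N\<close>.\<close>

definition distribution :: "real \<Rightarrow> ((real \<times> (real^3) \<Rightarrow> real) \<Rightarrow> real) \<Rightarrow> bool" where
  "distribution T P \<longleftrightarrow>
     (\<forall>\<phi> \<psi>. test_fun T \<phi> \<and> test_fun T \<psi> \<longrightarrow> P (\<lambda>z. \<phi> z + \<psi> z) = P \<phi> + P \<psi>) \<and>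
     (\<forall>r \<phi>. test_fun T \<phi> \<longrightarrow> P (\<lambda>z. r * \<phi> z) = r * P \<phi>) \<and>
     (\<forall>a b. 0 < a \<and> b < T \<longrightarrow> (\<exists>N C. \<forall>\<phi> M. test_supp a b \<phi> \<and>
        (\<forall>vs z. set vs \<subseteq> Basis \<and> length vs \<le> N \<longrightarrow> \<bar>iter_deriv vs \<phi> z\<bar> \<le> M) \<longrightarrow> \<bar>P \<phi>\<bar> \<le> C * M))"

definition deriv_t :: "(real \<times> (real^3) \<Rightarrow> 'b::real_normed_vector) \<Rightarrow> real \<times> (real^3) \<Rightarrow> 'b" where
  "deriv_t \<phi> = iter_deriv [(1, 0)] \<phi>"

definition deriv_x :: "3 \<Rightarrow> (real \<times> (real^3) \<Rightarrow> 'b::real_normed_vector) \<Rightarrow> real \<times> (real^3) \<Rightarrow> 'b" where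
  "deriv_x j \<phi> = iter_deriv [(0, axis j 1)] \<phi>"

definition laplacian_x :: "(real \<times> (real^3) \<Rightarrow> 'b::real_normed_vector) \<Rightarrow> real \<times> (real^3) \<Rightarrow> 'b" where
  "laplacian_x \<phi> z = (\<Sum>j\<in>UNIV. deriv_x j (deriv_x j \<phi>) z)"

definition div_x :: "(real \<times> (real^3) \<Rightarrow> real^3) \<Rightarrow> real \<times> (real^3) \<Rightarrow> real" where
  "div_x \<phi> z = (\<Sum>j\<in>UNIV. deriv_x j \<phi> z $ j)"

text \<open>For divergence-free \<open>u\<close> the distribution \<open>(u\<cdot>\<nabla>)u\<close> is \<open>div (u \<otimes> u)\<close>, which acts on \<open>\<phi>\<close> by
  \<open>- \<integral>\<integral> u \<bullet> (u\<cdot>\<nabla>)\<phi>\<close>.  The pressure \<open>P\<close> enters through \<open>\<langle>\<nabla>p, \<phi>\<rangle> = - \<langle>p, div \<phi>\<rangle>\<close>.\<close>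

definition ns_distributional :: "real \<Rightarrow> real \<Rightarrow> (real \<Rightarrow> real^3 \<Rightarrow> real^3) \<Rightarrow> bool" where
  "ns_distributional \<nu> T u \<longleftrightarrow>
     (\<forall>\<psi> :: real \<times> (real^3) \<Rightarrow> real. test_fun T \<psi> \<longrightarrow>
        (LBINT t:{0<..<T}. (\<integral>x. (\<Sum>j\<in>UNIV. u t x $ j * deriv_x j \<psi> (t, x)) \<partial>torus)) = 0) \<and>
     (\<exists>P. distribution T P \<and>
        (\<forall>\<phi> :: real \<times> (real^3) \<Rightarrow> real^3. test_fun T \<phi> \<longrightarrow>
           (LBINT t:{0<..<T}. (\<integral>x. (u t x \<bullet> deriv_t \<phi> (t, x)
              + u t x \<bullet> (\<Sum>j\<in>UNIV. u t x $ j *\<^sub>R deriv_x j \<phi> (t, x))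
              + \<nu> * (u t x \<bullet> laplacian_x \<phi> (t, x))) \<partial>torus)) + P (div_x \<phi>) = 0))"

definition ns_weak_solution ::
    "real \<Rightarrow> real \<Rightarrow> (real^3 \<Rightarrow> real^3) \<Rightarrow> (real \<Rightarrow> real^3 \<Rightarrow> real^3) \<Rightarrow> bool" where
  "ns_weak_solution \<nu> T u0 u \<longleftrightarrow> weakly_continuous T u \<and> L2_H1 T u \<and>
     ns_distributional \<nu> T u \<and> (AE x in torus. u 0 x = u0 x)"

definition energy_inequality ::
    "real \<Rightarrow> real \<Rightarrow> (real^3 \<Rightarrow> real^3) \<Rightarrow> (real \<Rightarrow> real^3 \<Rightarrow> real^3) \<Rightarrow> bool" where
  "energy_inequality \<nu> T u0 u \<longleftrightarrow> (\<forall>t. 0 < t \<and> t < T \<longrightarrow>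
     L2_norm_sq (u t)
       + ennreal (2 * \<nu>) * (\<integral>\<^sup>+s\<in>{0..t}. L2_norm_sq (weak_gradient (u s)) \<partial>lborel)
     \<le> L2_norm_sq u0)"

end

theory Submission
  imports Defs
begin

text \<open>
  Suppose that \<open>u(t) - U\<close> stays below \<open>\<delta>\<close> in the Besov norm for small \<open>t > 0\<close>.  Fix a large \<open>j\<close>, write
  \<open>\<lambda>\<close> for \<open>\<lambda>\<^bsub>q j\<^esub>\<close>, and test the equation against \<open>\<eta>(t) V(x)\<close>, where \<open>\<eta>\<close> is a bump
  function and \<open>V\<close> is a divergence-free trigonometric polynomial with coefficients of size \<open>1\<close> on a box around
  the frequencies of \<open>C\<^sub>j\<close>.  Split \<open>u\<close> into its frequencies below \<open>16\<lambda>\<close> and a remainder of \<open>L\<^sup>2\<close> norm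
  \<open>O(\<lambda>\<^sup>-\<^sup>1 \<parallel>\<nabla>u\<parallel>)\<close>.  As the \<open>q\<^sub>i\<close> are lacunary, the low frequencies are \<open>U\<^bsub>q j\<^esub> + U\<^bsub>q j-1\<^esub> + z\<close>, where \<open>z\<close>
  consists of the earlier blocks, bounded by \<open>O(\<lambda>\<^sup>1\<^sup>/\<^sup>2)\<close>, and of a truncation of \<open>u - U\<close>, bounded by \<open>O(\<delta>\<lambda>)\<close>.

  In the transport term the interaction of \<open>A\<^sub>j\<close> with \<open>B\<^sub>j\<close> contributes at least \<open>c\<^sup>6 \<lambda>\<^sup>3\<close>.  All other
  interactions, and the viscous and time-derivative terms, are \<open>O(\<delta>\<lambda>\<^sup>3)\<close> up to terms that are
  \<open>O(\<lambda>\<^sup>5\<^sup>/\<^sup>2)\<close> after integration in time; here one uses that \<open>V\<close> has no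
  frequencies below \<open>\<lambda>/2\<close>, so that one factor \<open>z\<close> may be replaced by its frequencies above \<open>\<lambda>/8\<close>, which
  have \<open>L\<^sup>2\<close> norm \<open>O(\<lambda>\<^sup>-\<^sup>1\<^sup>/\<^sup>2 + \<lambda>\<^sup>-\<^sup>1 \<parallel>\<nabla>u\<parallel>)\<close>.  Letting \<open>j\<close> tend to infinity gives a contradiction when
  \<open>\<delta>\<close> is small compared with \<open>c\<^sup>6\<close>.  This \<open>\<delta>\<close> depends on \<open>c\<close> alone.
\<close>

section \<open>Square-integrable functions on the torus\<close>

text \<open>The obstacle is that a Besov bound on \<open>u - U\<close> limits its truncations only
  to size \<delta>\<lambda> pointwise, the same power of \<lambda> as U itself. Terms linear in this
  difference are of the order of the main term, so only the smallness of \<delta> beats them.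
  Quadratic terms are worse: the gradient of V has L2 norm of order
  \<open>\<lambda>\<^sup>5\<^sup>/\<^sup>2\<close>, so next to a factor bounded by \<delta>\<lambda>
  the other one must have L2 norm \<open>\<lambda>\<^sup>-\<^sup>1\<^sup>/\<^sup>2\<close>, while
  the energy gives only a constant. Discarding pairs of low frequencies, which cannot reach V,
  provides the missing power. The bounds at a fixed time contain the gradient norm, which is
  uncontrolled at individual times. Hence the bump is fixed once, the errors are kept at most linear
  in the integrable dissipation, and only then does j grow. The viscous term has a lower power of
  \<lambda>, which keeps \<delta> free of \<nu>. The main term cannot cancel: after symmetrisation
  every resonant pair of frequencies has nonnegative real part. The bound 1/100 on c makes the
  blocks thin enough for resonance to be decided by linear inequalities.\<close>

lemma torus_finite: "finite_measure torus"
  unfolding torus_def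
  by (rule finite_measure_lebesgue_on) simp

lemma space_torus: "space torus = cbox 0 (\<chi> i. 2 * pi)"
  by (simp add: torus_def)

interpretation torus: finite_measure torus by (rule torus_finite)

definition l2norm :: "(real^3 \<Rightarrow> 'b::euclidean_space) \<Rightarrow> real" where
  "l2norm f = sqrt (\<integral>x. (norm (f x))\<^sup>2 \<partial>torus)"

lemma l2norm_nonneg [simp]: "0 \<le> l2norm f"
  by (simp add: l2norm_def)

lemma l2norm_sq: "(l2norm f)\<^sup>2 = (\<integral>x. (norm (f x))\<^sup>2 \<partial>torus)"
  by (simp add: l2norm_def)

lemma L2_measurable [measurable_dest]: "L2 f \<Longrightarrow> f \<in> borel_measurable torus"
  and L2_integrable_sq: "L2 f \<Longrightarrow> integrable torus (\<lambda>x. (norm (f x))\<^sup>2)"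
  by (auto simp: L2_def)

lemma L2_bounded:
  fixes f :: "real^3 \<Rightarrow> 'b::euclidean_space"
  assumes [measurable]: "f \<in> borel_measurable torus" and "AE x in torus. norm (f x) \<le> B"
  shows "L2 f"
  unfolding L2_def
proof
  show "integrable torus (\<lambda>x. (norm (f x))\<^sup>2)"
  proof (rule torus.integrable_const_bound[where B="B\<^sup>2"])
    show "AE x in torus. norm ((norm (f x))\<^sup>2) \<le> B\<^sup>2"
      using assms(2) by eventually_elim (auto intro!: power_mono)
  qed measurable
qed fact

lemma L2_prod_norm:
  fixes f :: "real^3 \<Rightarrow> 'b::euclidean_space" and g :: "real^3 \<Rightarrow> 'c::euclidean_space"
  assumes f: "L2 f" and g: "L2 g"
  shows "integrable torus (\<lambda>x. norm (f x) * norm (g x))"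
    and "(\<integral>x. norm (f x) * norm (g x) \<partial>torus) \<le> l2norm f * l2norm g"
proof -
  have [measurable]: "f \<in> borel_measurable torus" "g \<in> borel_measurable torus"
    using f g by (auto dest: L2_measurable)
  have "integrable torus (\<lambda>x. (norm (f x))\<^sup>2 + (norm (g x))\<^sup>2)"
    using f g by (intro Bochner_Integration.integrable_add L2_integrable_sq)
  then show int: "integrable torus (\<lambda>x. norm (f x) * norm (g x))"
  proof (rule Bochner_Integration.integrable_bound)
    have "norm (f x) * norm (g x) \<le> (norm (f x))\<^sup>2 + (norm (g x))\<^sup>2" for x
    proof -
      have "0 \<le> (norm (f x) - norm (g x))\<^sup>2" "0 \<le> norm (f x) * norm (g x)" by auto
      then show ?thesis unfolding power2_diff by linarith
    qed
    then show "AE x in torus. norm (norm (f x) * norm (g x)) \<le> norm ((norm (f x))\<^sup>2 + (norm (g x))\<^sup>2)"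
      by auto
  qed measurable
  have nn: "0 \<le> (\<integral>x. norm (f x) * norm (g x) \<partial>torus)"
    by (rule integral_nonneg_AE) auto
  have "(\<integral>\<^sup>+x. ennreal (norm (f x)) * ennreal (norm (g x)) \<partial>torus)\<^sup>2
      \<le> (\<integral>\<^sup>+x. (ennreal (norm (f x)))\<^sup>2 \<partial>torus) * (\<integral>\<^sup>+x. (ennreal (norm (g x)))\<^sup>2 \<partial>torus)"
    by (rule Cauchy_Schwarz_nn_integral) measurable
  also have "(\<integral>\<^sup>+x. ennreal (norm (f x)) * ennreal (norm (g x)) \<partial>torus)
      = ennreal (\<integral>x. norm (f x) * norm (g x) \<partial>torus)"
    by (simp add: nn_integral_eq_integral[OF int] flip: ennreal_mult)
  also have "(\<integral>\<^sup>+x. (ennreal (norm (f x)))\<^sup>2 \<partial>torus) = ennreal ((l2norm f)\<^sup>2)"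
    unfolding l2norm_sq by (simp add: ennreal_power nn_integral_eq_integral[OF L2_integrable_sq[OF f]])
  also have "(\<integral>\<^sup>+x. (ennreal (norm (g x)))\<^sup>2 \<partial>torus) = ennreal ((l2norm g)\<^sup>2)"
    unfolding l2norm_sq by (simp add: ennreal_power nn_integral_eq_integral[OF L2_integrable_sq[OF g]])
  finally have "(\<integral>x. norm (f x) * norm (g x) \<partial>torus)\<^sup>2 \<le> (l2norm f * l2norm g)\<^sup>2"
    using nn by (simp add: ennreal_power power_mult_distrib flip: ennreal_mult)
  then show "(\<integral>x. norm (f x) * norm (g x) \<partial>torus) \<le> l2norm f * l2norm g"
    by (rule power2_le_imp_le) simp
qed

lemma L2_add:
  assumes f: "L2 f" and g: "L2 g"
  shows "L2 (\<lambda>x. f x + g x)" and "l2norm (\<lambda>x. f x + g x) \<le> l2norm f + l2norm g"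
proof -
  have [measurable]: "f \<in> borel_measurable torus" "g \<in> borel_measurable torus"
    using f g by (auto dest: L2_measurable)
  have int: "integrable torus (\<lambda>x. (norm (f x))\<^sup>2 + (norm (g x))\<^sup>2 + 2 * (norm (f x) * norm (g x)))"
    using f g by (intro Bochner_Integration.integrable_add L2_integrable_sq integrable_mult_right L2_prod_norm)
  have le: "(norm (f x + g x))\<^sup>2 \<le> (norm (f x))\<^sup>2 + (norm (g x))\<^sup>2 + 2 * (norm (f x) * norm (g x))" for x
    using power_mono[OF norm_triangle_ineq[of "f x" "g x"], of 2] by (simp add: power2_sum)
  have int': "integrable torus (\<lambda>x. (norm (f x + g x))\<^sup>2)"
    by (rule Bochner_Integration.integrable_bound[OF int]) (use le in \<open>auto intro: order_trans[OF le]\<close>)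
  then show "L2 (\<lambda>x. f x + g x)" by (simp add: L2_def)
  have "(l2norm (\<lambda>x. f x + g x))\<^sup>2 \<le> (\<integral>x. (norm (f x))\<^sup>2 + (norm (g x))\<^sup>2 + 2 * (norm (f x) * norm (g x)) \<partial>torus)"
    unfolding l2norm_sq by (rule integral_mono[OF int' int le])
  also have "\<dots> = (l2norm f)\<^sup>2 + (l2norm g)\<^sup>2 + 2 * (\<integral>x. norm (f x) * norm (g x) \<partial>torus)"
    using f g by (simp add: l2norm_sq L2_integrable_sq L2_prod_norm)
  also have "\<dots> \<le> (l2norm f + l2norm g)\<^sup>2"
    using L2_prod_norm(2)[OF f g] by (simp add: power2_sum)
  finally show "l2norm (\<lambda>x. f x + g x) \<le> l2norm f + l2norm g"
    by (rule power2_le_imp_le) simp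
qed

lemma L2_uminus: "L2 f \<Longrightarrow> L2 (\<lambda>x. - f x)" and l2norm_uminus: "l2norm (\<lambda>x. - f x) = l2norm f"
  by (auto simp: L2_def l2norm_def)

lemma L2_diff:
  assumes "L2 f" "L2 g"
  shows "L2 (\<lambda>x. f x - g x)" and "l2norm (\<lambda>x. f x - g x) \<le> l2norm f + l2norm g"
  using L2_add[OF assms(1) L2_uminus[OF assms(2)]] by (simp_all add: l2norm_uminus)

lemma L2_of_real: "L2 f \<Longrightarrow> L2 (\<lambda>x. complex_of_real (f x))"
  and l2norm_of_real: "l2norm (\<lambda>x. complex_of_real (f x)) = l2norm f"
  by (auto simp: L2_def l2norm_def)

lemma L2_component: "L2 f \<Longrightarrow> L2 (\<lambda>x. f x $ i)"
  and l2norm_component: "L2 f \<Longrightarrow> l2norm (\<lambda>x. f x $ i) \<le> l2norm f"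
  for f :: "real^3 \<Rightarrow> 'b::euclidean_space^'n"
proof -
  assume f: "L2 f"
  note [measurable] = L2_measurable[OF f]
  have m: "(\<lambda>x. f x $ i) \<in> borel_measurable torus"
    by (rule borel_measurable_continuous_onI[THEN measurable_compose_rev])
       (auto intro!: continuous_intros)
  have le: "(norm (f x $ i))\<^sup>2 \<le> (norm (f x))\<^sup>2" for x
    by (intro power_mono Finite_Cartesian_Product.norm_nth_le) auto
  have int: "integrable torus (\<lambda>x. (norm (f x $ i))\<^sup>2)"
    by (rule Bochner_Integration.integrable_bound[OF L2_integrable_sq[OF f]]) (use m le in auto)
  then show "L2 (\<lambda>x. f x $ i)" using m by (simp add: L2_def)
  show "l2norm (\<lambda>x. f x $ i) \<le> l2norm f"
    unfolding l2norm_def by (intro real_sqrt_le_mono integral_mono int L2_integrable_sq f le)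
qed

lemma L2_mult_integrable:
  fixes f g :: "real^3 \<Rightarrow> 'a::{real_normed_field,euclidean_space}"
  assumes f: "L2 f" and g: "L2 g"
  shows "integrable torus (\<lambda>x. f x * g x)" and "norm (\<integral>x. f x * g x \<partial>torus) \<le> l2norm f * l2norm g"
proof -
  have [measurable]: "f \<in> borel_measurable torus" "g \<in> borel_measurable torus"
    using f g by (auto dest: L2_measurable)
  show int: "integrable torus (\<lambda>x. f x * g x)"
    by (rule Bochner_Integration.integrable_bound[OF L2_prod_norm(1)[OF f g]]) (auto simp: norm_mult)
  have "norm (\<integral>x. f x * g x \<partial>torus) \<le> (\<integral>x. norm (f x * g x) \<partial>torus)"
    by (rule integral_norm_bound)
  also have "\<dots> \<le> l2norm f * l2norm g" using L2_prod_norm(2)[OF f g] by (simp add: norm_mult)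
  finally show "norm (\<integral>x. f x * g x \<partial>torus) \<le> l2norm f * l2norm g" .
qed

lemma L2_mult_bounded:
  fixes f g :: "real^3 \<Rightarrow> 'a::{real_normed_field,euclidean_space}"
  assumes f: "f \<in> borel_measurable torus" "AE x in torus. norm (f x) \<le> B" and g: "L2 g" and B: "0 \<le> B"
  shows "L2 (\<lambda>x. f x * g x)" and "l2norm (\<lambda>x. f x * g x) \<le> B * l2norm g"
proof -
  have [measurable]: "f \<in> borel_measurable torus" "g \<in> borel_measurable torus"
    using f g by (auto dest: L2_measurable)
  have int: "integrable torus (\<lambda>x. B\<^sup>2 * (norm (g x))\<^sup>2)"
    by (intro integrable_mult_right L2_integrable_sq g)
  have le: "AE x in torus. (norm (f x * g x))\<^sup>2 \<le> B\<^sup>2 * (norm (g x))\<^sup>2"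
    using f(2) by eventually_elim (auto simp: norm_mult power_mult_distrib intro!: mult_right_mono power_mono)
  have int': "integrable torus (\<lambda>x. (norm (f x * g x))\<^sup>2)"
    by (rule Bochner_Integration.integrable_bound[OF int]) (use le in auto)
  then show "L2 (\<lambda>x. f x * g x)" by (simp add: L2_def)
  have "(l2norm (\<lambda>x. f x * g x))\<^sup>2 \<le> (\<integral>x. B\<^sup>2 * (norm (g x))\<^sup>2 \<partial>torus)"
    unfolding l2norm_sq by (rule integral_mono_AE[OF int' int le])
  also have "\<dots> = (B * l2norm g)\<^sup>2" by (simp add: l2norm_sq power_mult_distrib)
  finally show "l2norm (\<lambda>x. f x * g x) \<le> B * l2norm g"
    by (rule power2_le_imp_le) (simp add: B)
qed

lemma L2_const: "L2 (\<lambda>x. c)"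
  by (rule L2_bounded[where B="norm c"]) auto

lemma L2_integrable: "L2 f \<Longrightarrow> integrable torus f"
proof -
  assume f: "L2 f"
  note [measurable] = L2_measurable[OF f]
  show "integrable torus f"
    by (rule Bochner_Integration.integrable_bound[OF L2_prod_norm(1)[OF f L2_const[of "1::real"]]]) auto
qed

lemma L2_continuous:
  fixes f :: "real^3 \<Rightarrow> 'b::euclidean_space"
  assumes "continuous_on UNIV f"
  shows "L2 f"
proof -
  have m: "f \<in> borel_measurable torus"
    using assms unfolding torus_def
    by (intro continuous_imp_measurable_on_sets_lebesgue continuous_on_subset[OF assms]) auto
  have "compact (f ` cbox 0 (\<chi> i. 2 * pi))"
    by (intro compact_continuous_image continuous_on_subset[OF assms]) auto
  then obtain B where "\<forall>x\<in>cbox 0 (\<chi> i. 2 * pi). norm (f x) \<le> B"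
    using compact_imp_bounded bounded_iff by (metis image_eqI)
  then show ?thesis
    by (intro L2_bounded[OF m, of B] AE_I2) (auto simp: space_torus)
qed

section \<open>Fourier coefficients\<close>

definition fexp :: "int^3 \<Rightarrow> real^3 \<Rightarrow> complex" where
  "fexp k x = exp (\<i> * complex_of_real (rvec k \<bullet> x))"

text \<open>Scalar version of \<open>fourier_coeff\<close>: the proof works with complex components,
  and \<open>fourier_coeff_nth\<close> connects the two.\<close>

definition fc :: "(real^3 \<Rightarrow> complex) \<Rightarrow> int^3 \<Rightarrow> complex" where
  "fc f k = (\<integral>x. fexp (- k) x * f x \<partial>torus) / (2 * pi) ^ 3"

text \<open>Carrying the index set as a parameter makes the sum linear in the coefficients;
  \<open>trig_poly\<close>, which sums over the nonzero coefficients, is reduced to it by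
  \<open>trig_poly_nth\<close>.\<close>

definition tpoly :: "(int^3) set \<Rightarrow> (int^3 \<Rightarrow> complex) \<Rightarrow> real^3 \<Rightarrow> complex" where
  "tpoly F a x = (\<Sum>k\<in>F. a k * fexp k x)"

definition cube :: "nat \<Rightarrow> (int^3) set" where
  "cube N = {k. \<forall>i. \<bar>k $ i\<bar> \<le> int N}"

lemma finite_cube [simp]: "finite (cube N)"
proof -
  have "cube N \<subseteq> vec_lambda ` (UNIV \<rightarrow>\<^sub>E {- int N..int N})"
  proof
    fix k :: "int^3" assume "k \<in> cube N"
    then have "k = vec_lambda (vec_nth k)" "vec_nth k \<in> UNIV \<rightarrow>\<^sub>E {- int N..int N}"
      by (auto simp: cube_def abs_le_iff) (metis minus_le_iff)
    then show "k \<in> vec_lambda ` (UNIV \<rightarrow>\<^sub>E {- int N..int N})" by blast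
  qed
  then show ?thesis by (rule finite_subset) (intro finite_imageI finite_PiE; simp)
qed

lemma cube_mono: "M \<le> N \<Longrightarrow> cube M \<subseteq> cube N"
  by (auto simp: cube_def intro: order_trans)

lemma finite_subset_cube:
  assumes "finite F" shows "\<exists>N. F \<subseteq> cube N"
proof -
  obtain N where N: "\<And>k. k \<in> F \<Longrightarrow> Max (range (\<lambda>i. nat \<bar>k $ i\<bar>)) \<le> N"
    using assms finite_imageI[OF assms, of "\<lambda>k. Max (range (\<lambda>i. nat \<bar>k $ i\<bar>))"]
    by (meson Max_ge finite_imageI imageI)
  have "k \<in> cube N" if "k \<in> F" for k
    unfolding cube_def
  proof safe
    fix i
    have "nat \<bar>k $ i\<bar> \<le> Max (range (\<lambda>i. nat \<bar>k $ i\<bar>))" by (rule Max_ge) auto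
    with N[OF that] show "\<bar>k $ i\<bar> \<le> int N" by linarith
  qed
  then show ?thesis by blast
qed

lemma rvec_add: "rvec (k + l) = rvec k + rvec l"
  and rvec_minus: "rvec (- k) = - rvec k"
  and rvec_0 [simp]: "rvec 0 = 0"
  and rvec_nth [simp]: "rvec k $ i = of_int (k $ i)"
  by (auto simp: rvec_def vec_eq_iff)

lemma rvec_eq_0_iff [simp]: "rvec k = 0 \<longleftrightarrow> k = 0"
  by (auto simp: rvec_def vec_eq_iff)

lemma norm_rvec_sq: "(norm (rvec k))\<^sup>2 = (\<Sum>j\<in>UNIV. (real_of_int (k $ j))\<^sup>2)"
  by (simp add: norm_vec_def L2_set_def sum_nonneg)

lemma fexp_mult: "fexp k x * fexp l x = fexp (k + l) x"
  by (simp add: fexp_def rvec_add inner_add_left exp_add ring_distribs)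

lemma fexp_0 [simp]: "fexp 0 x = 1"
  by (simp add: fexp_def)

lemma norm_fexp [simp]: "norm (fexp k x) = 1"
  by (simp add: fexp_def)

lemma cnj_fexp: "cnj (fexp k x) = fexp (- k) x"
  by (simp add: fexp_def exp_cnj rvec_minus)

lemma continuous_fexp: "continuous_on S (fexp k)"
  unfolding fexp_def by (intro continuous_intros)

lemma L2_fexp: "L2 (fexp k)"
  by (intro L2_continuous continuous_fexp)

lemma fexp_measurable [measurable]: "fexp k \<in> borel_measurable torus"
  by (rule L2_measurable[OF L2_fexp])

lemma continuous_tpoly: "continuous_on S (tpoly F a)"
  unfolding tpoly_def by (intro continuous_intros continuous_fexp)

lemma L2_tpoly: "L2 (tpoly F a)"
  by (intro L2_continuous continuous_tpoly)

lemma L2_cmult: "L2 f \<Longrightarrow> L2 (\<lambda>x. c * f x)" for f :: "real^3 \<Rightarrow> complex"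
  by (rule L2_mult_bounded[where B="norm c"]) auto

lemma L2_fexp_mult:
  assumes "L2 f" shows "L2 (\<lambda>x. fexp k x * f x)"
  by (rule L2_mult_bounded[where B=1]) (auto simp: assms)

lemma integrable_fexp_mult:
  fixes f :: "real^3 \<Rightarrow> complex"
  assumes f: "integrable torus f" shows "integrable torus (\<lambda>x. fexp k x * f x)"
proof -
  have [measurable]: "f \<in> borel_measurable torus" using f by auto
  show ?thesis
    by (rule Bochner_Integration.integrable_bound[OF f]) (auto simp: norm_mult)
qed

text \<open>Fubini, through Lebesgue measure as a product over the basis. It reduces the
  orthogonality of the exponentials to one variable.\<close>

lemma integral_lborel_prod:
  fixes f :: "'a::euclidean_space \<Rightarrow> real \<Rightarrow> complex"
  assumes f: "\<And>b. b \<in> Basis \<Longrightarrow> integrable lborel (f b)"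
  shows "(\<integral>x. (\<Prod>b\<in>Basis. f b (x \<bullet> b)) \<partial>lborel) = (\<Prod>b\<in>(Basis::'a set). \<integral>y. f b y \<partial>lborel)"
proof -
  interpret P: product_sigma_finite "\<lambda>_::'a. lborel :: real measure" by standard
  have [measurable]: "b \<in> Basis \<Longrightarrow> f b \<in> borel_measurable borel" for b
    using f[of b] by auto
  have "(\<integral>x. (\<Prod>b\<in>Basis. f b (x \<bullet> b)) \<partial>lborel) =
     (\<integral>x. (\<Prod>b\<in>Basis. f b ((\<Sum>b\<in>Basis. x b *\<^sub>R b) \<bullet> b)) \<partial>(\<Pi>\<^sub>M b\<in>(Basis::'a set). lborel))"
    by (subst lborel_eq, subst integral_distr) auto
  also have "\<dots> = (\<integral>x. (\<Prod>b\<in>Basis. f b (x b)) \<partial>(\<Pi>\<^sub>M b\<in>(Basis::'a set). lborel))"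
    by (simp add: inner_sum_left_Basis)
  also have "\<dots> = (\<Prod>b\<in>(Basis::'a set). \<integral>y. f b y \<partial>lborel)"
    by (rule P.product_integral_prod) (auto simp: f)
  finally show ?thesis .
qed

lemma integral_exp_Icc:
  fixes n :: int
  shows "integrable lborel (\<lambda>y. indicator {0..2*pi} y *\<^sub>R exp (\<i> * complex_of_real (of_int n * y)))"
    and "(\<integral>y. indicator {0..2*pi} y *\<^sub>R exp (\<i> * complex_of_real (of_int n * y)) \<partial>lborel) = (if n = 0 then 2 * pi else 0)"
proof -
  have cont: "continuous_on {0..2*pi} (\<lambda>y. exp (\<i> * complex_of_real (of_int n * y)))"
    by (intro continuous_intros)
  show "integrable lborel (\<lambda>y. indicator {0..2*pi} y *\<^sub>R exp (\<i> * complex_of_real (of_int n * y)))"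
    using borel_integrable_atLeastAtMost'[OF cont] by (simp add: set_integrable_def)
  show "(\<integral>y. indicator {0..2*pi} y *\<^sub>R exp (\<i> * complex_of_real (of_int n * y)) \<partial>lborel) = (if n = 0 then 2 * pi else 0)"
  proof (cases "n = 0")
    case False
    define F where "F = (\<lambda>y. exp (\<i> * of_int n * complex_of_real y) / (\<i> * of_int n))"
    have "(\<integral>y. indicator {0..2*pi} y *\<^sub>R exp (\<i> * complex_of_real (of_int n * y)) \<partial>lborel) = F (2 * pi) - F 0"
    proof (rule integral_FTC_Icc[OF _ _ cont])
      fix y :: real
      have "((\<lambda>z. exp (\<i> * of_int n * z) / (\<i> * of_int n)) has_field_derivative exp (\<i> * complex_of_real (of_int n * y))) (at (complex_of_real y))"
        using False by (auto intro!: derivative_eq_intros simp: mult_ac)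
      then show "(F has_vector_derivative exp (\<i> * complex_of_real (of_int n * y))) (at y within {0..2*pi})"
        unfolding F_def by (rule has_vector_derivative_real_field)
    qed simp
    also have "F (2 * pi) = F 0"
    proof -
      have "exp (\<i> * of_int n * complex_of_real (2 * pi)) = exp (of_int (2 * n) * (of_real pi * \<i>))"
        by (simp add: mult_ac)
      also have "\<dots> = 1" by (simp add: exp_eq_1)
      finally show ?thesis by (simp add: F_def)
    qed
    finally show ?thesis using False by simp
  qed (simp add: measure_def scaleR_conv_of_real)
qed

lemma integral_torus_lborel:
  fixes f :: "real^3 \<Rightarrow> 'b::{banach,second_countable_topology}"
  assumes [measurable]: "f \<in> borel_measurable borel"
  shows "(\<integral>x. f x \<partial>torus) = (\<integral>x. indicator (cbox 0 (\<chi> i. 2 * pi)) x *\<^sub>R f x \<partial>lborel)"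
  unfolding torus_def
  by (subst integral_restrict_space) (auto simp: integral_completion)

lemma integral_fexp: "(\<integral>x. fexp k x \<partial>torus) = (if k = 0 then (2 * pi) ^ 3 else 0)"
proof -
  define g where "g = (\<lambda>b::real^3. \<lambda>y. indicator {0..2*pi} y *\<^sub>R exp (\<i> * complex_of_real ((rvec k \<bullet> b) * y)))"
  have int: "\<exists>n. rvec k \<bullet> b = of_int n" if "b \<in> Basis" for b
    using that by (auto simp: Basis_vec_def inner_axis)
  have g: "integrable lborel (g b)" "(\<integral>y. g b y \<partial>lborel) = (if rvec k \<bullet> b = 0 then 2 * pi else 0)"
    if "b \<in> Basis" for b
    using int[OF that] integral_exp_Icc unfolding g_def by (auto simp: scaleR_conv_of_real)
  have eq: "indicator (cbox 0 (\<chi> i. 2 * pi)) x *\<^sub>R fexp k x = (\<Prod>b\<in>Basis. g b (x \<bullet> b))" for x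
  proof -
    have "indicator (cbox 0 (\<chi> i. 2 * pi)) x = (\<Prod>b\<in>Basis. indicator {0..2*pi} (x \<bullet> b) :: real)"
    proof -
      have "x \<in> cbox 0 (\<chi> i. 2 * pi) \<longleftrightarrow> (\<forall>b\<in>Basis. x \<bullet> b \<in> {0..2*pi})"
        by (auto simp: mem_box Basis_vec_def inner_axis)
      then show ?thesis by (auto simp: indicator_def)
    qed
    moreover have "fexp k x = (\<Prod>b\<in>Basis. exp (\<i> * complex_of_real ((rvec k \<bullet> b) * (x \<bullet> b))))"
      unfolding fexp_def by (subst euclidean_inner) (simp add: sum_distrib_left exp_sum)
    ultimately show ?thesis
      by (simp add: g_def scaleR_conv_of_real prod.distrib)
  qed
  have "(\<integral>x. fexp k x \<partial>torus) = (\<integral>x. (\<Prod>b\<in>Basis. g b (x \<bullet> b)) \<partial>lborel)"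
    by (subst integral_torus_lborel) (auto simp: eq continuous_fexp intro!: borel_measurable_continuous_onI)
  also have "\<dots> = (\<Prod>b\<in>(Basis::(real^3) set). if rvec k \<bullet> b = 0 then 2 * pi else 0)"
    by (subst integral_lborel_prod) (auto simp: g)
  also have "\<dots> = (if k = 0 then (2 * pi) ^ 3 else 0)"
  proof (cases "k = 0")
    case False
    then have "\<exists>b\<in>Basis. rvec k \<bullet> b \<noteq> 0" by (metis euclidean_all_zero_iff rvec_eq_0_iff)
    with False show ?thesis by (auto intro!: prod_zero)
  qed simp
  finally show ?thesis .
qed

lemma fc_fexp_mult: "(\<integral>x. fexp k x * f x \<partial>torus) = (2 * pi) ^ 3 * fc f (- k)"
  by (simp add: fc_def)

lemma fc_tpoly:
  assumes "finite F"
  shows "fc (tpoly F a) k = (if k \<in> F then a k else 0)"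
proof -
  have "(\<integral>x. fexp (- k) x * tpoly F a x \<partial>torus) = (\<integral>x. (\<Sum>l\<in>F. a l * fexp (l - k) x) \<partial>torus)"
    unfolding tpoly_def by (simp add: sum_distrib_left mult.left_commute fexp_mult)
  also have "\<dots> = (\<Sum>l\<in>F. a l * (\<integral>x. fexp (l - k) x \<partial>torus))"
    by (subst Bochner_Integration.integral_sum) (auto intro!: L2_integrable L2_cmult L2_fexp)
  also have "\<dots> = (\<Sum>l\<in>F. if l = k then (2 * pi) ^ 3 * a k else 0)"
    by (rule sum.cong) (auto simp: integral_fexp)
  also have "\<dots> = (if k \<in> F then (2 * pi) ^ 3 * a k else 0)" using assms by simp
  finally show ?thesis by (simp add: fc_def)
qed

lemma integral_cnj: "(\<integral>x. cnj (f x) \<partial>M) = cnj (\<integral>x. f x \<partial>M)"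
  by (cases "integrable M f")
     (auto simp: integral_bounded_linear[OF bounded_linear_cnj] not_integrable_integral_eq
       dest: integrable_bounded_linear[OF bounded_linear_cnj, of M "\<lambda>x. cnj (f x)"])

lemma l2norm_sq_complex:
  "complex_of_real ((l2norm f)\<^sup>2) = (\<integral>x. f x * cnj (f x) \<partial>torus)"
  unfolding l2norm_sq by (simp only: complex_norm_square flip: integral_complex_of_real)

lemma L2_cnj: "L2 f \<Longrightarrow> L2 (\<lambda>x. cnj (f x))"
proof -
  assume f: "L2 f"
  have [measurable]: "f \<in> borel_measurable torus" by (rule L2_measurable[OF f])
  have "(\<lambda>x. cnj (f x)) \<in> borel_measurable torus"
    by (rule borel_measurable_continuous_onI[THEN measurable_compose_rev])
       (auto intro!: continuous_intros)
  then show ?thesis using f by (auto simp: L2_def)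
qed

lemma integral_tpoly_mult:
  assumes "L2 f"
  shows "(\<integral>x. tpoly F a x * f x \<partial>torus) = (2 * pi) ^ 3 * (\<Sum>k\<in>F. a k * fc f (- k))"
proof -
  have "(\<integral>x. tpoly F a x * f x \<partial>torus) = (\<integral>x. (\<Sum>k\<in>F. a k * (fexp k x * f x)) \<partial>torus)"
    by (simp add: tpoly_def sum_distrib_right mult.assoc)
  also have "\<dots> = (\<Sum>k\<in>F. a k * (\<integral>x. fexp k x * f x \<partial>torus))"
    using assms by (subst Bochner_Integration.integral_sum) (auto intro!: L2_integrable L2_cmult L2_fexp_mult)
  finally show ?thesis unfolding fc_fexp_mult by (simp add: sum_distrib_left mult_ac)
qed

lemma fc_cnj: "fc (\<lambda>x. cnj (f x)) k = cnj (fc f (- k))"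
proof -
  have "(\<integral>x. fexp (- k) x * cnj (f x) \<partial>torus) = cnj (\<integral>x. fexp k x * f x \<partial>torus)"
    by (subst integral_cnj[symmetric]) (simp add: cnj_fexp)
  then show ?thesis by (simp add: fc_def)
qed

lemma L2_inner_tpoly:
  assumes "L2 f"
  shows "(\<integral>x. tpoly F a x * cnj (f x) \<partial>torus) = (2 * pi) ^ 3 * (\<Sum>k\<in>F. a k * cnj (fc f k))"
  by (simp add: integral_tpoly_mult L2_cnj assms fc_cnj)

text \<open>Pythagoras with the square completed, so that \<open>a\<close> enters only through the
  last sum. Bessel's inequality, the norm of a trigonometric polynomial and best approximation are
  read off from it.\<close>

lemma l2norm_diff_tpoly:
  assumes f: "L2 f" and F: "finite F"
  shows "(l2norm (\<lambda>x. f x - tpoly F a x))\<^sup>2 = (l2norm f)\<^sup>2 - (2 * pi) ^ 3 * (\<Sum>k\<in>F. (norm (fc f k))\<^sup>2)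
     + (2 * pi) ^ 3 * (\<Sum>k\<in>F. (norm (fc f k - a k))\<^sup>2)"
proof -
  let ?p = "tpoly F a" and ?c = "(2 * pi) ^ 3 :: complex"
  note int = L2_mult_integrable(1)
  have "complex_of_real ((l2norm (\<lambda>x. f x - ?p x))\<^sup>2) =
     (\<integral>x. f x * cnj (f x) - ?p x * cnj (f x) - f x * cnj (?p x) + ?p x * cnj (?p x) \<partial>torus)"
    unfolding l2norm_sq_complex by (simp add: algebra_simps)
  also have "\<dots> = (\<integral>x. f x * cnj (f x) \<partial>torus) - (\<integral>x. ?p x * cnj (f x) \<partial>torus)
     - (\<integral>x. f x * cnj (?p x) \<partial>torus) + (\<integral>x. ?p x * cnj (?p x) \<partial>torus)"
    by (simp add: int f L2_cnj L2_tpoly)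
  also have "(\<integral>x. f x * cnj (?p x) \<partial>torus) = cnj (\<integral>x. ?p x * cnj (f x) \<partial>torus)"
    by (subst integral_cnj[symmetric]) (simp add: mult.commute)
  also have "(\<integral>x. ?p x * cnj (?p x) \<partial>torus) = ?c * (\<Sum>k\<in>F. a k * cnj (a k))"
    by (subst L2_inner_tpoly) (auto simp: L2_tpoly fc_tpoly F)
  also have "(\<integral>x. ?p x * cnj (f x) \<partial>torus) = ?c * (\<Sum>k\<in>F. a k * cnj (fc f k))"
    by (rule L2_inner_tpoly[OF f])
  finally have 1: "complex_of_real ((l2norm (\<lambda>x. f x - ?p x))\<^sup>2) = complex_of_real ((l2norm f)\<^sup>2)
    - ?c * (\<Sum>k\<in>F. a k * cnj (fc f k)) - ?c * (\<Sum>k\<in>F. cnj (a k) * fc f k) + ?c * (\<Sum>k\<in>F. a k * cnj (a k))"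
    by (simp only: l2norm_sq_complex complex_cnj_mult cnj_sum complex_cnj_power complex_cnj_complex_of_real complex_cnj_numeral complex_cnj_cnj)
  have 2: "complex_of_real ((norm (fc f k - a k))\<^sup>2) = complex_of_real ((norm (fc f k))\<^sup>2)
     - a k * cnj (fc f k) - cnj (a k) * fc f k + a k * cnj (a k)" for k
    by (simp only: complex_norm_square) (simp add: algebra_simps)
  have "complex_of_real ((l2norm (\<lambda>x. f x - ?p x))\<^sup>2) = complex_of_real ((l2norm f)\<^sup>2 - (2 * pi) ^ 3 * (\<Sum>k\<in>F. (norm (fc f k))\<^sup>2)
     + (2 * pi) ^ 3 * (\<Sum>k\<in>F. (norm (fc f k - a k))\<^sup>2))"
    unfolding 1 of_real_add of_real_diff of_real_mult of_real_sum 2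
    by (simp add: sum.distrib sum_subtractf algebra_simps)
  then show ?thesis using of_real_eq_iff by blast
qed

lemma bessel:
  assumes "L2 f" "finite F"
  shows "(2 * pi) ^ 3 * (\<Sum>k\<in>F. (norm (fc f k))\<^sup>2) \<le> (l2norm f)\<^sup>2"
  using l2norm_diff_tpoly[OF assms, of "fc f"] zero_le_power2[of "l2norm (\<lambda>x. f x - tpoly F (fc f) x)"]
  by simp

lemma l2norm_tpoly:
  assumes "finite F"
  shows "(l2norm (tpoly F a))\<^sup>2 = (2 * pi) ^ 3 * (\<Sum>k\<in>F. (norm (a k))\<^sup>2)"
  using l2norm_diff_tpoly[OF L2_const[of 0] assms, of a]
  by (simp add: fc_def l2norm_def sum_nonneg)

lemma best_approx:
  assumes "L2 f" "finite F"
  shows "l2norm (\<lambda>x. f x - tpoly F (fc f) x) \<le> l2norm (\<lambda>x. f x - tpoly F a x)"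
proof (rule power2_le_imp_le)
  show "(l2norm (\<lambda>x. f x - tpoly F (fc f) x))\<^sup>2 \<le> (l2norm (\<lambda>x. f x - tpoly F a x))\<^sup>2"
    by (simp add: l2norm_diff_tpoly assms sum_nonneg)
qed simp

lemma tpoly_mono_neutral:
  assumes "finite G" "F \<subseteq> G" "\<And>k. k \<in> G - F \<Longrightarrow> a k = 0"
  shows "tpoly F a = tpoly G a"
  unfolding tpoly_def using assms by (intro ext sum.mono_neutral_left) auto

section \<open>Density of trigonometric polynomials\<close>

text \<open>Trigonometric polynomials form an algebra, so polynomials in the circle coordinates pull
  back to them.\<close>

lemma
  defines "T \<equiv> {f. \<exists>F a. finite F \<and> f = tpoly F a}"
  shows tpoly_add: "f \<in> T \<Longrightarrow> g \<in> T \<Longrightarrow> (\<lambda>x. f x + g x) \<in> T"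
    and tpoly_mult: "f \<in> T \<Longrightarrow> g \<in> T \<Longrightarrow> (\<lambda>x. f x * g x) \<in> T"
    and tpoly_fexp: "(\<lambda>x. c * fexp k x) \<in> T"
proof -
  have add: "(\<lambda>x. f x + g x) \<in> T" if fg: "f \<in> T" "g \<in> T" for f g
  proof -
    obtain F a G b where *: "finite F" "f = tpoly F a" "finite G" "g = tpoly G b"
      using fg unfolding T_def by auto
    let ?a = "\<lambda>k. if k \<in> F then a k else 0" and ?b = "\<lambda>k. if k \<in> G then b k else 0"
    have "f = tpoly (F \<union> G) ?a"
      unfolding *(2) by (subst tpoly_mono_neutral[of "F \<union> G" F ?a, symmetric]) (use * in \<open>auto simp: tpoly_def\<close>)
    moreover have "g = tpoly (F \<union> G) ?b"
      unfolding *(4) by (subst tpoly_mono_neutral[of "F \<union> G" G ?b, symmetric]) (use * in \<open>auto simp: tpoly_def\<close>)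
    ultimately have "(\<lambda>x. f x + g x) = tpoly (F \<union> G) (\<lambda>k. ?a k + ?b k)"
      by (auto simp: tpoly_def sum.distrib distrib_right)
    then show ?thesis unfolding T_def using * by blast
  qed
  then show "f \<in> T \<Longrightarrow> g \<in> T \<Longrightarrow> (\<lambda>x. f x + g x) \<in> T" .
  show single: "(\<lambda>x. c * fexp k x) \<in> T" for c k
    unfolding T_def by (auto simp: tpoly_def intro!: exI[of _ "{k}"] exI[of _ "\<lambda>_. c"])
  have sum: "(\<lambda>x. \<Sum>i\<in>I. h i x) \<in> T" if "finite I" "\<And>i. i \<in> I \<Longrightarrow> h i \<in> T" for I and h :: "'i \<Rightarrow> _"
    using that
  proof (induction I)
    case empty
    show ?case using single[of 0 0] by simp
  qed (auto intro!: add)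
  show "f \<in> T \<Longrightarrow> g \<in> T \<Longrightarrow> (\<lambda>x. f x * g x) \<in> T"
  proof -
    assume fg: "f \<in> T" "g \<in> T"
    obtain F a G b where *: "finite F" "f = tpoly F a" "finite G" "g = tpoly G b"
      using fg unfolding T_def by auto
    have "(\<lambda>x. f x * g x) = (\<lambda>x. \<Sum>k\<in>F. \<Sum>l\<in>G. (a k * b l) * fexp (k + l) x)"
      unfolding * tpoly_def sum_product fexp_mult[symmetric] by (simp add: mult_ac)
    also have "\<dots> \<in> T" using * by (intro sum single)
    finally show ?thesis .
  qed
qed

text \<open>The quotient map from the cell to the product of three unit circles; it glues opposite
  faces.\<close>

definition ucirc :: "real^3 \<Rightarrow> complex^3" where
  "ucirc x = (\<chi> i. exp (\<i> * complex_of_real (x $ i)))"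

lemma ucirc_fexp: "ucirc x $ i = fexp (axis i 1) x"
proof -
  have "rvec (axis i 1) = axis i 1" by (auto simp: rvec_def axis_def vec_eq_iff)
  then show ?thesis by (simp add: ucirc_def fexp_def inner_axis')
qed

lemma continuous_ucirc: "continuous_on S ucirc"
  unfolding ucirc_def by (intro continuous_intros)

text \<open>A real-linear functional on \<open>complex^3\<close> is determined by its values on
  \<open>axis i 1\<close> and \<open>axis i \<i>\<close>. The real and imaginary parts of a circle
  coordinate are a cosine and a sine, hence combinations of two exponentials.\<close>

lemma real_polynomial_ucirc:
  assumes "real_polynomial_function g"
  shows "\<exists>F a. finite F \<and> (\<lambda>x. complex_of_real (g (ucirc x))) = tpoly F a"
  using assms
proof induction
  case (linear f)
  have eq: "complex_of_real (f (ucirc x)) =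
     (\<Sum>i\<in>UNIV. complex_of_real (f (axis i 1) / 2) * (fexp (axis i 1) x + fexp (- axis i 1) x)
       + complex_of_real (f (axis i \<i>) / 2) * (- \<i>) * (fexp (axis i 1) x + (- 1) * fexp (- axis i 1) x))" for x
  proof -
    have lin: "linear f" using linear by (rule bounded_linear.linear)
    have "f (ucirc x) = f (\<Sum>i\<in>UNIV. Re (ucirc x $ i) *\<^sub>R axis i 1 + Im (ucirc x $ i) *\<^sub>R axis i \<i>)"
      by (rule arg_cong[where f=f]) (auto simp: vec_eq_iff axis_def complex_eq_iff if_distrib if_distribR sum.distrib cong: if_cong)
    also have "\<dots> = (\<Sum>i\<in>UNIV. Re (ucirc x $ i) * f (axis i 1) + Im (ucirc x $ i) * f (axis i \<i>))"
      by (simp add: linear_sum[OF lin] linear_add[OF lin] linear_cmul[OF lin])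
    finally show ?thesis
      by (simp add: ucirc_fexp complex_eq_iff cnj_fexp[symmetric] mult.commute)
  qed
  have sum: "(\<lambda>x. \<Sum>i\<in>I. h i x) \<in> {f. \<exists>F a. finite F \<and> f = tpoly F a}"
    if "finite I" "\<And>i. i \<in> I \<Longrightarrow> h i \<in> {f. \<exists>F a. finite F \<and> f = tpoly F a}" for I and h :: "3 \<Rightarrow> _"
    using that
  proof (induction I)
    case empty
    show ?case using tpoly_fexp[of 0 0] by simp
  next
    case (insert j I)
    then show ?case using tpoly_add[of "h j" "\<lambda>x. \<Sum>i\<in>I. h i x"] by simp
  qed
  have cm: "(\<lambda>x. c * h x) \<in> {f. \<exists>F a. finite F \<and> f = tpoly F a}" if "h \<in> {f. \<exists>F a. finite F \<and> f = tpoly F a}" for c h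
    using tpoly_mult[OF tpoly_fexp[of c 0] that] by simp
  have fx: "fexp k \<in> {f. \<exists>F a. finite F \<and> f = tpoly F a}" for k
    using tpoly_fexp[of 1 k] by simp
  have "(\<lambda>x. complex_of_real (f (ucirc x))) \<in> {f. \<exists>F a. finite F \<and> f = tpoly F a}"
    unfolding eq by (intro sum tpoly_add cm fx) auto
  then show ?case by auto
next
  case (const c)
  show ?case using tpoly_fexp[of "complex_of_real c" 0] by simp
next
  case (add f g)
  then show ?case using tpoly_add[of "\<lambda>x. complex_of_real (f (ucirc x))" "\<lambda>x. complex_of_real (g (ucirc x))"] by simp
next
  case (mult f g)
  then show ?case using tpoly_mult[of "\<lambda>x. complex_of_real (f (ucirc x))" "\<lambda>x. complex_of_real (g (ucirc x))"] by simp
qed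

abbreviation cell :: "(real^3) set" where "cell \<equiv> cbox 0 (\<chi> i. 2 * pi)"

lemma mem_cell: "x \<in> cell \<longleftrightarrow> (\<forall>i. 0 \<le> x $ i \<and> x $ i \<le> 2 * pi)"
  by (auto simp: mem_box_cart)

text \<open>As \<open>g\<close> vanishes on the faces of the cell, it descends to the product of three circles, where
  the Stone-Weierstrass theorem applies.\<close>

lemma uniform_trig_approx:
  fixes g :: "real^3 \<Rightarrow> real"
  assumes g: "continuous_on cell g" and bd: "\<And>x. x \<in> cell \<Longrightarrow> (\<exists>i. x $ i = 0 \<or> x $ i = 2 * pi) \<Longrightarrow> g x = 0"
    and e: "0 < e"
  shows "\<exists>F a. finite F \<and> (\<forall>x\<in>cell. norm (complex_of_real (g x) - tpoly F a x) < e)"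
proof -
  define r where "r = (\<lambda>z :: complex^3. (\<chi> i. Arg2pi (z $ i)) :: real^3)"
  \<comment> \<open>\<open>Arg2pi\<close> takes values in [0, 2 pi), so \<open>r\<close> inverts
    \<open>ucirc\<close> except that it moves the faces at 2 pi to the faces at 0. There
    \<open>g\<close> vanishes on both sides.\<close>
  have Arg: "Arg2pi (exp (\<i> * complex_of_real y)) = (if y = 2 * pi then 0 else y)" if "0 \<le> y" "y \<le> 2 * pi" for y
    using that Arg2pi_exp[of "\<i> * complex_of_real y"] Arg2pi_of_real[of 1] exp_two_pi_i' by (auto simp: mult_ac)
  have gr: "g (r (ucirc x)) = g x" if x: "x \<in> cell" for x
  proof (cases "\<exists>i. x $ i = 2 * pi")
    case True
    then obtain i where i: "x $ i = 2 * pi" by auto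
    have "r (ucirc x) \<in> cell" "r (ucirc x) $ i = 0"
      using x i by (auto simp: r_def ucirc_def mem_cell Arg)
    then have "g (r (ucirc x)) = 0" by (intro bd) auto
    moreover have "g x = 0" using i x by (intro bd) auto
    ultimately show ?thesis by simp
  next
    case False
    then have "r (ucirc x) = x" using x by (auto simp: r_def ucirc_def mem_cell Arg vec_eq_iff)
    then show ?thesis by simp
  qed
  define S where "S = ucirc ` cell"
  have S: "compact S" unfolding S_def by (intro compact_continuous_image continuous_ucirc) auto
  \<comment> \<open>\<open>Arg2pi\<close> is discontinuous, but continuity of
    \<open>g \<circ> r\<close> may be tested after composing with \<open>ucirc\<close>, a quotient
    map from the compact cell onto \<open>S\<close>; the composite is \<open>g\<close>
    itself.\<close>
  have cont: "continuous_on S (g \<circ> r)"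
    unfolding continuous_openin_preimage_eq
  proof (intro allI impI)
    fix B :: "real set" assume B: "open B"
    have "openin (top_of_set cell) (cell \<inter> ucirc -` (S \<inter> (g \<circ> r) -` B)) \<longleftrightarrow> openin (top_of_set S) (S \<inter> (g \<circ> r) -` B)"
      by (rule Abstract_Topology_2.continuous_imp_quotient_map) (auto simp: S_def continuous_ucirc)
    moreover have "cell \<inter> ucirc -` (S \<inter> (g \<circ> r) -` B) = cell \<inter> g -` B"
      using gr unfolding S_def by (auto simp del: mem_box_cart) (metis gr)
    ultimately show "openin (top_of_set S) (S \<inter> (g \<circ> r) -` B)"
      using g B continuous_openin_preimage_gen by metis
  qed
  obtain p where p: "real_polynomial_function p" "\<And>z. z \<in> S \<Longrightarrow> \<bar>(g \<circ> r) z - p z\<bar> < e"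
    using Stone_Weierstrass_real_polynomial_function[OF S cont e] by blast
  obtain F a where Fa: "finite F" "(\<lambda>x. complex_of_real (p (ucirc x))) = tpoly F a"
    using real_polynomial_ucirc[OF p(1)] by blast
  have "norm (complex_of_real (g x) - tpoly F a x) < e" if "x \<in> cell" for x
  proof -
    have "complex_of_real (g x) - tpoly F a x = complex_of_real (g x - p (ucirc x))"
      using fun_cong[OF Fa(2), of x] by simp
    then show ?thesis using p(2)[of "ucirc x"] gr[OF that] that
      by (simp add: S_def del: of_real_diff)
  qed
  with Fa(1) show ?thesis by blast
qed


lemma AE_torus_negligible:
  assumes "negligible N" and "\<And>x. x \<in> cell \<Longrightarrow> x \<notin> N \<Longrightarrow> P x"
  shows "AE x in torus. P x"
proof -
  have "AE x in lebesgue. x \<notin> N"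
    using assms(1) AE_not_in negligible_iff_null_sets by blast
  then show ?thesis unfolding torus_def
    by (subst AE_restrict_space_iff) (use assms(2) in auto)
qed

lemma l2norm_le_sup:
  fixes f :: "real^3 \<Rightarrow> 'b::euclidean_space"
  assumes f: "f \<in> borel_measurable torus" "AE x in torus. norm (f x) \<le> c" and c: "0 \<le> c"
  shows "l2norm f \<le> sqrt (measure torus (space torus)) * c"
proof (rule power2_le_imp_le)
  have int: "integrable torus (\<lambda>x. (norm (f x))\<^sup>2)" using L2_bounded[OF f] by (rule L2_integrable_sq)
  have "(l2norm f)\<^sup>2 \<le> (\<integral>x. c\<^sup>2 \<partial>torus)"
    unfolding l2norm_sq using int
    by (rule integral_mono_AE) (use f(2) in \<open>auto elim!: eventually_mono intro!: power_mono\<close>)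
  then show "(l2norm f)\<^sup>2 \<le> (sqrt (measure torus (space torus)) * c)\<^sup>2"
    by (simp add: power_mult_distrib)
qed (simp add: c)

definition clamp_at :: "real \<Rightarrow> real \<Rightarrow> real" where
  "clamp_at K y = max (- K) (min K y)"

lemma clamp_at_bound: "0 \<le> K \<Longrightarrow> \<bar>clamp_at K y\<bar> \<le> K"
  by (auto simp: clamp_at_def)

lemma clamp_at_measurable [measurable]: "clamp_at K \<in> borel_measurable borel"
  unfolding clamp_at_def by measurable

lemma l2norm_tendsto_0:
  fixes f :: "nat \<Rightarrow> real^3 \<Rightarrow> 'b::euclidean_space"
  assumes "\<And>n. f n \<in> borel_measurable torus" "AE x in torus. (\<lambda>n. f n x) \<longlonglongrightarrow> 0"
    and "L2 w" "\<And>n. AE x in torus. norm (f n x) \<le> norm (w x)"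
  shows "(\<lambda>n. l2norm (f n)) \<longlonglongrightarrow> 0"
proof -
  have [measurable]: "f n \<in> borel_measurable torus" for n by fact
  have "(\<lambda>n. \<integral>x. (norm (f n x))\<^sup>2 \<partial>torus) \<longlonglongrightarrow> (\<integral>x. 0 \<partial>torus)"
  proof (rule integral_dominated_convergence[where w="\<lambda>x. (norm (w x))\<^sup>2"])
    show "AE x in torus. (\<lambda>n. (norm (f n x))\<^sup>2) \<longlonglongrightarrow> 0"
      using assms(2) by eventually_elim (auto intro!: tendsto_eq_intros)
    show "AE x in torus. norm ((norm (f n x))\<^sup>2) \<le> (norm (w x))\<^sup>2" for n
      using assms(4)[of n] by eventually_elim (auto intro!: power_mono)
  qed (auto intro!: L2_integrable_sq assms)
  then show ?thesis unfolding l2norm_def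
    using tendsto_real_sqrt by fastforce
qed

lemma clamp_approx:
  fixes f :: "real^3 \<Rightarrow> real"
  assumes f: "L2 f"
  shows "(\<lambda>n. l2norm (\<lambda>x. f x - clamp_at (real n) (f x))) \<longlonglongrightarrow> 0"
proof (rule l2norm_tendsto_0[OF _ _ f])
  have [measurable]: "f \<in> borel_measurable torus" by (rule L2_measurable[OF f])
  show "(\<lambda>x. f x - clamp_at (real n) (f x)) \<in> borel_measurable torus" for n by measurable
  have "(\<lambda>n. f x - clamp_at (real n) (f x)) \<longlonglongrightarrow> 0" for x
  proof (rule tendsto_eventually)
    obtain N :: nat where "\<bar>f x\<bar> \<le> real N" using real_arch_simple by blast
    then show "\<forall>\<^sub>F n in sequentially. f x - clamp_at (real n) (f x) = 0"
      by (intro eventually_sequentiallyI[of N]) (auto simp: clamp_at_def)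
  qed
  then show "AE x in torus. (\<lambda>n. f x - clamp_at (real n) (f x)) \<longlonglongrightarrow> 0" by simp
  show "AE x in torus. norm (f x - clamp_at (real n) (f x)) \<le> norm (f x)" for n
    by (auto simp: clamp_at_def)
qed

text \<open>The approximants must vanish on the faces, as \<open>uniform_trig_approx\<close>
  demands. The factor \<open>tau n\<close> forces this: it is 0 on the faces and tends to 1 in the
  open cell, while the faces are negligible. Clamping supplies the majorant for dominated
  convergence.\<close>

lemma bounded_continuous_approx:
  fixes f :: "real^3 \<Rightarrow> real"
  assumes f: "L2 f" and K: "0 \<le> K"
  obtains s where "\<And>n. continuous_on UNIV (s n)"
    "\<And>n x. \<exists>i. x $ i = 0 \<or> x $ i = 2 * pi \<Longrightarrow> s n x = (0::real)"
    "(\<lambda>n. l2norm (\<lambda>x. clamp_at K (f x) - s n x)) \<longlonglongrightarrow> 0"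
proof -
  have [measurable]: "f \<in> borel_measurable torus" by (rule L2_measurable[OF f])
  have "f \<in> borel_measurable (lebesgue_on cell)" using L2_measurable[OF f] by (simp add: torus_def)
  then have "f measurable_on cell" by (subst measurable_on_iff_borel_measurable) auto
  then obtain N g where N: "negligible N" and g: "\<And>n. continuous_on UNIV (g n)"
    and lim: "\<And>x. x \<notin> N \<Longrightarrow> (\<lambda>n. g n x) \<longlonglongrightarrow> (if x \<in> cell then f x else 0)"
    unfolding measurable_on_def by auto
  define tau where "tau = (\<lambda>n x. \<Prod>i\<in>UNIV. min 1 (real n * (1 - cos ((x::real^3) $ i))))"
  define s where "s = (\<lambda>n x. clamp_at K (g n x) * tau n x)"
  have cont: "continuous_on UNIV (s n)" for n
    unfolding s_def tau_def clamp_at_def by (intro continuous_intros g)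
  have tau: "0 \<le> tau n x" "tau n x \<le> 1" for n x
    unfolding tau_def by (auto intro!: prod_nonneg prod_le_1)
  have tau1: "(\<lambda>n. tau n x) \<longlonglongrightarrow> 1" if x: "x \<in> box 0 (\<chi> i. 2 * pi)" for x
  proof -
    have "(\<lambda>n. min 1 (real n * (1 - cos (x $ i)))) \<longlonglongrightarrow> 1" for i
    proof (rule tendsto_eventually)
      have xi: "0 < x $ i" "x $ i < 2 * pi" using x by (auto simp: mem_box_cart)
      have "cos (x $ i) \<noteq> 1"
      proof
        assume "cos (x $ i) = 1"
        then obtain m :: int where m: "x $ i = of_int m * 2 * pi" by (auto simp: cos_one_2pi_int)
        with xi have "0 < m" "m < 1" by (auto simp: zero_less_mult_iff)
        then show False by simp
      qed
      then have pos: "0 < 1 - cos (x $ i)" using cos_le_one[of "x $ i"] by linarith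
      then obtain M :: nat where M: "1 / (1 - cos (x $ i)) \<le> real M" using real_arch_simple by blast
      show "\<forall>\<^sub>F n in sequentially. min 1 (real n * (1 - cos (x $ i))) = 1"
      proof (rule eventually_sequentiallyI[of M])
        fix n assume "M \<le> n"
        then have "1 / (1 - cos (x $ i)) \<le> real n" using M by linarith
        then show "min 1 (real n * (1 - cos (x $ i))) = 1" using pos by (simp add: field_simps)
      qed
    qed
    then have "(\<lambda>n. \<Prod>i\<in>(UNIV::3 set). min 1 (real n * (1 - cos (x $ i)))) \<longlonglongrightarrow> (\<Prod>i\<in>(UNIV::3 set). 1)"
      by (intro tendsto_prod) auto
    then show ?thesis by (simp add: tau_def)
  qed
  have neg: "negligible (N \<union> (cell - box 0 (\<chi> i. 2 * pi)))"
    by (intro negligible_Un N negligible_frontier_interval)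
  have sm: "s n \<in> borel_measurable torus" for n
    by (intro L2_measurable L2_continuous cont)
  have "(\<lambda>n. l2norm (\<lambda>x. clamp_at K (f x) - s n x)) \<longlonglongrightarrow> 0"
  proof (rule l2norm_tendsto_0[where w="\<lambda>_. 2 * K"])
    show "AE x in torus. (\<lambda>n. clamp_at K (f x) - s n x) \<longlonglongrightarrow> 0"
    proof (rule AE_torus_negligible[OF neg])
      fix x assume x: "x \<in> cell" "x \<notin> N \<union> (cell - box 0 (\<chi> i. 2 * pi))"
      have "(\<lambda>n. clamp_at K (f x) - s n x) \<longlonglongrightarrow> clamp_at K (f x) - clamp_at K (f x) * 1"
        unfolding s_def using x lim[of x]
        by (intro tendsto_diff tendsto_const tendsto_mult tau1) (auto simp: clamp_at_def intro!: tendsto_intros)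
      then show "(\<lambda>n. clamp_at K (f x) - s n x) \<longlonglongrightarrow> 0" by simp
    qed
    have sK: "\<bar>s n x\<bar> \<le> K" for n x
      using mult_mono[OF clamp_at_bound[OF K, of "g n x"] tau(2)[of n x]] tau(1)[of n x] K
      by (simp add: s_def abs_mult)
    have "\<bar>clamp_at K (f x) - s n x\<bar> \<le> 2 * K" for x n
      using clamp_at_bound[OF K, of "f x"] sK[of n x] by linarith
    then show "AE x in torus. norm (clamp_at K (f x) - s n x) \<le> norm (2 * K)" for n
      using K by simp
    show "(\<lambda>x. clamp_at K (f x) - s n x) \<in> borel_measurable torus" for n using sm by measurable
  qed (rule L2_const)
  moreover have "s n x = 0" if "\<exists>i. x $ i = 0 \<or> x $ i = 2 * pi" for n x
  proof -
    have "tau n x = 0"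
    proof -
      from that obtain i where "x $ i = 0 \<or> x $ i = 2 * pi" by blast
      then have "min 1 (real n * (1 - cos (x $ i))) = 0" by auto
      then show ?thesis unfolding tau_def by (intro prod_zero) auto
    qed
    then show ?thesis by (simp add: s_def)
  qed
  ultimately show ?thesis using that cont by blast
qed

lemma trig_dense:
  fixes f :: "real^3 \<Rightarrow> real"
  assumes f: "L2 f" and e: "0 < e"
  shows "\<exists>F a. finite F \<and> l2norm (\<lambda>x. complex_of_real (f x) - tpoly F a x) < e"
proof -
  have [measurable]: "f \<in> borel_measurable torus" by (rule L2_measurable[OF f])
  from LIMSEQ_D[OF clamp_approx[OF f], of "e / 3"] obtain K :: nat
    where K: "l2norm (\<lambda>x. f x - clamp_at (real K) (f x)) < e / 3" using e by fastforce
  obtain s where s: "\<And>n. continuous_on UNIV (s n)"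
    "\<And>n x. \<exists>i. x $ i = 0 \<or> x $ i = 2 * pi \<Longrightarrow> s n x = (0::real)"
    "(\<lambda>n. l2norm (\<lambda>x. clamp_at (real K) (f x) - s n x)) \<longlonglongrightarrow> 0"
    using bounded_continuous_approx[OF f, of "real K"] by auto
  from LIMSEQ_D[OF s(3), of "e / 3"] obtain n
    where n: "l2norm (\<lambda>x. clamp_at (real K) (f x) - s n x) < e / 3" using e by fastforce
  define V where "V = sqrt (measure torus (space torus))"
  have V: "0 \<le> V" by (simp add: V_def)
  \<comment> \<open>A uniform error of \<open>e / (3 * (V + 1))\<close> is at most
    \<open>e / 3\<close> in the L2 norm, \<open>V\<close> being the square root of the volume of the
    cell.\<close>
  have "\<exists>F a. finite F \<and> (\<forall>x\<in>cell. norm (complex_of_real (s n x) - tpoly F a x) < e / (3 * (V + 1)))"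
    by (rule uniform_trig_approx) (use s e V in \<open>auto intro: continuous_on_subset\<close>)
  then obtain F a where Fa: "finite F" "\<And>x. x \<in> cell \<Longrightarrow> norm (complex_of_real (s n x) - tpoly F a x) < e / (3 * (V + 1))"
    by blast
  have Ls: "L2 (s n)" by (intro L2_continuous s)
  have Lc: "L2 (\<lambda>x. clamp_at (real K) (f x))"
    by (rule L2_bounded[where B=K]) (auto simp: clamp_at_bound)
  have Ld: "L2 (\<lambda>x. complex_of_real (s n x) - tpoly F a x)"
    by (intro L2_diff L2_of_real Ls L2_tpoly)
  have "l2norm (\<lambda>x. complex_of_real (s n x) - tpoly F a x) \<le> V * (e / (3 * (V + 1)))"

  proof -
    have "AE x in torus. norm (complex_of_real (s n x) - tpoly F a x) \<le> e / (3 * (V + 1))"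
      using Fa(2) by (intro AE_I2) (auto simp: space_torus intro: less_imp_le)
    then show ?thesis
      using l2norm_le_sup[OF L2_measurable[OF Ld], of "e / (3 * (V + 1))"] e V unfolding V_def[symmetric] by simp
  qed
  also have "\<dots> \<le> e / 3" using V e by (simp add: field_simps)
  finally have 3: "l2norm (\<lambda>x. complex_of_real (s n x) - tpoly F a x) \<le> e / 3" .
  have "l2norm (\<lambda>x. complex_of_real (f x) - tpoly F a x) \<le>
    l2norm (\<lambda>x. complex_of_real ((f x - clamp_at (real K) (f x)) + (clamp_at (real K) (f x) - s n x))) +
    l2norm (\<lambda>x. complex_of_real (s n x) - tpoly F a x)"
    using L2_add(2)[of "\<lambda>x. complex_of_real ((f x - clamp_at (real K) (f x)) + (clamp_at (real K) (f x) - s n x))"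
      "\<lambda>x. complex_of_real (s n x) - tpoly F a x"] Ld f Lc Ls
    by (simp add: L2_of_real L2_diff)
  also have "\<dots> < e"
    unfolding l2norm_of_real using L2_add(2)[of "\<lambda>x. f x - clamp_at (real K) (f x)" "\<lambda>x. clamp_at (real K) (f x) - s n x"]
      f Lc Ls K n 3 by (simp add: L2_diff)
  finally show ?thesis using Fa(1) by blast
qed

text \<open>By best approximation the partial Fourier sums do at least as well as any polynomial
  from \<open>trig_dense\<close> whose frequencies lie in the cube.\<close>

lemma parseval_limit:
  fixes f :: "real^3 \<Rightarrow> real"
  assumes f: "L2 f"
  shows "(\<lambda>N. l2norm (\<lambda>x. complex_of_real (f x) - tpoly (cube N) (fc (\<lambda>x. complex_of_real (f x))) x)) \<longlonglongrightarrow> 0"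
proof (rule LIMSEQ_I)
  fix e :: real assume "0 < e"
  from trig_dense[OF f this] obtain F a where Fa: "finite F" "l2norm (\<lambda>x. complex_of_real (f x) - tpoly F a x) < e" by blast
  obtain M where M: "F \<subseteq> cube M" using finite_subset_cube[OF Fa(1)] by blast
  have "l2norm (\<lambda>x. complex_of_real (f x) - tpoly (cube N) (fc (\<lambda>x. complex_of_real (f x))) x) < e" if "M \<le> N" for N
  proof -
    let ?a = "\<lambda>k. if k \<in> F then a k else 0"
    have "tpoly F a = tpoly F ?a" by (auto simp: tpoly_def)
    also have "\<dots> = tpoly (cube N) ?a"
      by (rule tpoly_mono_neutral) (use M cube_mono[OF that] in auto)
    finally have "l2norm (\<lambda>x. complex_of_real (f x) - tpoly (cube N) ?a x) < e" using Fa(2) by simp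
    then show ?thesis using best_approx[OF L2_of_real[OF f] finite_cube, of N ?a] by linarith
  qed
  then show "\<exists>no. \<forall>n\<ge>no. norm (l2norm (\<lambda>x. complex_of_real (f x) - tpoly (cube n) (fc (\<lambda>x. complex_of_real (f x))) x) - 0) < e"
    by auto
qed

text \<open>Only frequencies above \<open>M\<close> are altered, and there a factor
  \<open>norm (rvec k) / M\<close> can be inserted at no cost; this converts the remainder into the
  gradient sum. Since \<open>G\<close> bounds all partial sums, the cubes may exhaust the
  lattice.\<close>

lemma multiplier_remainder:
  fixes f :: "real^3 \<Rightarrow> real" and mu :: "int^3 \<Rightarrow> complex"
  defines "a \<equiv> fc (\<lambda>x. complex_of_real (f x))"
  assumes f: "L2 f" and F: "finite F"
    and G: "\<And>N. (\<Sum>k\<in>cube N. (norm (rvec k))\<^sup>2 * (norm (a k))\<^sup>2) \<le> G"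
    and M: "0 < M" and K: "\<And>k. norm (1 - mu k) \<le> K"
    and low: "\<And>k. norm (rvec k) \<le> M \<Longrightarrow> mu k = 1" and high: "\<And>k. k \<notin> F \<Longrightarrow> mu k = 0"
  shows "l2norm (\<lambda>x. complex_of_real (f x) - tpoly F (\<lambda>k. mu k * a k) x) \<le> sqrt ((2 * pi) ^ 3 * G) * K / M"
proof -
  let ?f = "\<lambda>x. complex_of_real (f x)"
  have Lf: "L2 ?f" by (rule L2_of_real[OF f])
  have K0: "0 \<le> K" using K[of 0] norm_ge_zero order_trans by blast
  have G0: "0 \<le> G" using G[of 0] by (rule order_trans[rotated]) (auto intro!: sum_nonneg)
  obtain N0 where N0: "F \<subseteq> cube N0" using finite_subset_cube[OF F] by blast
  have "l2norm (\<lambda>x. ?f x - tpoly F (\<lambda>k. mu k * a k) x) \<le> l2norm (\<lambda>x. ?f x - tpoly (cube N) a x) + sqrt ((2 * pi) ^ 3 * G) * K / M"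
    if N: "N0 \<le> N" for N
  proof -
    have 1: "tpoly F (\<lambda>k. mu k * a k) = tpoly (cube N) (\<lambda>k. mu k * a k)"
      by (rule tpoly_mono_neutral) (use N0 cube_mono[OF N] high in auto)
    have "(\<lambda>x. ?f x - tpoly F (\<lambda>k. mu k * a k) x) = (\<lambda>x. (?f x - tpoly (cube N) a x) + tpoly (cube N) (\<lambda>k. (1 - mu k) * a k) x)"
      unfolding 1 by (auto simp: tpoly_def algebra_simps sum_subtractf)
    then have 2: "l2norm (\<lambda>x. ?f x - tpoly F (\<lambda>k. mu k * a k) x) \<le> l2norm (\<lambda>x. ?f x - tpoly (cube N) a x) + l2norm (tpoly (cube N) (\<lambda>k. (1 - mu k) * a k))"
      using L2_add(2)[of "\<lambda>x. ?f x - tpoly (cube N) a x" "tpoly (cube N) (\<lambda>k. (1 - mu k) * a k)"]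
      by (simp add: L2_diff Lf L2_tpoly)
    have le: "(norm ((1 - mu k) * a k))\<^sup>2 \<le> (K / M)\<^sup>2 * ((norm (rvec k))\<^sup>2 * (norm (a k))\<^sup>2)" for k
    proof (cases "norm (rvec k) \<le> M")
      case True
      then show ?thesis by (simp add: low)
    next
      case False
      then have "norm (1 - mu k) * M \<le> K * norm (rvec k)" using K[of k] K0 M by (intro mult_mono) auto
      then have "norm (1 - mu k) \<le> K / M * norm (rvec k)" using M by (simp add: field_simps)
      then have "norm ((1 - mu k) * a k) \<le> K / M * norm (rvec k) * norm (a k)"
        unfolding norm_mult by (intro mult_right_mono) auto
      then have "(norm ((1 - mu k) * a k))\<^sup>2 \<le> (K / M * norm (rvec k) * norm (a k))\<^sup>2" by (intro power_mono) auto
      then show ?thesis by (simp add: power_mult_distrib power_divide mult_ac)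
    qed
    have "(l2norm (tpoly (cube N) (\<lambda>k. (1 - mu k) * a k)))\<^sup>2 = (2 * pi) ^ 3 * (\<Sum>k\<in>cube N. (norm ((1 - mu k) * a k))\<^sup>2)"
      by (rule l2norm_tpoly) simp
    also have "\<dots> \<le> (2 * pi) ^ 3 * (\<Sum>k\<in>cube N. (K / M)\<^sup>2 * ((norm (rvec k))\<^sup>2 * (norm (a k))\<^sup>2))"
      by (intro mult_left_mono sum_mono le) auto
    also have "\<dots> \<le> (2 * pi) ^ 3 * ((K / M)\<^sup>2 * G)"
      unfolding sum_distrib_left[symmetric] by (intro mult_left_mono G) auto
    also have "\<dots> = (sqrt ((2 * pi) ^ 3 * G) * K / M)\<^sup>2"
      using G0 by (simp add: power_mult_distrib power_divide)
    finally have "l2norm (tpoly (cube N) (\<lambda>k. (1 - mu k) * a k)) \<le> sqrt ((2 * pi) ^ 3 * G) * K / M"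
      by (rule power2_le_imp_le) (use K0 M G0 in auto)
    with 2 show ?thesis by linarith
  qed
  then have "\<forall>\<^sub>F N in sequentially. l2norm (\<lambda>x. ?f x - tpoly F (\<lambda>k. mu k * a k) x) \<le> l2norm (\<lambda>x. ?f x - tpoly (cube N) a x) + sqrt ((2 * pi) ^ 3 * G) * K / M"
    by (rule eventually_sequentiallyI)
  moreover have "(\<lambda>N. l2norm (\<lambda>x. ?f x - tpoly (cube N) a x) + sqrt ((2 * pi) ^ 3 * G) * K / M) \<longlonglongrightarrow> 0 + sqrt ((2 * pi) ^ 3 * G) * K / M"
    unfolding a_def by (intro tendsto_add tendsto_const parseval_limit f)
  ultimately show ?thesis
    using tendsto_lowerbound[of _ _ sequentially] by fastforce
qed

section \<open>Test functions and weak gradients\<close>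

text \<open>An invariant class of differentiable functions replaces explicit formulas for all
  iterated derivatives.\<close>

lemma smooth_coinduct:
  assumes "f \<in> S" and diff: "\<And>g x. g \<in> S \<Longrightarrow> g differentiable (at x)"
    and step: "\<And>g v. g \<in> S \<Longrightarrow> (\<lambda>x. frechet_derivative g (at x) v) \<in> S"
  shows "smooth f"
proof -
  have "iter_deriv vs f \<in> S" for vs
    using assms(1) by (induction vs) (auto intro: step)
  then show ?thesis unfolding smooth_def using diff by blast
qed

text \<open>Real sums instead of exponentials because test functions are real. Differentiation
  exchanges the two coefficient families, so the class is invariant.\<close>

definition trigf :: "(int^3) set \<Rightarrow> (int^3 \<Rightarrow> 'b::real_normed_vector) \<Rightarrow> (int^3 \<Rightarrow> 'b) \<Rightarrow> real^3 \<Rightarrow> 'b" where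
  "trigf D w w' x = (\<Sum>k\<in>D. cos (rvec k \<bullet> x) *\<^sub>R w k + sin (rvec k \<bullet> x) *\<^sub>R w' k)"

lemma trigf_has_derivative:
  "(trigf D w w' has_derivative
     (\<lambda>y. trigf D (\<lambda>k. (rvec k \<bullet> y) *\<^sub>R w' k) (\<lambda>k. - (rvec k \<bullet> y) *\<^sub>R w k) x)) (at x)"
  unfolding trigf_def
proof (rule has_derivative_sum)
  fix k
  have i: "((\<lambda>x. rvec k \<bullet> x) has_derivative (\<lambda>y. rvec k \<bullet> y)) (at x)"
    by (auto intro!: derivative_eq_intros)
  have "((\<lambda>x. cos (rvec k \<bullet> x) *\<^sub>R w k + sin (rvec k \<bullet> x) *\<^sub>R w' k) has_derivative
      (\<lambda>y. ((rvec k \<bullet> y) * - sin (rvec k \<bullet> x)) *\<^sub>R w k + ((rvec k \<bullet> y) * cos (rvec k \<bullet> x)) *\<^sub>R w' k)) (at x)"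
    by (intro has_derivative_add has_derivative_scaleR_left has_derivative_cos[OF i] has_derivative_sin[OF i])
  then show "((\<lambda>x. cos (rvec k \<bullet> x) *\<^sub>R w k + sin (rvec k \<bullet> x) *\<^sub>R w' k) has_derivative
      (\<lambda>y. cos (rvec k \<bullet> x) *\<^sub>R (rvec k \<bullet> y) *\<^sub>R w' k + sin (rvec k \<bullet> x) *\<^sub>R - (rvec k \<bullet> y) *\<^sub>R w k)) (at x)"
    by (rule has_derivative_eq_rhs) (auto simp: mult.commute)
qed

lemma frechet_trigf:
  "frechet_derivative (trigf D w w') (at x) y = trigf D (\<lambda>k. (rvec k \<bullet> y) *\<^sub>R w' k) (\<lambda>k. - (rvec k \<bullet> y) *\<^sub>R w k) x"
  by (simp add: frechet_derivative_at[OF trigf_has_derivative, symmetric])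

lemma smooth_trigf:
  fixes w w' :: "int^3 \<Rightarrow> 'b::real_normed_vector"
  shows "smooth (trigf D w w')"
proof -
  define S where "S = {trigf D w w' | w w' :: int^3 \<Rightarrow> 'b. True}"
  show ?thesis
  proof (rule smooth_coinduct[of _ S])
    have S: "trigf D w w' \<in> S" for w w' unfolding S_def by blast
    show "trigf D w w' \<in> S" by (rule S)
    fix g v x assume "g \<in> S"
    then obtain w w' where g: "g = trigf D w w'" unfolding S_def by blast
    show "g differentiable (at x)" unfolding g differentiable_def by (rule exI) (rule trigf_has_derivative)
    show "(\<lambda>x. frechet_derivative g (at x) v) \<in> S"
      unfolding g frechet_trigf by (rule S)
  qed
qed

lemma rvec_inner_periodic:
  "cos (rvec k \<bullet> (x + axis i (2 * pi))) = cos (rvec k \<bullet> x)" "sin (rvec k \<bullet> (x + axis i (2 * pi))) = sin (rvec k \<bullet> x)"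
proof -
  have "rvec k \<bullet> (x + axis i (2 * pi)) = rvec k \<bullet> x + 2 * pi * of_int (k $ i)"
    by (simp add: inner_add_right inner_axis)
  then show "cos (rvec k \<bullet> (x + axis i (2 * pi))) = cos (rvec k \<bullet> x)" "sin (rvec k \<bullet> (x + axis i (2 * pi))) = sin (rvec k \<bullet> x)"
    by (simp_all only: cos_add sin_add cos_int_2pin sin_int_2pin mult_1_right mult_zero_right diff_0_right add_0_right)
qed

lemma periodic_trigf: "periodic (trigf D w w')"
  by (simp add: periodic_def trigf_def rvec_inner_periodic)

lemma trigf_scaleR: "trigf D (\<lambda>k. c *\<^sub>R w k) (\<lambda>k. c *\<^sub>R w' k) x = c *\<^sub>R trigf D w w' x"
  by (simp add: trigf_def scaleR_sum_right algebra_simps)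

section \<open>Smooth cutoffs in time\<close>

text \<open>The family \<open>x\<^sup>-\<^sup>m exp (-1/x)\<close> is closed under differentiation up to linear combinations.\<close>

definition flat :: "nat \<Rightarrow> real \<Rightarrow> real" where
  "flat m x = (if x > 0 then exp (- 1 / x) / x ^ m else 0)"

lemma flat_tendsto_0: "(flat m \<longlongrightarrow> 0) (at 0)"
proof -
  have "((\<lambda>y::real. y ^ m / exp y) \<longlongrightarrow> 0) at_top" by (rule tendsto_power_div_exp_0)
  then have "((\<lambda>x::real. inverse x ^ m / exp (inverse x)) \<longlongrightarrow> 0) (at_right 0)"
    by (rule filterlim_compose[OF _ filterlim_inverse_at_top_right])
  moreover have "\<forall>\<^sub>F x in at_right 0. inverse x ^ m / exp (inverse x) = flat m x"
    using eventually_at_right_less[of 0]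
    by eventually_elim (auto simp: flat_def exp_minus field_simps)
  ultimately have "(flat m \<longlongrightarrow> 0) (at_right 0)" by (rule Lim_transform_eventually)
  moreover have "(flat m \<longlongrightarrow> 0) (at_left 0)"
  proof (rule Lim_transform_eventually[OF tendsto_const])
    show "\<forall>\<^sub>F x in at_left 0. 0 = flat m x"
      unfolding eventually_at by (auto simp: flat_def intro!: exI[of _ 1])
  qed
  ultimately show ?thesis by (simp add: filterlim_split_at)
qed

lemma flat_deriv: "(flat m has_real_derivative flat (m + 2) x - real m * flat (m + 1) x) (at x)"
proof -
  consider "x > 0" | "x < 0" | "x = 0" by linarith
  then show ?thesis
  proof cases
    case 1
    have "((\<lambda>x. exp (- 1 / x) / x ^ m) has_real_derivative flat (m + 2) x - real m * flat (m + 1) x) (at x)"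
    proof -
      have 1: "((\<lambda>x. exp (- 1 / x)) has_real_derivative exp (- 1 / x) / x ^ 2) (at x)"
        using 1 by (auto intro!: derivative_eq_intros simp: power2_eq_square)
      have 2: "((\<lambda>x. x ^ m) has_real_derivative real m * x ^ (m - 1)) (at x)"
        by (rule DERIV_cong[OF DERIV_pow]) simp
      have "(exp (- 1 / x) / x ^ 2 * x ^ m - exp (- 1 / x) * (real m * x ^ (m - 1))) / (x ^ m * x ^ m)
          = flat (m + 2) x - real m * flat (m + 1) x"
        using \<open>x > 0\<close> by (cases m) (simp_all add: flat_def field_simps power2_eq_square)
      then show ?thesis using DERIV_divide[OF 1 2] \<open>x > 0\<close> by simp
    qed
    moreover have ev: "\<forall>\<^sub>F y in nhds x. exp (- 1 / y) / y ^ m = flat m y"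

    proof -
      have "\<forall>\<^sub>F y in nhds x. y \<in> {0<..}" by (rule eventually_nhds_in_open) (use 1 in auto)
      then show ?thesis by eventually_elim (auto simp: flat_def)
    qed
    ultimately show ?thesis using DERIV_cong_ev[OF refl ev refl] by blast
  next
    case 2
    have ev: "\<forall>\<^sub>F y in nhds x. 0 = flat m y"

    proof -
      have "\<forall>\<^sub>F y in nhds x. y \<in> {..<0}" by (rule eventually_nhds_in_open) (use 2 in auto)
      then show ?thesis by eventually_elim (auto simp: flat_def)
    qed
    have "((\<lambda>y. 0) has_real_derivative 0) (at x)" by simp
    then have "(flat m has_real_derivative 0) (at x)" using DERIV_cong_ev[OF refl ev refl] by blast
    moreover have "flat (m + 2) x - real m * flat (m + 1) x = 0" using 2 by (simp add: flat_def)
    ultimately show ?thesis by simp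
  next
    case 3
    \<comment> \<open>The difference quotient of \<open>flat m\<close> at 0 is exactly
      \<open>flat (m + 1)\<close>.\<close>
    have "((\<lambda>h. (flat m (0 + h) - flat m 0) / h) \<longlongrightarrow> 0) (at 0)"
    proof (rule Lim_transform_eventually[OF flat_tendsto_0[of "m + 1"]])
      show "\<forall>\<^sub>F h in at 0. flat (m + 1) h = (flat m (0 + h) - flat m 0) / h"
        unfolding eventually_at by (auto simp: flat_def field_simps intro!: exI[of _ 1])
    qed
    then show ?thesis using 3 by (simp add: DERIV_def flat_def)
  qed
qed

text \<open>The exponents \<open>m\<close> and \<open>l\<close> are carried along to make the family
  closed under differentiation up to linear combinations; the cutoff that is used has both equal to
  0.\<close>

definition bump :: "real \<Rightarrow> real \<Rightarrow> nat \<Rightarrow> nat \<Rightarrow> real \<Rightarrow> real" where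
  "bump a b m l t = flat m (t - a) * flat l (b - t)"

definition bump' :: "real \<Rightarrow> real \<Rightarrow> nat \<Rightarrow> nat \<Rightarrow> real \<Rightarrow> real" where
  "bump' a b m l t = bump a b (m + 2) l t - real m * bump a b (m + 1) l t
     - bump a b m (l + 2) t + real l * bump a b m (l + 1) t"

lemma bump_deriv: "(bump a b m l has_real_derivative bump' a b m l t) (at t)"
proof -
  have 1: "((\<lambda>t. flat m (t - a)) has_real_derivative (flat (m + 2) (t - a) - real m * flat (m + 1) (t - a)) * 1) (at t)"
    by (rule DERIV_chain'[OF _ flat_deriv]) (auto intro!: derivative_eq_intros)
  have 2: "((\<lambda>t. flat l (b - t)) has_real_derivative (flat (l + 2) (b - t) - real l * flat (l + 1) (b - t)) * (-1)) (at t)"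
    by (rule DERIV_chain'[OF _ flat_deriv]) (auto intro!: derivative_eq_intros)
  show ?thesis unfolding bump_def[abs_def]
    by (rule DERIV_cong[OF DERIV_mult[OF 1 2]]) (simp add: bump'_def bump_def algebra_simps)
qed

lemma bump_outside: "t \<notin> {a..b} \<Longrightarrow> bump a b m l t = 0"
  by (auto simp: bump_def flat_def)

lemma bump_nonneg: "0 \<le> bump a b m l t"
  by (auto simp: bump_def flat_def)

lemma bump_pos: "t \<in> {a<..<b} \<Longrightarrow> 0 < bump a b m l t"
  by (auto simp: bump_def flat_def)

lemma bump_continuous: "continuous_on S (bump a b m l)"
  by (intro continuous_at_imp_continuous_on ballI DERIV_isCont[OF bump_deriv])

lemma bump'_continuous: "continuous_on S (bump' a b m l)"
  unfolding bump'_def by (intro continuous_intros bump_continuous)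

lemma bump'_outside: "t \<notin> {a..b} \<Longrightarrow> bump' a b m l t = 0"
  by (auto simp: bump'_def bump_outside)

section \<open>Test functions of product form in time and space\<close>

lemma time_space_has_derivative:
  assumes p: "(p has_real_derivative p' t) (at t)"
  shows "((\<lambda>z. p (fst z) *\<^sub>R trigf D w w' (snd z)) has_derivative
     (\<lambda>v. (fst v * p' t) *\<^sub>R trigf D w w' x +
        p t *\<^sub>R trigf D (\<lambda>k. (rvec k \<bullet> snd v) *\<^sub>R w' k) (\<lambda>k. - (rvec k \<bullet> snd v) *\<^sub>R w k) x)) (at (t, x))"
proof -
  have "((\<lambda>z. p (fst z)) has_derivative (\<lambda>v. fst v * p' t)) (at (t, x))"
    using has_derivative_compose[OF has_derivative_fst[OF has_derivative_ident], of p "(*) (p' t)" "(t, x)" UNIV]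
      p unfolding has_field_derivative_def by (simp add: mult.commute)
  moreover have "((\<lambda>z. trigf D w w' (snd z)) has_derivative
     (\<lambda>v. trigf D (\<lambda>k. (rvec k \<bullet> snd v) *\<^sub>R w' k) (\<lambda>k. - (rvec k \<bullet> snd v) *\<^sub>R w k) x)) (at (t, x))"
    using has_derivative_compose[OF has_derivative_snd[OF has_derivative_ident], of "trigf D w w'" _ "(t, x)" UNIV]
      trigf_has_derivative[of D w w' x] by simp
  ultimately show ?thesis
    by (rule has_derivative_eq_rhs[OF has_derivative_scaleR]) (auto simp: algebra_simps)
qed

lemma frechet_time_space:
  assumes "\<And>t. (p has_real_derivative p' t) (at t)"
  shows "frechet_derivative (\<lambda>z. p (fst z) *\<^sub>R trigf D w w' (snd z)) (at z) v =
     (fst v * p' (fst z)) *\<^sub>R trigf D w w' (snd z) +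
        p (fst z) *\<^sub>R trigf D (\<lambda>k. (rvec k \<bullet> snd v) *\<^sub>R w' k) (\<lambda>k. - (rvec k \<bullet> snd v) *\<^sub>R w k) (snd z)"
  using frechet_derivative_at[OF time_space_has_derivative[where p=p and p'=p' and t="fst z" and D=D and w=w and w'=w' and x="snd z", OF assms], symmetric]
  by simp

text \<open>The invariant class for \<open>smooth_coinduct\<close>. Scalars are absorbed into the
  coefficients of \<open>trigf\<close>, so closure under addition is enough for the linear
  combinations produced by \<open>bump'\<close>.\<close>

inductive_set bump_trig :: "real \<Rightarrow> real \<Rightarrow> (int^3) set \<Rightarrow> (real \<times> (real^3) \<Rightarrow> 'b::real_normed_vector) set"
  for a b :: real and D :: "(int^3) set" where
  base: "(\<lambda>z. bump a b m l (fst z) *\<^sub>R trigf D w w' (snd z)) \<in> bump_trig a b D"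
| add: "f \<in> bump_trig a b D \<Longrightarrow> g \<in> bump_trig a b D \<Longrightarrow> (\<lambda>z. f z + g z) \<in> bump_trig a b D"

lemma bump_trig_scale: "(\<lambda>z. (c * bump a b m l (fst z)) *\<^sub>R trigf D w w' (snd z)) \<in> bump_trig a b D"
  using bump_trig.base[of a b m l D "\<lambda>k. c *\<^sub>R w k" "\<lambda>k. c *\<^sub>R w' k"]
  by (simp only: trigf_scaleR scaleR_scaleR mult.commute)

lemma bump_trig_deriv:
  assumes "f \<in> bump_trig a b D"
  shows "(\<forall>z. f differentiable (at z)) \<and> (\<forall>v. (\<lambda>z. frechet_derivative f (at z) v) \<in> bump_trig a b D)"
  using assms
proof induction
  case (base m l w w')
  have "(\<lambda>z. (fst v * bump' a b m l (fst z)) *\<^sub>R trigf D w w' (snd z) +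
        bump a b m l (fst z) *\<^sub>R trigf D (\<lambda>k. (rvec k \<bullet> snd v) *\<^sub>R w' k) (\<lambda>k. - (rvec k \<bullet> snd v) *\<^sub>R w k) (snd z)) \<in> bump_trig a b D" for v :: "real \<times> (real^3)"
  proof -
    have eq: "(fst v * bump' a b m l t) *\<^sub>R (y::'a) = (fst v * bump a b (m + 2) l t) *\<^sub>R y + ((- fst v * real m) * bump a b (m + 1) l t) *\<^sub>R y
       + ((- fst v) * bump a b m (l + 2) t) *\<^sub>R y + ((fst v * real l) * bump a b m (l + 1) t) *\<^sub>R y" for t y
      by (simp add: bump'_def algebra_simps)
    show ?thesis unfolding eq by (intro bump_trig.add bump_trig_scale bump_trig.base)
  qed
  moreover have "(\<lambda>z. bump a b m l (fst z) *\<^sub>R trigf D w w' (snd z)) differentiable (at z)" for z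
    using time_space_has_derivative[where p="bump a b m l" and p'="bump' a b m l" and t="fst z" and D=D and w=w and w'=w' and x="snd z", OF bump_deriv]
    by (auto simp: differentiable_def)
  ultimately show ?case by (simp add: frechet_time_space[OF bump_deriv])
next
  case (add f g)
  have "frechet_derivative (\<lambda>z. f z + g z) (at z) v = frechet_derivative f (at z) v + frechet_derivative g (at z) v" for z v
  proof -
    have "((\<lambda>z. f z + g z) has_derivative (\<lambda>v. frechet_derivative f (at z) v + frechet_derivative g (at z) v)) (at z)"
      using add.IH frechet_derivative_works by (intro has_derivative_add) blast+
    then show ?thesis by (simp add: frechet_derivative_at[symmetric])
  qed
  then show ?case using add.IH by (auto intro!: bump_trig.add differentiable_add)
qed

lemma smooth_bump_trig: "smooth (\<lambda>z. bump a b m l (fst z) *\<^sub>R trigf D w w' (snd z))"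
  by (rule smooth_coinduct[where S="bump_trig a b D"]) (use bump_trig_deriv bump_trig.base in blast)+

lemma test_fun_bump_trig:
  assumes "0 < a" "b < T"
  shows "test_fun T (\<lambda>z. bump a b m l (fst z) *\<^sub>R trigf D w w' (snd z))"
proof -
  have "periodic (\<lambda>x. bump a b m l t *\<^sub>R trigf D w w' x)" for t
    using periodic_trigf[of D w w'] by (simp add: periodic_def)
  then have "test_supp a b (\<lambda>z. bump a b m l (fst z) *\<^sub>R trigf D w w' (snd z))"
    unfolding test_supp_def using smooth_bump_trig by (auto simp: bump_outside)
  then show ?thesis unfolding test_fun_def using assms by blast
qed

lemma deriv_t_time_space:
  assumes "\<And>t. (p has_real_derivative p' t) (at t)"
  shows "deriv_t (\<lambda>z. p (fst z) *\<^sub>R trigf D w w' (snd z)) (t, x) = p' t *\<^sub>R trigf D w w' x"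
  unfolding deriv_t_def iter_deriv.simps frechet_time_space[OF assms] by (simp add: trigf_def)

lemma deriv_x_time_space:
  assumes "\<And>t. (p has_real_derivative p' t) (at t)"
  shows "deriv_x j (\<lambda>z. p (fst z) *\<^sub>R trigf D w w' (snd z)) =
    (\<lambda>z. p (fst z) *\<^sub>R trigf D (\<lambda>k. of_int (k $ j) *\<^sub>R w' k) (\<lambda>k. - of_int (k $ j) *\<^sub>R w k) (snd z))"
  unfolding deriv_x_def iter_deriv.simps frechet_time_space[OF assms] by (simp add: inner_axis)

lemma laplacian_time_space:
  assumes "\<And>t. (p has_real_derivative p' t) (at t)"
  shows "laplacian_x (\<lambda>z. p (fst z) *\<^sub>R trigf D w w' (snd z)) (t, x) =
    p t *\<^sub>R trigf D (\<lambda>k. - (norm (rvec k))\<^sup>2 *\<^sub>R w k) (\<lambda>k. - (norm (rvec k))\<^sup>2 *\<^sub>R w' k) x"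
proof -
  have "laplacian_x (\<lambda>z. p (fst z) *\<^sub>R trigf D w w' (snd z)) (t, x) =
     (\<Sum>j\<in>UNIV. p t *\<^sub>R trigf D (\<lambda>k. - (of_int (k $ j))\<^sup>2 *\<^sub>R w k) (\<lambda>k. - (of_int (k $ j))\<^sup>2 *\<^sub>R w' k) x)"
    unfolding laplacian_x_def deriv_x_time_space[OF assms] by (simp add: power2_eq_square)
  also have "\<dots> = p t *\<^sub>R trigf D (\<lambda>k. - (norm (rvec k))\<^sup>2 *\<^sub>R w k) (\<lambda>k. - (norm (rvec k))\<^sup>2 *\<^sub>R w' k) x"
  proof -
    have "(\<Sum>j\<in>UNIV. trigf D (\<lambda>k. - (of_int (k $ j))\<^sup>2 *\<^sub>R w k) (\<lambda>k. - (of_int (k $ j))\<^sup>2 *\<^sub>R w' k) x) =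
       trigf D (\<lambda>k. - (norm (rvec k))\<^sup>2 *\<^sub>R w k) (\<lambda>k. - (norm (rvec k))\<^sup>2 *\<^sub>R w' k) x"
      unfolding trigf_def
      by (subst sum.swap, intro sum.cong refl)
         (simp add: norm_rvec_sq scaleR_sum_left scaleR_sum_right sum_subtractf sum_negf)
    then show ?thesis by (simp add: scaleR_sum_right[symmetric])
  qed
  finally show ?thesis .
qed

section \<open>Fourier coefficients of weak gradients\<close>

lemma fc_of_real:
  fixes h :: "real^3 \<Rightarrow> real"
  assumes h: "L2 h"
  shows "fc (\<lambda>x. complex_of_real (h x)) k = (of_real (\<integral>x. h x * cos (rvec k \<bullet> x) \<partial>torus)
    - \<i> * of_real (\<integral>x. h x * sin (rvec k \<bullet> x) \<partial>torus)) / (2 * pi) ^ 3"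
proof -
  have "L2 (\<lambda>x. cos (rvec k \<bullet> x))" "L2 (\<lambda>x. sin (rvec k \<bullet> x))"
    by (intro L2_continuous continuous_intros)+
  then have int: "integrable torus (\<lambda>x. h x * cos (rvec k \<bullet> x))" "integrable torus (\<lambda>x. h x * sin (rvec k \<bullet> x))"
    using h by (auto intro: L2_mult_integrable)
  have "(\<integral>x. fexp (- k) x * complex_of_real (h x) \<partial>torus) =
     (\<integral>x. complex_of_real (h x * cos (rvec k \<bullet> x)) - \<i> * complex_of_real (h x * sin (rvec k \<bullet> x)) \<partial>torus)"
    by (rule Bochner_Integration.integral_cong)
       (auto simp: fexp_def rvec_minus exp_Euler[symmetric] complex_eq_iff Re_exp Im_exp)
  also have "\<dots> = of_real (\<integral>x. h x * cos (rvec k \<bullet> x) \<partial>torus) - \<i> * of_real (\<integral>x. h x * sin (rvec k \<bullet> x) \<partial>torus)"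
    using int by (simp del: of_real_mult)
  finally show ?thesis by (simp add: fc_def)
qed

text \<open>Weak gradients are tested against real functions, so cosine and sine are inserted
  separately and recombined.\<close>

lemma weak_gradient_fc:
  assumes G: "is_weak_gradient v G" and v: "L2 v"
  shows "fc (\<lambda>x. complex_of_real (G x $ i $ j)) k = \<i> * of_int (k $ j) * fc (\<lambda>x. complex_of_real (v x $ i)) k"
proof -
  have LG: "L2 (\<lambda>x. G x $ i $ j)" using G by (auto simp: is_weak_gradient_def intro!: L2_component)
  have Lv: "L2 (\<lambda>x. v x $ i)" by (rule L2_component[OF v])
  have wg: "(\<integral>x. v x $ i * frechet_derivative (trigf {k} w w') (at x) (axis j 1) \<partial>torus)
             = - (\<integral>x. G x $ i $ j * trigf {k} w w' x \<partial>torus)" for w w' :: "int^3 \<Rightarrow> real"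
    using G smooth_trigf periodic_trigf unfolding is_weak_gradient_def by blast
  have "(\<integral>x. v x $ i * (- of_int (k $ j) * sin (rvec k \<bullet> x)) \<partial>torus) = - (\<integral>x. G x $ i $ j * cos (rvec k \<bullet> x) \<partial>torus)"
    using wg[of "\<lambda>_. 1" "\<lambda>_. 0"] unfolding frechet_trigf by (simp add: trigf_def inner_axis mult.commute)
  moreover have "(\<integral>x. v x $ i * (- of_int (k $ j) * sin (rvec k \<bullet> x)) \<partial>torus) = - of_int (k $ j) * (\<integral>x. v x $ i * sin (rvec k \<bullet> x) \<partial>torus)"
    unfolding integral_mult_right_zero[symmetric] by (simp only: mult.left_commute)
  ultimately have 1: "(\<integral>x. G x $ i $ j * cos (rvec k \<bullet> x) \<partial>torus) = of_int (k $ j) * (\<integral>x. v x $ i * sin (rvec k \<bullet> x) \<partial>torus)"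
    by simp
  have "(\<integral>x. v x $ i * (of_int (k $ j) * cos (rvec k \<bullet> x)) \<partial>torus) = - (\<integral>x. G x $ i $ j * sin (rvec k \<bullet> x) \<partial>torus)"
    using wg[of "\<lambda>_. 0" "\<lambda>_. 1"] unfolding frechet_trigf by (simp add: trigf_def inner_axis mult.commute)
  moreover have "(\<integral>x. v x $ i * (of_int (k $ j) * cos (rvec k \<bullet> x)) \<partial>torus) = of_int (k $ j) * (\<integral>x. v x $ i * cos (rvec k \<bullet> x) \<partial>torus)"
    unfolding integral_mult_right_zero[symmetric] by (simp only: mult.left_commute)
  ultimately have 2: "(\<integral>x. G x $ i $ j * sin (rvec k \<bullet> x) \<partial>torus) = - of_int (k $ j) * (\<integral>x. v x $ i * cos (rvec k \<bullet> x) \<partial>torus)"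
    by simp
  show ?thesis unfolding fc_of_real[OF LG] fc_of_real[OF Lv] 1 2 by (simp add: field_simps)
qed

lemma weak_gradient_bound:
  assumes H: "H1 v" and F: "finite F"
  shows "ennreal ((2 * pi) ^ 3 * (\<Sum>k\<in>F. \<Sum>i\<in>UNIV. (norm (rvec k))\<^sup>2 * (norm (fc (\<lambda>x. complex_of_real (v x $ i)) k))\<^sup>2))
     \<le> L2_norm_sq (weak_gradient v)"
proof -
  define G where "G = weak_gradient v"
  have G: "is_weak_gradient v G" and v: "L2 v"
    using H someI_ex[of "is_weak_gradient v"] by (auto simp: H1_def G_def weak_gradient_def)
  have LG: "L2 G" using G by (simp add: is_weak_gradient_def)
  have Lij: "L2 (\<lambda>x. complex_of_real (G x $ i $ j))" for i j by (intro L2_of_real L2_component LG)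
  have int: "integrable torus (\<lambda>x. (G x $ i $ j)\<^sup>2)" for i j
    using L2_integrable_sq[OF L2_component[OF L2_component[OF LG]], of i j] by simp
  have "(2 * pi) ^ 3 * (\<Sum>k\<in>F. \<Sum>i\<in>UNIV. (norm (rvec k))\<^sup>2 * (norm (fc (\<lambda>x. complex_of_real (v x $ i)) k))\<^sup>2)
     = (2 * pi) ^ 3 * (\<Sum>k\<in>F. \<Sum>i\<in>UNIV. \<Sum>j\<in>UNIV. (norm (fc (\<lambda>x. complex_of_real (G x $ i $ j)) k))\<^sup>2)"
    by (simp add: weak_gradient_fc[OF G v] norm_rvec_sq sum_distrib_right norm_mult power_mult_distrib)
  also have "\<dots> = (\<Sum>i\<in>UNIV. \<Sum>j\<in>UNIV. (2 * pi) ^ 3 * (\<Sum>k\<in>F. (norm (fc (\<lambda>x. complex_of_real (G x $ i $ j)) k))\<^sup>2))"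
    by (simp add: sum_distrib_left sum.swap[of _ F])
  also have "\<dots> \<le> (\<Sum>i\<in>UNIV. \<Sum>j\<in>UNIV. (l2norm (\<lambda>x. complex_of_real (G x $ i $ j)))\<^sup>2)"
    by (intro sum_mono bessel Lij F)
  also have "\<dots> = (\<Sum>i\<in>UNIV. \<Sum>j\<in>UNIV. (\<integral>x. (G x $ i $ j)\<^sup>2 \<partial>torus))"
    by (simp add: l2norm_sq)
  also have "\<dots> = (\<integral>x. (\<Sum>i\<in>UNIV. \<Sum>j\<in>UNIV. (G x $ i $ j)\<^sup>2) \<partial>torus)"
    by (simp add: Bochner_Integration.integral_sum Bochner_Integration.integrable_sum int)
  also have "\<dots> = (\<integral>x. (norm (G x))\<^sup>2 \<partial>torus)"
    by (simp add: norm_vec_def L2_set_def sum_nonneg)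
  finally have "ennreal ((2 * pi) ^ 3 * (\<Sum>k\<in>F. \<Sum>i\<in>UNIV. (norm (rvec k))\<^sup>2 * (norm (fc (\<lambda>x. complex_of_real (v x $ i)) k))\<^sup>2))
     \<le> ennreal (\<integral>x. (norm (G x))\<^sup>2 \<partial>torus)" by (rule ennreal_leI)
  also have "\<dots> = L2_norm_sq G"
    unfolding L2_norm_sq_def by (simp add: nn_integral_eq_integral L2_integrable_sq LG)
  finally show ?thesis by (simp add: G_def)
qed

section \<open>Measurability in time\<close>

definition uhat :: "(real^3 \<Rightarrow> real^3) \<Rightarrow> 3 \<Rightarrow> int^3 \<Rightarrow> complex" where
  "uhat v i = fc (\<lambda>x. complex_of_real (v x $ i))"

abbreviation time_measure :: "real \<Rightarrow> real measure" where
  "time_measure T \<equiv> restrict_space lborel {0<..<T}"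

lemma time_measurable_continuous:
  fixes f :: "real \<Rightarrow> 'a::topological_space"
  assumes "continuous_on {0..<T} f"
  shows "f \<in> borel_measurable (time_measure T)"
proof -
  have "f \<in> borel_measurable (restrict_space borel {0<..<T})"
    by (rule borel_measurable_continuous_on_restrict) (rule continuous_on_subset[OF assms], auto)
  then show ?thesis by (simp add: measurable_def space_restrict_space sets_restrict_space)
qed

lemma time_AE: "AE t in time_measure T. P t" if "AE t in lborel. t \<in> {0<..<T} \<longrightarrow> P t"
  using that by (subst AE_restrict_space_iff) auto

lemma L2_norm_sq_eq: "L2 v \<Longrightarrow> L2_norm_sq v = ennreal ((l2norm v)\<^sup>2)"
  unfolding L2_norm_sq_def l2norm_sq by (simp add: nn_integral_eq_integral L2_integrable_sq)

lemma l2norm_sq_vec: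
  fixes v :: "real^3 \<Rightarrow> real^3"
  assumes "L2 v"
  shows "(l2norm v)\<^sup>2 = (\<Sum>i\<in>UNIV. (l2norm (\<lambda>x. v x $ i))\<^sup>2)"
proof -
  have int: "integrable torus (\<lambda>x. (v x $ i)\<^sup>2)" for i
    using L2_integrable_sq[OF L2_component[OF assms], of i] by simp
  have "(l2norm v)\<^sup>2 = (\<integral>x. (\<Sum>i\<in>UNIV. (v x $ i)\<^sup>2) \<partial>torus)"
    by (simp add: l2norm_sq norm_vec_def L2_set_def sum_nonneg)
  also have "\<dots> = (\<Sum>i\<in>UNIV. (l2norm (\<lambda>x. v x $ i))\<^sup>2)"
    by (simp add: l2norm_sq Bochner_Integration.integral_sum int)
  finally show ?thesis .
qed

lemma parseval_sums:
  fixes f :: "real^3 \<Rightarrow> real"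
  assumes "L2 f"
  shows "(\<lambda>N. (2 * pi) ^ 3 * (\<Sum>k\<in>cube N. (norm (fc (\<lambda>x. complex_of_real (f x)) k))\<^sup>2)) \<longlonglongrightarrow> (l2norm f)\<^sup>2"
proof -
  let ?f = "\<lambda>x. complex_of_real (f x)"
  have "(\<lambda>N. (l2norm f)\<^sup>2 - (l2norm (\<lambda>x. ?f x - tpoly (cube N) (fc ?f) x))\<^sup>2) \<longlonglongrightarrow> (l2norm f)\<^sup>2 - 0\<^sup>2"
    by (intro tendsto_intros parseval_limit assms)
  then show ?thesis
    by (simp add: l2norm_diff_tpoly L2_of_real assms l2norm_of_real)
qed

lemma weakly_continuous_L2: "weakly_continuous T u \<Longrightarrow> t \<in> {0..<T} \<Longrightarrow> L2 (u t)"
  by (simp add: weakly_continuous_def)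

lemma weakly_continuous_component:
  assumes u: "weakly_continuous T u" and w: "L2 w"
  shows "continuous_on {0..<T} (\<lambda>t. \<integral>x. u t x $ i * w x \<partial>torus)"
proof -
  have "L2 (\<lambda>x. w x *\<^sub>R axis i (1::real) :: real^3)"
  proof -
    have [measurable]: "w \<in> borel_measurable torus" by (rule L2_measurable[OF w])
    show ?thesis using w by (auto simp: L2_def power_mult_distrib)
  qed
  then have "continuous_on {0..<T} (\<lambda>t. \<integral>x. u t x \<bullet> (w x *\<^sub>R axis i (1::real)) \<partial>torus)"
    using u unfolding weakly_continuous_def by blast
  then show ?thesis by (simp add: inner_axis mult.commute)
qed

lemma uhat_continuous:
  assumes u: "weakly_continuous T u"
  shows "continuous_on {0..<T} (\<lambda>t. uhat (u t) i k)"
proof -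
  have "L2 (\<lambda>x. cos (rvec k \<bullet> x))" "L2 (\<lambda>x. sin (rvec k \<bullet> x))"
    by (intro L2_continuous continuous_intros)+
  note c = weakly_continuous_component[OF u this(1), of i] weakly_continuous_component[OF u this(2), of i]
  have "continuous_on {0..<T} (\<lambda>t. (of_real (\<integral>x. u t x $ i * cos (rvec k \<bullet> x) \<partial>torus)
    - \<i> * of_real (\<integral>x. u t x $ i * sin (rvec k \<bullet> x) \<partial>torus)) / (2 * pi) ^ 3)"
    by (intro continuous_intros c) auto
  then show ?thesis
    by (rule continuous_on_eq)
       (simp add: uhat_def fc_of_real[OF L2_component[OF weakly_continuous_L2[OF u]]])
qed

lemma uhat_measurable:
  assumes "weakly_continuous T u"
  shows "(\<lambda>t. uhat (u t) i k) \<in> borel_measurable (time_measure T)"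
  by (rule time_measurable_continuous) (rule uhat_continuous[OF assms])

text \<open>Weak continuity makes each Fourier coefficient continuous in time, but not the norm; by
  Parseval the norm is a limit of finite sums of such coefficients.\<close>

lemma energy_measurable:
  assumes u: "weakly_continuous T u"
  shows "(\<lambda>t. (l2norm (u t))\<^sup>2) \<in> borel_measurable (time_measure T)"
proof (rule borel_measurable_LIMSEQ_real)
  fix t assume "t \<in> space (time_measure T)"
  then have L: "L2 (u t)" by (intro weakly_continuous_L2[OF u]) (auto simp: space_restrict_space)
  show "(\<lambda>N. \<Sum>i\<in>UNIV. (2 * pi) ^ 3 * (\<Sum>k\<in>cube N. (norm (uhat (u t) i k))\<^sup>2)) \<longlonglongrightarrow> (l2norm (u t))\<^sup>2"
    unfolding l2norm_sq_vec[OF L] uhat_def by (intro tendsto_sum parseval_sums L2_component L)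
next
  note [measurable] = uhat_measurable[OF u]
  show "(\<lambda>t. \<Sum>i\<in>UNIV. (2 * pi) ^ 3 * (\<Sum>k\<in>cube N. (norm (uhat (u t) i k))\<^sup>2)) \<in> borel_measurable (time_measure T)" for N
    by measurable
qed

lemma trilinear_bound:
  fixes f g w :: "real^3 \<Rightarrow> complex"
  assumes f: "L2 f" and g: "L2 g" and w: "w \<in> borel_measurable torus" "AE x in torus. norm (w x) \<le> W" "0 \<le> W"
  shows "integrable torus (\<lambda>x. f x * g x * w x)" and "norm (\<integral>x. f x * g x * w x \<partial>torus) \<le> W * l2norm f * l2norm g"
proof -
  have L: "L2 (\<lambda>x. w x * g x)" and n: "l2norm (\<lambda>x. w x * g x) \<le> W * l2norm g"
    using L2_mult_bounded[OF w(1,2) g w(3)] by auto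
  have eq: "f x * g x * w x = f x * (w x * g x)" for x by simp
  show "integrable torus (\<lambda>x. f x * g x * w x)" unfolding eq by (rule L2_mult_integrable[OF f L])
  have "norm (\<integral>x. f x * (w x * g x) \<partial>torus) \<le> l2norm f * l2norm (\<lambda>x. w x * g x)"
    by (rule L2_mult_integrable[OF f L])
  also have "\<dots> \<le> l2norm f * (W * l2norm g)" by (intro mult_left_mono n) auto
  finally show "norm (\<integral>x. f x * g x * w x \<partial>torus) \<le> W * l2norm f * l2norm g"
    unfolding eq by (simp add: mult_ac)
qed

lemma bounded_on_torus:
  fixes w :: "real^3 \<Rightarrow> 'b::euclidean_space"
  assumes "continuous_on UNIV w"
  obtains W where "0 \<le> W" "AE x in torus. norm (w x) \<le> W" "w \<in> borel_measurable torus"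
proof -
  have "compact (w ` cell)"
    by (intro compact_continuous_image continuous_on_subset[OF assms]) auto
  then obtain B where B: "\<forall>x\<in>cell. norm (w x) \<le> B"
    using compact_imp_bounded bounded_iff by (metis image_eqI)
  have "0 \<in> cell" by (simp add: mem_cell)
  with B have "0 \<le> B" using norm_ge_zero order_trans by blast
  moreover have "AE x in torus. norm (w x) \<le> B"
    by (rule AE_I2) (use B in \<open>simp add: space_torus\<close>)
  ultimately show ?thesis using that L2_measurable[OF L2_continuous[OF assms]] by blast
qed

text \<open>The integral is quadratic in \<open>u\<close>, so weak continuity does not make it
  continuous in time. With \<open>u\<close> replaced by a Fourier truncation it becomes a finite sum
  of products of continuous functions, and the truncations converge at each time.\<close>

lemma trilinear_measurable:
  fixes w :: "real^3 \<Rightarrow> real"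
  assumes u: "weakly_continuous T u" and w: "continuous_on UNIV w"
  shows "(\<lambda>t. \<integral>x. u t x $ i * u t x $ j * w x \<partial>torus) \<in> borel_measurable (time_measure T)"
proof -
  let ?w = "\<lambda>x. complex_of_real (w x)"
  have cw: "continuous_on UNIV ?w" by (intro continuous_intros w)
  obtain W where W: "0 \<le> W" "AE x in torus. norm (?w x) \<le> W" "?w \<in> borel_measurable torus"
    using bounded_on_torus[OF cw] by blast
  let ?P = "\<lambda>N t i. tpoly (cube N) (uhat (u t) i)"
  have "(\<lambda>t. \<integral>x. complex_of_real (u t x $ i) * complex_of_real (u t x $ j) * ?w x \<partial>torus) \<in> borel_measurable (time_measure T)"
  proof (rule borel_measurable_LIMSEQ_metric)
    fix t assume "t \<in> space (time_measure T)"
    then have L: "L2 (u t)" by (intro weakly_continuous_L2[OF u]) (auto simp: space_restrict_space)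
    let ?f = "\<lambda>i x. complex_of_real (u t x $ i)"
    have Lf: "L2 (?f i)" for i by (intro L2_of_real L2_component L)
    have lim: "(\<lambda>N. l2norm (\<lambda>x. ?f i x - ?P N t i x)) \<longlonglongrightarrow> 0" for i
      unfolding uhat_def by (intro parseval_limit L2_component L)
    have Ld: "L2 (\<lambda>x. ?f i x - ?P N t i x)" for i N by (intro L2_diff Lf L2_tpoly)
    note I = trilinear_bound(1)[OF _ _ W(3,2,1)] and B = trilinear_bound(2)[OF _ _ W(3,2,1)]
    \<comment> \<open>One factor is replaced at a time, so every error term contains an L2
      difference that tends to 0.\<close>
    have alg: "a' * b' * w - a * b * w = - ((a - a') * b * w) - a' * (b - b') * w" for a a' b b' w :: complex
      by (simp add: algebra_simps)
    have nt: "norm (- a - b) \<le> norm a + norm b" for a b :: complex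
      using norm_triangle_ineq4[of "- a" b] by simp
    have le: "norm ((\<integral>x. ?P N t i x * ?P N t j x * ?w x \<partial>torus) - (\<integral>x. ?f i x * ?f j x * ?w x \<partial>torus))
       \<le> W * l2norm (\<lambda>x. ?f i x - ?P N t i x) * l2norm (?f j) + W * (l2norm (?f i) + l2norm (\<lambda>x. ?f i x - ?P N t i x)) * l2norm (\<lambda>x. ?f j x - ?P N t j x)" for N
    proof -
      have "(\<integral>x. ?P N t i x * ?P N t j x * ?w x \<partial>torus) - (\<integral>x. ?f i x * ?f j x * ?w x \<partial>torus)
        = (\<integral>x. ?P N t i x * ?P N t j x * ?w x - ?f i x * ?f j x * ?w x \<partial>torus)"
        by (intro Bochner_Integration.integral_diff[symmetric] I L2_tpoly Lf)
      also have "\<dots> = (\<integral>x. - ((?f i x - ?P N t i x) * ?f j x * ?w x) - (?P N t i x * (?f j x - ?P N t j x) * ?w x) \<partial>torus)"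
        by (simp only: alg)
      also have "\<dots> = - (\<integral>x. (?f i x - ?P N t i x) * ?f j x * ?w x \<partial>torus) - (\<integral>x. ?P N t i x * (?f j x - ?P N t j x) * ?w x \<partial>torus)"
        by (simp only: Bochner_Integration.integral_diff[OF Bochner_Integration.integrable_minus[OF I[OF Ld Lf]] I[OF L2_tpoly Ld]] integral_minus)
      finally have eq: "(\<integral>x. ?P N t i x * ?P N t j x * ?w x \<partial>torus) - (\<integral>x. ?f i x * ?f j x * ?w x \<partial>torus) =
         - (\<integral>x. (?f i x - ?P N t i x) * ?f j x * ?w x \<partial>torus) - (\<integral>x. ?P N t i x * (?f j x - ?P N t j x) * ?w x \<partial>torus)" .
      have "norm ((\<integral>x. ?P N t i x * ?P N t j x * ?w x \<partial>torus) - (\<integral>x. ?f i x * ?f j x * ?w x \<partial>torus)) \<le> norm (\<integral>x. (?f i x - ?P N t i x) * ?f j x * ?w x \<partial>torus) + norm (\<integral>x. ?P N t i x * (?f j x - ?P N t j x) * ?w x \<partial>torus)"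
        unfolding eq by (rule nt)
      also have "\<dots> \<le> W * l2norm (\<lambda>x. ?f i x - ?P N t i x) * l2norm (?f j) + W * l2norm (?P N t i) * l2norm (\<lambda>x. ?f j x - ?P N t j x)"
        by (intro add_mono B L2_tpoly Lf Ld)
      also have "\<dots> \<le> W * l2norm (\<lambda>x. ?f i x - ?P N t i x) * l2norm (?f j) + W * (l2norm (?f i) + l2norm (\<lambda>x. ?f i x - ?P N t i x)) * l2norm (\<lambda>x. ?f j x - ?P N t j x)"
      proof -
        have "l2norm (?P N t i) \<le> l2norm (?f i) + l2norm (\<lambda>x. ?f i x - ?P N t i x)"
          using L2_diff(2)[OF Lf[of i] Ld[of i N]] by simp
        then show ?thesis
          by (intro add_left_mono mult_right_mono mult_left_mono W(1) l2norm_nonneg)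
      qed
      finally show ?thesis .
    qed
    have "(\<lambda>N. W * l2norm (\<lambda>x. ?f i x - ?P N t i x) * l2norm (?f j) + W * (l2norm (?f i) + l2norm (\<lambda>x. ?f i x - ?P N t i x)) * l2norm (\<lambda>x. ?f j x - ?P N t j x)) \<longlonglongrightarrow>
       W * 0 * l2norm (?f j) + W * (l2norm (?f i) + 0) * 0"
      by (intro tendsto_intros lim)
    then have "(\<lambda>N. (\<integral>x. ?P N t i x * ?P N t j x * ?w x \<partial>torus) - (\<integral>x. ?f i x * ?f j x * ?w x \<partial>torus)) \<longlonglongrightarrow> 0"
      by (intro Lim_null_comparison[OF always_eventually[OF allI[OF le]]]) simp
    then show "(\<lambda>N. \<integral>x. ?P N t i x * ?P N t j x * ?w x \<partial>torus) \<longlonglongrightarrow> (\<integral>x. ?f i x * ?f j x * ?w x \<partial>torus)"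
      by (simp add: LIM_zero_iff)
  next
    fix N
    note [measurable] = uhat_measurable[OF u]
    have eq: "(\<integral>x. ?P N t i x * ?P N t j x * ?w x \<partial>torus) =
      (\<Sum>k\<in>cube N. \<Sum>l\<in>cube N. uhat (u t) i k * uhat (u t) j l * (\<integral>x. fexp k x * fexp l x * ?w x \<partial>torus))" for t
    proof -
      have "(\<integral>x. ?P N t i x * ?P N t j x * ?w x \<partial>torus) =
        (\<integral>x. (\<Sum>k\<in>cube N. \<Sum>l\<in>cube N. uhat (u t) i k * uhat (u t) j l * (fexp k x * fexp l x * ?w x)) \<partial>torus)"
        unfolding tpoly_def sum_product sum_distrib_right
        by (intro Bochner_Integration.integral_cong sum.cong refl) (simp add: sum_distrib_left sum_distrib_right mult_ac)
      also have "\<dots> = (\<Sum>k\<in>cube N. \<Sum>l\<in>cube N. uhat (u t) i k * uhat (u t) j l * (\<integral>x. fexp k x * fexp l x * ?w x \<partial>torus))"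
      proof -
        have int: "integrable torus (\<lambda>x. uhat (u t) i k * uhat (u t) j l * (fexp k x * fexp l x * ?w x))" for k l
          by (rule integrable_mult_right) (rule trilinear_bound(1)[OF L2_fexp L2_fexp W(3,2,1)])
        show ?thesis
          by (simp only: Bochner_Integration.integral_sum[OF Bochner_Integration.integrable_sum[OF int]]
            Bochner_Integration.integral_sum[OF int] integral_mult_right_zero)
      qed
      finally show ?thesis .
    qed
    show "(\<lambda>t. \<integral>x. ?P N t i x * ?P N t j x * ?w x \<partial>torus) \<in> borel_measurable (time_measure T)"
      unfolding eq by measurable
  qed
  moreover have "complex_of_real (\<integral>x. u t x $ i * u t x $ j * w x \<partial>torus) = (\<integral>x. complex_of_real (u t x $ i) * complex_of_real (u t x $ j) * ?w x \<partial>torus)" for t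
    by (simp only: of_real_mult[symmetric] integral_complex_of_real)
  ultimately have "(\<lambda>t. complex_of_real (\<integral>x. u t x $ i * u t x $ j * w x \<partial>torus)) \<in> borel_measurable (time_measure T)"
    by simp
  then have "(\<lambda>t. Re (complex_of_real (\<integral>x. u t x $ i * u t x $ j * w x \<partial>torus))) \<in> borel_measurable (time_measure T)"
    by measurable
  then show ?thesis by simp
qed

text \<open>By Parseval this is \<open>\<parallel>\<nabla>v\<parallel>\<^sup>2 / (2\<pi>)\<^sup>3\<close>; unlike the norm of \<open>weak_gradient\<close> it is visibly measurable
  in time.\<close>

definition grad_sq :: "(real^3 \<Rightarrow> real^3) \<Rightarrow> ennreal" where
  "grad_sq v = (SUP N. ennreal (\<Sum>k\<in>cube N. \<Sum>i\<in>UNIV. (norm (rvec k))\<^sup>2 * (norm (uhat v i k))\<^sup>2))"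

text \<open>Measurability in time of the norm of \<open>weak_gradient\<close> is never asserted:
  only monotonicity of the nonnegative integral is applied to it, and \<open>grad_sq\<close>, which
  lies below, inherits finiteness.\<close>

lemma L2_H1_integrable:
  assumes u: "weakly_continuous T u" and h: "L2_H1 T u"
  shows "integrable (time_measure T) (\<lambda>t. (l2norm (u t))\<^sup>2)"
    and "integrable (time_measure T) (\<lambda>t. enn2real (grad_sq (u t)))"
    and "AE t in time_measure T. grad_sq (u t) < \<infinity>"
proof -
  have AE_H1: "AE t in time_measure T. H1 (u t)"
    using h unfolding L2_H1_def by (intro time_AE) (auto elim: eventually_mono)
  have nn: "(\<integral>\<^sup>+t. L2_norm_sq (u t) + L2_norm_sq (weak_gradient (u t)) \<partial>time_measure T) < \<infinity>"
  proof -
    have "(\<integral>\<^sup>+t. L2_norm_sq (u t) + L2_norm_sq (weak_gradient (u t)) \<partial>time_measure T)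
      = (\<integral>\<^sup>+t\<in>{0<..<T}. (L2_norm_sq (u t) + L2_norm_sq (weak_gradient (u t))) \<partial>lborel)"
      by (subst nn_integral_restrict_space) auto
    also have "\<dots> \<le> (\<integral>\<^sup>+t\<in>{0..<T}. (L2_norm_sq (u t) + L2_norm_sq (weak_gradient (u t))) \<partial>lborel)"
      by (intro nn_integral_mono mult_left_mono) (auto simp: indicator_def)
    also have "\<dots> < \<infinity>" using h by (simp add: L2_H1_def)
    finally show ?thesis .
  qed
  note [measurable] = energy_measurable[OF u] uhat_measurable[OF u]
  have gm [measurable]: "(\<lambda>t. grad_sq (u t)) \<in> borel_measurable (time_measure T)"
    unfolding grad_sq_def by measurable
  have AE_L2: "AE t in time_measure T. L2 (u t)"
    using AE_H1 by eventually_elim (simp add: H1_def)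
  have "(\<integral>\<^sup>+t. ennreal (norm ((l2norm (u t))\<^sup>2)) \<partial>time_measure T) \<le> (\<integral>\<^sup>+t. L2_norm_sq (u t) + L2_norm_sq (weak_gradient (u t)) \<partial>time_measure T)"
    by (rule nn_integral_mono_AE) (use AE_L2 in eventually_elim, simp add: L2_norm_sq_eq)
  also note nn
  finally show "integrable (time_measure T) (\<lambda>t. (l2norm (u t))\<^sup>2)"
    by (intro integrableI_bounded) auto
  have le: "AE t in time_measure T. ennreal ((2 * pi) ^ 3) * grad_sq (u t) \<le> L2_norm_sq (weak_gradient (u t))"
    using AE_H1
  proof eventually_elim
    case (elim t)
    show ?case unfolding grad_sq_def SUP_mult_left_ennreal
    proof (rule SUP_least)
      fix N
      show "ennreal ((2 * pi) ^ 3) * ennreal (\<Sum>k\<in>cube N. \<Sum>i\<in>UNIV. (norm (rvec k))\<^sup>2 * (norm (uhat (u t) i k))\<^sup>2) \<le> L2_norm_sq (weak_gradient (u t))"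
        using weak_gradient_bound[OF elim finite_cube[of N]] unfolding uhat_def by (simp only: ennreal_mult''[of "(2 * pi) ^ 3"] sum_nonneg mult_nonneg_nonneg zero_le_power2 ennreal_mult[symmetric] zero_le_power pi_ge_zero)
    qed
  qed
  have "1 \<le> (2 * pi) ^ 3" using pi_gt3 by (intro one_le_power) auto
  then have one: "ennreal 1 \<le> ennreal ((2 * pi) ^ 3)" by (rule ennreal_leI)
  have le': "AE t in time_measure T. grad_sq (u t) \<le> L2_norm_sq (u t) + L2_norm_sq (weak_gradient (u t))"
    using le
  proof eventually_elim
    case (elim t)
    have "grad_sq (u t) = ennreal 1 * grad_sq (u t)" by simp
    also have "\<dots> \<le> ennreal ((2 * pi) ^ 3) * grad_sq (u t)" by (rule mult_right_mono[OF one]) simp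
    also note elim
    also have "L2_norm_sq (weak_gradient (u t)) \<le> L2_norm_sq (u t) + L2_norm_sq (weak_gradient (u t))" by simp
    finally show ?case .
  qed
  have fin: "(\<integral>\<^sup>+t. grad_sq (u t) \<partial>time_measure T) < \<infinity>"
    using nn_integral_mono_AE[OF le'] nn by (rule order_le_less_trans)
  then show "AE t in time_measure T. grad_sq (u t) < \<infinity>"
    using nn_integral_PInf_AE[OF gm] by (auto simp: less_top elim: eventually_mono)
  have "(\<integral>\<^sup>+t. ennreal (norm (enn2real (grad_sq (u t)))) \<partial>time_measure T) \<le> (\<integral>\<^sup>+t. grad_sq (u t) \<partial>time_measure T)"
    by (rule nn_integral_mono) (simp add: ennreal_enn2real_if)
  also note fin
  finally show "integrable (time_measure T) (\<lambda>t. enn2real (grad_sq (u t)))"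
    by (intro integrableI_bounded) auto
qed

lemma grad_sq_bound:
  assumes "grad_sq v < \<infinity>"
  shows "(\<Sum>k\<in>cube N. (norm (rvec k))\<^sup>2 * (norm (uhat v i k))\<^sup>2) \<le> enn2real (grad_sq v)"
proof -
  have "ennreal (\<Sum>k\<in>cube N. (norm (rvec k))\<^sup>2 * (norm (uhat v i k))\<^sup>2) \<le>
    ennreal (\<Sum>k\<in>cube N. \<Sum>i\<in>UNIV. (norm (rvec k))\<^sup>2 * (norm (uhat v i k))\<^sup>2)"
    by (intro ennreal_leI sum_mono member_le_sum[of i UNIV "\<lambda>i. _ * (norm (uhat v i _))\<^sup>2"]) auto
  also have "\<dots> \<le> grad_sq v" unfolding grad_sq_def by (rule SUP_upper) simp
  also have "\<dots> = ennreal (enn2real (grad_sq v))" using assms by simp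
  finally show ?thesis by (simp add: ennreal_le_iff)
qed

section \<open>The equation tested against a trigonometric field\<close>

text \<open>Sines are chosen because their derivatives are cosines with real coefficients. The
  coefficients of U on the A and B blocks are real too, so their products meet the derivatives of
  the test field in phase.\<close>

definition test_V :: "(int^3) set \<Rightarrow> (int^3 \<Rightarrow> real^3) \<Rightarrow> real^3 \<Rightarrow> real^3" where
  "test_V D d = trigf D (\<lambda>_. 0) d"

definition test_DV :: "(int^3) set \<Rightarrow> (int^3 \<Rightarrow> real^3) \<Rightarrow> 3 \<Rightarrow> real^3 \<Rightarrow> real^3" where
  "test_DV D d j = trigf D (\<lambda>k. of_int (k $ j) *\<^sub>R d k) (\<lambda>_. 0)"

definition test_LV :: "(int^3) set \<Rightarrow> (int^3 \<Rightarrow> real^3) \<Rightarrow> real^3 \<Rightarrow> real^3" where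
  "test_LV D d = trigf D (\<lambda>_. 0) (\<lambda>k. - (norm (rvec k))\<^sup>2 *\<^sub>R d k)"

text \<open>The nonlinear term of the weak formulation: the tensor of \<open>v\<close> with itself,
  paired with the gradient of \<open>test_V D d\<close>.\<close>

definition transport :: "(int^3) set \<Rightarrow> (int^3 \<Rightarrow> real^3) \<Rightarrow> (real^3 \<Rightarrow> real^3) \<Rightarrow> real" where
  "transport D d v = (\<Sum>i\<in>UNIV. \<Sum>j\<in>UNIV. \<integral>x. v x $ i * v x $ j * test_DV D d j x $ i \<partial>torus)"

lemma continuous_trigf: "continuous_on S (trigf D w w')"
  unfolding trigf_def by (intro continuous_intros)

lemma continuous_test: "continuous_on S (test_V D d)" "continuous_on S (test_DV D d j)" "continuous_on S (test_LV D d)"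
  unfolding test_V_def test_DV_def test_LV_def by (intro continuous_trigf)+

lemma integrable_trilinear_real:
  fixes w :: "real^3 \<Rightarrow> real"
  assumes v: "L2 v" and w: "continuous_on UNIV w"
  shows "integrable torus (\<lambda>x. v x $ i * v x $ j * w x)"
proof -
  obtain W where W: "0 \<le> W" "AE x in torus. norm (w x) \<le> W" "w \<in> borel_measurable torus"
    using bounded_on_torus[OF w] by blast
  have "integrable torus (\<lambda>x. v x $ i * (w x * v x $ j))"
    by (intro L2_mult_integrable L2_mult_bounded[OF W(3,2) _ W(1)] L2_component v)
  then show ?thesis by (simp add: mult_ac)
qed

lemma integrable_inner_L2:
  fixes v w :: "real^3 \<Rightarrow> real^3"
  assumes "L2 v" "L2 w"
  shows "integrable torus (\<lambda>x. v x \<bullet> w x)" and "\<bar>\<integral>x. v x \<bullet> w x \<partial>torus\<bar> \<le> l2norm v * l2norm w"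
proof -
  have [measurable]: "v \<in> borel_measurable torus" "w \<in> borel_measurable torus"
    using assms by (auto dest: L2_measurable)
  show int: "integrable torus (\<lambda>x. v x \<bullet> w x)"
    by (rule Bochner_Integration.integrable_bound[OF L2_prod_norm(1)[OF assms]]) (auto simp: Cauchy_Schwarz_ineq2)
  have "\<bar>\<integral>x. v x \<bullet> w x \<partial>torus\<bar> \<le> (\<integral>x. \<bar>v x \<bullet> w x\<bar> \<partial>torus)" by (rule integral_abs_bound)
  also have "\<dots> \<le> (\<integral>x. norm (v x) * norm (w x) \<partial>torus)"
    by (intro integral_mono integrable_abs int L2_prod_norm(1)[OF assms] Cauchy_Schwarz_ineq2)
  also have "\<dots> \<le> l2norm v * l2norm w" by (rule L2_prod_norm(2)[OF assms])
  finally show "\<bar>\<integral>x. v x \<bullet> w x \<partial>torus\<bar> \<le> l2norm v * l2norm w" .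
qed

text \<open>The test function is the bump times \<open>test_V\<close>. Orthogonality of
  \<open>d k\<close> to \<open>k\<close> makes it divergence-free, which eliminates the
  pressure.\<close>

lemma ns_time_identity:
  assumes u: "weakly_continuous T u" and ns: "ns_distributional \<nu> T u"
    and div: "\<And>k. k \<in> D \<Longrightarrow> rvec k \<bullet> d k = 0" and ab: "0 < a" "b < T"
  shows "(\<integral>t. bump' a b 0 0 t * (\<integral>x. u t x \<bullet> test_V D d x \<partial>torus)
    + bump a b 0 0 t * (transport D d (u t) + \<nu> * (\<integral>x. u t x \<bullet> test_LV D d x \<partial>torus)) \<partial>time_measure T) = 0"
proof -
  define eta eta' where "eta = bump a b 0 0" and "eta' = bump' a b 0 0"
  have eta: "\<And>t. (eta has_real_derivative eta' t) (at t)" unfolding eta_def eta'_def by (rule bump_deriv)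
  define phi where "phi = (\<lambda>z. eta (fst z) *\<^sub>R trigf D (\<lambda>_. 0) d (snd z))"
  have test: "test_fun T phi" unfolding phi_def eta_def using ab by (intro test_fun_bump_trig)
  have dt: "deriv_t phi (t, x) = eta' t *\<^sub>R test_V D d x" for t x
    unfolding phi_def test_V_def by (rule deriv_t_time_space[OF eta])
  have dx: "deriv_x j phi = (\<lambda>z. eta (fst z) *\<^sub>R test_DV D d j (snd z))" for j
    unfolding phi_def test_DV_def deriv_x_time_space[OF eta] by (simp add: trigf_def)
  have lap: "laplacian_x phi (t, x) = eta t *\<^sub>R test_LV D d x" for t x
    unfolding phi_def test_LV_def laplacian_time_space[OF eta] by (simp add: trigf_def)
  have "div_x phi z = 0" for z
  proof -
    have "div_x phi z = eta (fst z) * (\<Sum>j\<in>UNIV. \<Sum>k\<in>D. cos (rvec k \<bullet> snd z) * (of_int (k $ j) * d k $ j))"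
      by (simp add: div_x_def dx test_DV_def trigf_def sum_distrib_left mult_ac)
    also have "(\<Sum>j\<in>UNIV. \<Sum>k\<in>D. cos (rvec k \<bullet> snd z) * (of_int (k $ j) * d k $ j)) = (\<Sum>k\<in>D. cos (rvec k \<bullet> snd z) * (rvec k \<bullet> d k))"
      by (subst sum.swap) (simp add: inner_vec_def sum_distrib_left)
    also have "\<dots> = 0" using div by simp
    finally show ?thesis by simp
  qed
  then have divphi: "div_x phi = (\<lambda>z. 0)" by auto
  obtain P where P: "distribution T P" and eq: "\<And>\<phi> :: real \<times> (real^3) \<Rightarrow> real^3. test_fun T \<phi> \<Longrightarrow>
           (LBINT t:{0<..<T}. (\<integral>x. (u t x \<bullet> deriv_t \<phi> (t, x)
              + u t x \<bullet> (\<Sum>j\<in>UNIV. u t x $ j *\<^sub>R deriv_x j \<phi> (t, x))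
              + \<nu> * (u t x \<bullet> laplacian_x \<phi> (t, x))) \<partial>torus)) + P (div_x \<phi>) = 0"
    using ns unfolding ns_distributional_def by blast
  have tr: "test_fun T (\<lambda>z. bump a b 0 0 (fst z) *\<^sub>R trigf D (\<lambda>_. 0) (\<lambda>_. 0::real) (snd z))"
    using ab by (intro test_fun_bump_trig)
  \<comment> \<open>Homogeneity of the pressure is stated for test functions, so it is applied with
    scalar 0 to the bump with zero coefficients.\<close>
  have "P (\<lambda>z. 0) = 0"
  proof -
    have "P (\<lambda>z. r * \<phi> z) = r * P \<phi>" if "test_fun T \<phi>" for r \<phi>
      using P that unfolding distribution_def by blast
    from this[OF tr, of 0] show ?thesis by simp
  qed
  with eq[OF test] have 0: "(LBINT t:{0<..<T}. (\<integral>x. (u t x \<bullet> deriv_t phi (t, x)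
              + u t x \<bullet> (\<Sum>j\<in>UNIV. u t x $ j *\<^sub>R deriv_x j phi (t, x))
              + \<nu> * (u t x \<bullet> laplacian_x phi (t, x))) \<partial>torus)) = 0"
    by (simp add: divphi)
  have inner: "(\<integral>x. (u t x \<bullet> deriv_t phi (t, x)
              + u t x \<bullet> (\<Sum>j\<in>UNIV. u t x $ j *\<^sub>R deriv_x j phi (t, x))
              + \<nu> * (u t x \<bullet> laplacian_x phi (t, x))) \<partial>torus) =
       eta' t * (\<integral>x. u t x \<bullet> test_V D d x \<partial>torus)
    + eta t * (transport D d (u t) + \<nu> * (\<integral>x. u t x \<bullet> test_LV D d x \<partial>torus))"
    if t: "t \<in> {0<..<T}" for t
  proof -
    have L: "L2 (u t)" using t by (intro weakly_continuous_L2[OF u]) auto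
    have i1: "integrable torus (\<lambda>x. u t x \<bullet> test_V D d x)" "integrable torus (\<lambda>x. u t x \<bullet> test_LV D d x)"
      by (intro integrable_inner_L2 L L2_continuous continuous_test)+
    have i2: "integrable torus (\<lambda>x. u t x $ i * u t x $ j * test_DV D d j x $ i)" for i j
      by (intro integrable_trilinear_real L continuous_intros continuous_test)
    have pt: "(u t x \<bullet> deriv_t phi (t, x) + u t x \<bullet> (\<Sum>j\<in>UNIV. u t x $ j *\<^sub>R deriv_x j phi (t, x))
              + \<nu> * (u t x \<bullet> laplacian_x phi (t, x))) =
        eta' t * (u t x \<bullet> test_V D d x) + eta t * (\<Sum>i\<in>UNIV. \<Sum>j\<in>UNIV. u t x $ i * u t x $ j * test_DV D d j x $ i)
         + eta t * \<nu> * (u t x \<bullet> test_LV D d x)" for x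
    proof -
      have "u t x \<bullet> (\<Sum>j\<in>UNIV. u t x $ j *\<^sub>R eta t *\<^sub>R test_DV D d j x) =
        eta t * (\<Sum>j\<in>UNIV. \<Sum>i\<in>UNIV. u t x $ i * u t x $ j * test_DV D d j x $ i)"
        by (simp only: inner_sum_right) (simp add: inner_vec_def sum_distrib_left mult_ac)
      also have "\<dots> = eta t * (\<Sum>i\<in>UNIV. \<Sum>j\<in>UNIV. u t x $ i * u t x $ j * test_DV D d j x $ i)"
        by (subst sum.swap) simp
      finally show ?thesis by (simp add: dt dx lap)
    qed
    have "(\<integral>x. (u t x \<bullet> deriv_t phi (t, x)
              + u t x \<bullet> (\<Sum>j\<in>UNIV. u t x $ j *\<^sub>R deriv_x j phi (t, x))
              + \<nu> * (u t x \<bullet> laplacian_x phi (t, x))) \<partial>torus) =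
       eta' t * (\<integral>x. u t x \<bullet> test_V D d x \<partial>torus)
       + eta t * (\<integral>x. (\<Sum>i\<in>UNIV. \<Sum>j\<in>UNIV. u t x $ i * u t x $ j * test_DV D d j x $ i) \<partial>torus)
       + eta t * \<nu> * (\<integral>x. u t x \<bullet> test_LV D d x \<partial>torus)"
      unfolding pt
      by (subst Bochner_Integration.integral_add | intro Bochner_Integration.integrable_add integrable_mult_right i1 i2 Bochner_Integration.integrable_sum)+ simp
    also have "(\<integral>x. (\<Sum>i\<in>UNIV. \<Sum>j\<in>UNIV. u t x $ i * u t x $ j * test_DV D d j x $ i) \<partial>torus) = transport D d (u t)"
      unfolding transport_def
      by (simp only: Bochner_Integration.integral_sum[OF Bochner_Integration.integrable_sum[OF i2]]
            Bochner_Integration.integral_sum[OF i2])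
    finally show ?thesis by (simp add: algebra_simps)
  qed
  have "(\<integral>t. eta' t * (\<integral>x. u t x \<bullet> test_V D d x \<partial>torus)
    + eta t * (transport D d (u t) + \<nu> * (\<integral>x. u t x \<bullet> test_LV D d x \<partial>torus)) \<partial>time_measure T) =
    (LBINT t:{0<..<T}. (\<integral>x. (u t x \<bullet> deriv_t phi (t, x)
              + u t x \<bullet> (\<Sum>j\<in>UNIV. u t x $ j *\<^sub>R deriv_x j phi (t, x))
              + \<nu> * (u t x \<bullet> laplacian_x phi (t, x))) \<partial>torus))"
    unfolding set_lebesgue_integral_def
    by (subst integral_restrict_space) (auto simp: inner indicator_def intro!: Bochner_Integration.integral_cong)
  with 0 show ?thesis by (simp add: eta_def eta'_def)
qed

lemma bounded_bump:
  obtains E where "0 < E" "\<And>t. bump a b 0 0 t \<le> E" "\<And>t. \<bar>bump' a b 0 0 t\<bar> \<le> E"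
proof -
  have bd: "\<exists>B. \<forall>t. \<bar>f t\<bar> \<le> B" if f: "continuous_on {a..b} f" and out: "\<And>t. t \<notin> {a..b} \<Longrightarrow> f t = 0" for f :: "real \<Rightarrow> real"
  proof -
    have "bounded (f ` {a..b})" by (intro compact_imp_bounded compact_continuous_image f) auto
    then obtain B where "\<forall>y\<in>f ` {a..b}. norm y \<le> B" unfolding bounded_iff by blast
    then have B: "\<And>t. t \<in> {a..b} \<Longrightarrow> \<bar>f t\<bar> \<le> B" by simp
    have "\<bar>f t\<bar> \<le> \<bar>B\<bar>" for t
      using B[of t] out[of t] by (cases "t \<in> {a..b}") auto
    then show ?thesis by blast
  qed
  obtain B1 where B1: "\<And>t. \<bar>bump a b 0 0 t\<bar> \<le> B1" using bd[OF bump_continuous bump_outside] by blast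
  obtain B2 where B2: "\<And>t. \<bar>bump' a b 0 0 t\<bar> \<le> B2" using bd[OF bump'_continuous bump'_outside] by blast
  show ?thesis
  proof (rule that[of "1 + \<bar>B1\<bar> + \<bar>B2\<bar>"])
    show "bump a b 0 0 t \<le> 1 + \<bar>B1\<bar> + \<bar>B2\<bar>" for t using B1[of t] by linarith
    show "\<bar>bump' a b 0 0 t\<bar> \<le> 1 + \<bar>B1\<bar> + \<bar>B2\<bar>" for t using B2[of t] by linarith
  qed auto
qed

lemma finite_time_measure: "finite_measure (time_measure T)"
proof (rule finite_measureI)
  show "emeasure (time_measure T) (space (time_measure T)) \<noteq> \<infinity>"
    by (cases "0 \<le> T") (simp_all add: emeasure_restrict_space space_restrict_space)
qed

lemma integral_bump_pos:
  assumes "0 < a" "a < b" "b < T"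
  shows "integrable (time_measure T) (bump a b 0 0)" "0 < (\<integral>t. bump a b 0 0 t \<partial>time_measure T)"
proof -
  have fin: "finite_measure (time_measure T)"
    by (rule finite_time_measure)
  interpret finite_measure "time_measure T" by (rule fin)
  obtain E where E: "\<And>t. bump a b 0 0 t \<le> E" using bounded_bump by metis
  show int: "integrable (time_measure T) (bump a b 0 0)"
    by (rule integrable_const_bound[where B=E])
       (auto simp: E bump_nonneg intro!: time_measurable_continuous bump_continuous)
  show "0 < (\<integral>t. bump a b 0 0 t \<partial>time_measure T)"
  proof (rule ccontr)
    assume "\<not> ?thesis"
    moreover have "0 \<le> (\<integral>t. bump a b 0 0 t \<partial>time_measure T)" by (intro integral_nonneg_AE) (auto simp: bump_nonneg)
    ultimately have "(\<integral>t. bump a b 0 0 t \<partial>time_measure T) = 0" by linarith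
    then have "AE t in time_measure T. bump a b 0 0 t = 0"
      using integral_nonneg_eq_0_iff_AE[OF int] bump_nonneg by auto
    then have "AE t in lborel. t \<in> {0<..<T} \<longrightarrow> bump a b 0 0 t = 0"
      by (subst (asm) AE_restrict_space_iff) auto
    then have "AE t in lborel. t \<notin> {a<..<b}"
    proof eventually_elim
      case (elim t)
      show ?case
      proof
        assume t: "t \<in> {a<..<b}"
        then have "t \<in> {0<..<T}" using assms by auto
        with elim bump_pos[OF t, of 0 0] show False by simp
      qed
    qed
    then have "{a<..<b} \<in> null_sets lborel" by (subst AE_iff_null_sets) auto
    then have "emeasure lborel {a<..<b} = 0" by auto
    then show False using assms by simp
  qed
qed

text \<open>The tested equation has integral 0 in time. A lower bound valid at almost every time
  therefore forces the main constant to be paid for by the errors, which are measured against the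
  integrable quantity 1 + energy + dissipation.\<close>

lemma ns_lower_bound:
  assumes u: "weakly_continuous T u" and h: "L2_H1 T u" and ns: "ns_distributional \<nu> T u"
    and div: "\<And>k. k \<in> D \<Longrightarrow> rvec k \<bullet> d k = 0" and ab: "0 < a" "a < b" "b < T"
    and E: "\<And>t. bump a b 0 0 t \<le> E" "\<And>t. \<bar>bump' a b 0 0 t\<bar> \<le> E"
    and c: "0 \<le> c2" "0 \<le> c3"
    and low: "\<And>t. t \<in> {a..b} \<Longrightarrow> grad_sq (u t) < \<infinity> \<Longrightarrow>
      c1 - c2 * (1 + (l2norm (u t))\<^sup>2 + enn2real (grad_sq (u t))) \<le> transport D d (u t) + \<nu> * (\<integral>x. u t x \<bullet> test_LV D d x \<partial>torus)"
    and A: "\<And>t. t \<in> {a..b} \<Longrightarrow> \<bar>\<integral>x. u t x \<bullet> test_V D d x \<partial>torus\<bar> \<le> c3 * (1 + (l2norm (u t))\<^sup>2)"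
  shows "c1 * (\<integral>t. bump a b 0 0 t \<partial>time_measure T) \<le>
     E * (c2 + c3) * (\<integral>t. 1 + (l2norm (u t))\<^sup>2 + enn2real (grad_sq (u t)) \<partial>time_measure T)"
proof -
  let ?M = "time_measure T"
  let ?h = "\<lambda>t. 1 + (l2norm (u t))\<^sup>2 + enn2real (grad_sq (u t))"
  let ?A = "\<lambda>t. \<integral>x. u t x \<bullet> test_V D d x \<partial>torus" and ?B = "\<lambda>t. transport D d (u t)" and ?L = "\<lambda>t. \<integral>x. u t x \<bullet> test_LV D d x \<partial>torus"
  let ?f = "\<lambda>t. bump' a b 0 0 t * ?A t + bump a b 0 0 t * (?B t + \<nu> * ?L t)"
  have fin: "finite_measure ?M"
    by (rule finite_time_measure)
  have int_h: "integrable ?M ?h"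
    by (intro Bochner_Integration.integrable_add L2_H1_integrable[OF u h] finite_measure.integrable_const fin)
  have h0: "1 \<le> ?h t" for t by simp
  have cont: "continuous_on {0..<T} ?A" "continuous_on {0..<T} ?L"
    using u L2_continuous[OF continuous_test(1)] L2_continuous[OF continuous_test(3)] unfolding weakly_continuous_def by blast+
  have [measurable]: "?A \<in> borel_measurable ?M" "?L \<in> borel_measurable ?M"
    by (intro time_measurable_continuous cont)+
  have [measurable]: "?B \<in> borel_measurable ?M"
    unfolding transport_def by (intro borel_measurable_sum trilinear_measurable[OF u] continuous_intros continuous_test)
  have [measurable]: "bump a b 0 0 \<in> borel_measurable ?M" "bump' a b 0 0 \<in> borel_measurable ?M"
    by (intro time_measurable_continuous bump_continuous bump'_continuous)+
  have E0: "0 \<le> E" using E(2)[of 0] by linarith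
  have l2h: "l2norm (u t) \<le> ?h t" for t
  proof -
    have "0 \<le> (l2norm (u t) - 1)\<^sup>2" by simp
    then have "2 * l2norm (u t) \<le> 1 + (l2norm (u t))\<^sup>2" by (simp add: power2_diff)
    then show ?thesis using l2norm_nonneg[of "u t"] enn2real_nonneg[of "grad_sq (u t)"] by linarith
  qed
  \<comment> \<open>A crude bound whose constant may depend on \<open>D\<close> and
    \<open>d\<close>. Its purpose is the integrability of \<open>?f\<close>, without which the
    integrals could not be compared.\<close>
  have "\<exists>K. 0 \<le> K \<and> (\<forall>t\<in>{0<..<T}. \<bar>?B t\<bar> \<le> K * ?h t)"
  proof -
    have ex: "\<exists>W. 0 \<le> W \<and> (AE x in torus. norm (test_DV D d j x $ i) \<le> W)" for i j
    proof -
      have "continuous_on UNIV (\<lambda>x. test_DV D d j x $ i)" by (intro continuous_intros continuous_test)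
      then show ?thesis by (rule bounded_on_torus) blast
    qed
    define W where "W = (\<lambda>i j. SOME W. 0 \<le> W \<and> (AE x in torus. norm (test_DV D d j x $ i) \<le> W))"
    have W: "0 \<le> W i j" "AE x in torus. norm (test_DV D d j x $ i) \<le> W i j" for i j
      using someI_ex[OF ex[of j i]] by (auto simp: W_def)
    have "\<bar>?B t\<bar> \<le> (\<Sum>i\<in>UNIV. \<Sum>j\<in>UNIV. W i j) * ?h t" if "t \<in> {0<..<T}" for t
    proof -
      have L: "L2 (u t)" using that by (intro weakly_continuous_L2[OF u]) auto
      have "\<bar>\<integral>x. u t x $ i * u t x $ j * test_DV D d j x $ i \<partial>torus\<bar> \<le> W i j * ?h t" for i j
      proof -
        have m: "(\<lambda>x. test_DV D d j x $ i) \<in> borel_measurable torus"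
          by (intro L2_measurable L2_continuous continuous_intros continuous_test)
        have "\<bar>\<integral>x. u t x $ i * (test_DV D d j x $ i * u t x $ j) \<partial>torus\<bar> \<le> l2norm (\<lambda>x. u t x $ i) * l2norm (\<lambda>x. test_DV D d j x $ i * u t x $ j)"
          using L2_mult_integrable(2)[OF L2_component[OF L, of i] L2_mult_bounded(1)[OF m W(2) L2_component[OF L, of j] W(1)]] by simp
        also have "\<dots> \<le> l2norm (u t) * (W i j * l2norm (u t))"
          by (intro mult_mono l2norm_component L order_trans[OF L2_mult_bounded(2)[OF m W(2) L2_component[OF L, of j] W(1)]] mult_left_mono W) auto
        also have "\<dots> = W i j * (l2norm (u t))\<^sup>2" by (simp add: power2_eq_square)
        also have "\<dots> \<le> W i j * ?h t" by (intro mult_left_mono W) auto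
        finally show ?thesis by (simp add: mult_ac)
      qed
      then show ?thesis unfolding transport_def sum_distrib_right
        by (intro order_trans[OF sum_abs] sum_mono)
    qed
    moreover have "0 \<le> (\<Sum>i\<in>UNIV. \<Sum>j\<in>UNIV. W i j)" by (intro sum_nonneg W)
    ultimately show ?thesis by blast
  qed
  then obtain K where K: "0 \<le> K" "\<And>t. t \<in> {0<..<T} \<Longrightarrow> \<bar>?B t\<bar> \<le> K * ?h t" by blast
  let ?K = "E * l2norm (test_V D d) + E * (K + \<bar>\<nu>\<bar> * l2norm (test_LV D d))"
  have bound: "\<bar>?f t\<bar> \<le> ?K * ?h t" if "t \<in> {0<..<T}" for t
  proof -
    have L: "L2 (u t)" using that by (intro weakly_continuous_L2[OF u]) auto
    have a1: "\<bar>?A t\<bar> \<le> l2norm (test_V D d) * ?h t"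
      using integrable_inner_L2(2)[OF L L2_continuous[OF continuous_test(1)], of D d] mult_right_mono[OF l2h, of "l2norm (test_V D d)" t]
      by (simp add: mult.commute)
    have a2: "\<bar>?L t\<bar> \<le> l2norm (test_LV D d) * ?h t"
      using integrable_inner_L2(2)[OF L L2_continuous[OF continuous_test(3)], of D d] mult_right_mono[OF l2h, of "l2norm (test_LV D d)" t]
      by (simp add: mult.commute)
    have "\<bar>?f t\<bar> \<le> \<bar>bump' a b 0 0 t\<bar> * \<bar>?A t\<bar> + \<bar>bump a b 0 0 t\<bar> * (\<bar>?B t\<bar> + \<bar>\<nu>\<bar> * \<bar>?L t\<bar>)"
      by (intro order_trans[OF abs_triangle_ineq] add_mono, simp_all add: abs_mult)
         (intro mult_left_mono order_trans[OF abs_triangle_ineq], simp_all add: abs_mult)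
    also have "\<dots> \<le> E * (l2norm (test_V D d) * ?h t) + E * (K * ?h t + \<bar>\<nu>\<bar> * (l2norm (test_LV D d) * ?h t))"
      using E[of t] bump_nonneg[of a b 0 0 t]
      by (intro add_mono mult_mono E a1 a2 K(2)[OF that]) (auto simp: E0 K(1) intro!: add_nonneg_nonneg mult_nonneg_nonneg)
    finally show ?thesis by (simp add: algebra_simps)
  qed
  have int_f: "integrable ?M ?f"
  proof (rule Bochner_Integration.integrable_bound[OF integrable_mult_right[OF int_h, of ?K]])
    show "AE t in ?M. norm (?f t) \<le> norm (?K * ?h t)"
      using bound by (intro AE_I2) (auto simp: space_restrict_space intro: order_trans[OF _ abs_ge_self])
  qed measurable
  have "c1 * (\<integral>t. bump a b 0 0 t \<partial>?M) - E * (c2 + c3) * (\<integral>t. ?h t \<partial>?M) = (\<integral>t. c1 * bump a b 0 0 t - E * (c2 + c3) * ?h t \<partial>?M)"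
    using int_h integral_bump_pos(1)[OF ab] by (subst Bochner_Integration.integral_diff) (auto intro: integrable_mult_right)
  also have "\<dots> \<le> (\<integral>t. ?f t \<partial>?M)"
  proof (rule integral_mono_AE)
    show "AE t in ?M. c1 * bump a b 0 0 t - E * (c2 + c3) * ?h t \<le> ?f t"
      using L2_H1_integrable(3)[OF u h]
    proof eventually_elim
      case (elim t)
      show ?case
      proof (cases "t \<in> {a..b}")
        case True
        have 1: "bump a b 0 0 t * (c1 - c2 * ?h t) \<le> bump a b 0 0 t * (?B t + \<nu> * ?L t)"
          by (intro mult_left_mono low True elim bump_nonneg)
        have 2: "bump a b 0 0 t * (c2 * ?h t) \<le> E * (c2 * ?h t)"
          by (intro mult_right_mono E mult_nonneg_nonneg c) auto
        have "\<bar>bump' a b 0 0 t * ?A t\<bar> \<le> E * (c3 * (1 + (l2norm (u t))\<^sup>2))"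
          unfolding abs_mult by (intro mult_mono E A True E0) auto
        also have "\<dots> \<le> E * (c3 * ?h t)" by (intro mult_left_mono E0 c) auto
        finally have 3: "\<bar>bump' a b 0 0 t * ?A t\<bar> \<le> E * (c3 * ?h t)" .
        have "bump a b 0 0 t * (c1 - c2 * ?h t) = c1 * bump a b 0 0 t - bump a b 0 0 t * (c2 * ?h t)"
          "E * (c2 + c3) * ?h t = E * (c2 * ?h t) + E * (c3 * ?h t)" by (simp_all add: algebra_simps)
        with 1 2 3 show ?thesis by linarith
      next
        case False
        have "0 \<le> E * (c2 + c3) * ?h t" by (intro mult_nonneg_nonneg E0 add_nonneg_nonneg c) auto
        then show ?thesis using False by (simp add: bump_outside bump'_outside)
      qed
    qed
    show "integrable ?M (\<lambda>t. c1 * bump a b 0 0 t - E * (c2 + c3) * ?h t)"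
      by (intro Bochner_Integration.integrable_diff integrable_mult_right int_h integral_bump_pos(1)[OF ab])
  qed (rule int_f)
  also have "\<dots> = 0" by (rule ns_time_identity[OF u ns div ab(1,3)])
  finally show ?thesis by simp
qed

section \<open>The blocks of the initial datum\<close>

lemma card_cube: "card (cube N) = (2 * N + 1) ^ 3"
proof -
  have "bij_betw vec_lambda (UNIV \<rightarrow>\<^sub>E {- int N..int N}) (cube N)"
  proof (rule bij_betw_byWitness[where f'=vec_nth])
    show "vec_lambda ` (UNIV \<rightarrow>\<^sub>E {- int N..int N}) \<subseteq> cube N"
      by (auto simp: cube_def abs_le_iff PiE_iff) (metis minus_le_iff)
    show "vec_nth ` cube N \<subseteq> UNIV \<rightarrow>\<^sub>E {- int N..int N}"
      by (auto simp: cube_def abs_le_iff) (metis minus_le_iff)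
  qed auto
  then have "card (cube N) = card ((UNIV :: 3 set) \<rightarrow>\<^sub>E {- int N..int N})"
    by (simp add: bij_betw_same_card)
  also have "\<dots> = card {- int N..int N} ^ 3" by (subst card_funcsetE) auto
  also have "card {- int N..int N} = 2 * N + 1" by simp
  finally show ?thesis .
qed

lemma tpoly_sup:
  assumes "finite F" "F \<subseteq> cube N" "\<And>k. k \<in> F \<Longrightarrow> norm (a k) \<le> B" "0 \<le> B"
  shows "norm (tpoly F a x) \<le> (2 * real N + 1) ^ 3 * B"
    and "(l2norm (tpoly F a))\<^sup>2 \<le> (2 * pi) ^ 3 * ((2 * real N + 1) ^ 3 * B\<^sup>2)"
proof -
  have c: "real (card F) \<le> (2 * real N + 1) ^ 3"
  proof -
    have "card F \<le> card (cube N)" using assms by (intro card_mono) auto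
    then have "real (card F) \<le> real ((2 * N + 1) ^ 3)" unfolding card_cube by linarith
    then show ?thesis by (simp add: add.commute)
  qed
  have "norm (tpoly F a x) \<le> (\<Sum>k\<in>F. norm (a k * fexp k x))" unfolding tpoly_def by (rule norm_sum)
  also have "\<dots> \<le> (\<Sum>k\<in>F. B)" by (intro sum_mono) (auto simp: norm_mult assms)
  also have "\<dots> = real (card F) * B" by simp
  also have "\<dots> \<le> (2 * real N + 1) ^ 3 * B" by (intro mult_right_mono c assms)
  finally show "norm (tpoly F a x) \<le> (2 * real N + 1) ^ 3 * B" .
  have "(\<Sum>k\<in>F. (norm (a k))\<^sup>2) \<le> (\<Sum>k\<in>F. B\<^sup>2)" by (intro sum_mono power_mono assms) auto
  also have "\<dots> = real (card F) * B\<^sup>2" by simp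
  also have "\<dots> \<le> (2 * real N + 1) ^ 3 * B\<^sup>2" by (intro mult_right_mono c) auto
  finally show "(l2norm (tpoly F a))\<^sup>2 \<le> (2 * pi) ^ 3 * ((2 * real N + 1) ^ 3 * B\<^sup>2)"
    unfolding l2norm_tpoly[OF assms(1)] by (intro mult_left_mono) auto
qed

lemma trig_poly_nth:
  assumes "finite F" "\<And>k. a k \<noteq> 0 \<Longrightarrow> k \<in> F"
  shows "trig_poly a x $ i = tpoly F (\<lambda>k. a k $ i) x"
proof -
  have "trig_poly a x = (\<Sum>k\<in>F. exp (\<i> * complex_of_real (rvec k \<bullet> x)) *s a k)"
    unfolding trig_poly_def using assms by (intro sum.mono_neutral_left) auto
  then show ?thesis by (simp add: tpoly_def fexp_def mult.commute)
qed

lemma lam_nat: "0 \<le> n \<Longrightarrow> lam n = 2 ^ nat n"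
  by (simp add: lam_def power_int_def)

lemma lam_pos: "0 < lam n"
  by (simp add: lam_def)

lemma lam_add: "lam (m + n) = lam m * lam n"
  by (simp add: lam_def power_int_add)

lemma lam_ge_2: "0 < n \<Longrightarrow> 2 \<le> lam n"
  using power_increasing[of 1 "nat n" "2::real"] by (simp add: lam_nat)

lemma lam_minus_1: "lam (n - 1) = lam n / 2"
  by (simp add: lam_def power_int_diff)

definition U_hat :: "real \<Rightarrow> int \<Rightarrow> 3 \<Rightarrow> int^3 \<Rightarrow> complex" where
  "U_hat c n i k = (U_high_hat c n k + U_low_hat c n k) $ i"

lemma leray_e: "e1 k $ i = complex_of_real (leray_symbol (rvec k) $ i $ 1)" "e2 k $ i = complex_of_real (leray_symbol (rvec k) $ i $ 2)"
  by (simp_all add: e1_def e2_def cvec_def matrix_vector_mult_basis column_def)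

lemma leray_nth: "leray_symbol \<xi> $ i $ j = (if i = j then 1 else 0) - \<xi> $ i * \<xi> $ j / (norm \<xi>)\<^sup>2"
  by (simp add: leray_symbol_def mat_def)

lemma leray_bound: "\<bar>leray_symbol \<xi> $ i $ j\<bar> \<le> 2"
proof -
  have "\<bar>\<xi> $ i * \<xi> $ j\<bar> \<le> (norm \<xi>)\<^sup>2"
    unfolding abs_mult power2_eq_square by (intro mult_mono component_le_norm_cart) auto
  then have "\<bar>\<xi> $ i * \<xi> $ j / (norm \<xi>)\<^sup>2\<bar> \<le> 1"
    by (cases "\<xi> = 0") (auto simp: abs_mult divide_le_eq)
  moreover have "\<bar>(if i = j then 1 else 0) - y\<bar> \<le> 2" if "\<bar>y\<bar> \<le> 1" for y :: real
    using that by auto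
  ultimately show ?thesis unfolding leray_nth by blast
qed

lemma leray_even: "leray_symbol (- \<xi>) = leray_symbol \<xi>"
  by (simp add: leray_symbol_def)

lemma e_even: "e1 (- k) = e1 k" "e2 (- k) = e2 k"
  by (simp_all add: e1_def e2_def rvec_minus leray_even)

lemma mem_uminus_image: "k \<in> uminus ` S \<longleftrightarrow> - k \<in> (S :: (int^3) set)"
  by (metis (no_types, lifting) add.inverse_inverse image_iff)

lemma U_hat_eq:
  "U_hat c n i k = (1 / (lam n)\<^sup>2) *\<^sub>R
     ((of_bool (k \<in> block_A c n \<or> - k \<in> block_A c n)) * e2 k $ i
      + \<i> * of_bool (k \<in> block_C c n) * (e2 k $ i - e1 k $ i)
      - \<i> * of_bool (- k \<in> block_C c n) * (e2 k $ i - e1 k $ i)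
      + of_bool (k \<in> block_B c n \<or> - k \<in> block_B c n) * e1 k $ i)"
  by (simp add: U_hat_def U_high_hat_def U_low_hat_def indicator_def of_bool_def mem_uminus_image scaleR_add_right right_diff_distrib)

lemma U_hat_cnj: "cnj (U_hat c n i k) = U_hat c n i (- k)"
  unfolding U_hat_eq e_even leray_e by (auto simp: of_bool_def)

lemma U_hat_bound: "norm (U_hat c n i k) \<le> 12 / (lam n)\<^sup>2"
proof -
  have 1: "norm (e1 k $ i) \<le> 2" "norm (e2 k $ i) \<le> 2" unfolding leray_e using leray_bound by simp_all
  have 2: "norm (e2 k $ i - e1 k $ i) \<le> 4" using norm_triangle_ineq4[of "e2 k $ i" "e1 k $ i"] 1 by linarith
  have ob: "norm (of_bool P * z) \<le> norm z" for P and z :: complex by (cases P) auto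
  let ?z = "(of_bool (k \<in> block_A c n \<or> - k \<in> block_A c n)) * e2 k $ i
      + \<i> * of_bool (k \<in> block_C c n) * (e2 k $ i - e1 k $ i)
      - \<i> * of_bool (- k \<in> block_C c n) * (e2 k $ i - e1 k $ i)
      + of_bool (k \<in> block_B c n \<or> - k \<in> block_B c n) * e1 k $ i"
  have a: "norm ((of_bool (k \<in> block_A c n \<or> - k \<in> block_A c n)) * e2 k $ i) \<le> 2"
    using ob 1 order_trans by blast
  have b: "norm (\<i> * of_bool P * (e2 k $ i - e1 k $ i)) \<le> 4" for P using 2 by (cases P) (auto simp: norm_mult)
  have c: "norm (of_bool (k \<in> block_B c n \<or> - k \<in> block_B c n) * e1 k $ i) \<le> 2"
    using ob 1 order_trans by blast
  have "norm ?z \<le> 2 + 4 + 4 + 2"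
    by (intro norm_triangle_le norm_triangle_le_diff add_mono a b c)
  then have "norm ?z / (lam n)\<^sup>2 \<le> 12 / (lam n)\<^sup>2" by (intro divide_right_mono) auto
  then show ?thesis unfolding U_hat_eq by simp
qed

lemma U_hat_nz:
  assumes "U_hat c n i k \<noteq> 0"
  shows "\<exists>l\<in>{k, - k}. l \<in> block_A c n \<or> l \<in> block_B c n \<or> l \<in> block_C c n"
  using assms unfolding U_hat_eq by (auto split: if_splits simp: of_bool_def)

lemma block_A_iff: "k \<in> block_A c n \<longleftrightarrow> \<bar>real_of_int (k $ 1) - lam n\<bar> \<le> c * lam n \<and> \<bar>real_of_int (k $ 2)\<bar> \<le> c * lam n \<and> \<bar>real_of_int (k $ 3)\<bar> \<le> c * lam n"
  unfolding block_A_def abs_le_iff by (auto simp: algebra_simps)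

lemma block_B_iff: "k \<in> block_B c n \<longleftrightarrow> \<bar>real_of_int (k $ 1)\<bar> \<le> c * lam n / 2 \<and> \<bar>real_of_int (k $ 2)\<bar> \<le> c * lam n / 2 \<and> \<bar>real_of_int (k $ 3) - lam n / 2\<bar> \<le> c * lam n / 2"
  unfolding block_B_def lam_minus_1 abs_le_iff by (auto simp: field_simps)

lemma block_C_bounds:
  assumes "k \<in> block_C c n"
  shows "\<bar>real_of_int (k $ 1) - lam n\<bar> \<le> 3 * (c * lam n) / 2" "\<bar>real_of_int (k $ 2)\<bar> \<le> 3 * (c * lam n) / 2" "\<bar>real_of_int (k $ 3) - lam n / 2\<bar> \<le> 3 * (c * lam n) / 2"
proof -
  obtain a b where k: "k = a + b" "a \<in> block_A c n" "b \<in> block_B c n" using assms by (auto simp: block_C_def)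
  show "\<bar>real_of_int (k $ 1) - lam n\<bar> \<le> 3 * (c * lam n) / 2" "\<bar>real_of_int (k $ 2)\<bar> \<le> 3 * (c * lam n) / 2" "\<bar>real_of_int (k $ 3) - lam n / 2\<bar> \<le> 3 * (c * lam n) / 2"
    using k(2,3) unfolding k(1) block_A_iff block_B_iff plus_vec_def vec_lambda_beta of_int_add by linarith+
qed

lemma c_lam_bound: "0 < c \<Longrightarrow> c < 1 / 100 \<Longrightarrow> 0 < c * lam n \<and> c * lam n \<le> lam n / 100"
  using lam_pos[of n] mult_right_mono[of c "1/100" "lam n"] by auto

lemma block_nth_le:
  assumes c: "0 < c" "c < 1 / 100" and l: "l \<in> block_A c n \<or> l \<in> block_B c n \<or> l \<in> block_C c n"
  shows "\<bar>real_of_int (l $ j)\<bar> \<le> 2 * lam n"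
    and "lam n / 4 \<le> \<bar>real_of_int (l $ 1)\<bar> \<or> lam n / 4 \<le> \<bar>real_of_int (l $ 3)\<bar>"
proof -
  note cl = c_lam_bound[OF c, of n]
  have *: "(\<forall>j. \<bar>real_of_int (l $ j)\<bar> \<le> 2 * lam n) \<and> (lam n / 4 \<le> \<bar>real_of_int (l $ 1)\<bar> \<or> lam n / 4 \<le> \<bar>real_of_int (l $ 3)\<bar>)"
    using l
  proof (elim disjE)
    assume "l \<in> block_A c n"
    then show ?thesis unfolding block_A_iff forall_3 using cl by (safe; linarith)
  next
    assume "l \<in> block_B c n"
    then show ?thesis unfolding block_B_iff forall_3 using cl by (safe; linarith)
  next
    assume "l \<in> block_C c n"
    from block_C_bounds[OF this] show ?thesis unfolding forall_3 using cl by (safe; linarith)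
  qed
  then show "\<bar>real_of_int (l $ j)\<bar> \<le> 2 * lam n"
    "lam n / 4 \<le> \<bar>real_of_int (l $ 1)\<bar> \<or> lam n / 4 \<le> \<bar>real_of_int (l $ 3)\<bar>" by blast+
qed

lemma U_hat_support:
  assumes c: "0 < c" "c < 1 / 100" and nz: "U_hat c n i k \<noteq> 0"
  shows "\<bar>real_of_int (k $ j)\<bar> \<le> 2 * lam n" and "lam n / 4 \<le> norm (rvec k)"
proof -
  obtain l where l: "l = k \<or> l = - k" "l \<in> block_A c n \<or> l \<in> block_B c n \<or> l \<in> block_C c n"
    using U_hat_nz[OF nz] by blast
  note b = block_nth_le[OF c l(2)]
  show "\<bar>real_of_int (k $ j)\<bar> \<le> 2 * lam n" using b(1)[of j] l(1) by auto
  have "norm (rvec l) = norm (rvec k)" using l(1) by (auto simp: rvec_minus)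
  then show "lam n / 4 \<le> norm (rvec k)"
    using b(2) component_le_norm_cart[of "rvec l" 1] component_le_norm_cart[of "rvec l" 3] by auto
qed

text \<open>A common frequency box, of half-side \<open>2 * lam n\<close> for positive
  \<open>n\<close>, for the blocks at scale \<open>n\<close> and for the test field.\<close>

definition ucube :: "int \<Rightarrow> (int^3) set" where
  "ucube n = cube (2 * 2 ^ nat n)"

lemma finite_ucube [simp]: "finite (ucube n)"
  by (simp add: ucube_def)

lemma mem_ucube_iff:
  assumes "0 < n"
  shows "k \<in> ucube n \<longleftrightarrow> (\<forall>j. \<bar>real_of_int (k $ j)\<bar> \<le> 2 * lam n)"
proof -
  have "\<bar>k $ j\<bar> \<le> int (2 * 2 ^ nat n) \<longleftrightarrow> \<bar>real_of_int (k $ j)\<bar> \<le> 2 * lam n" for j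
  proof -
    have "2 * lam n = real_of_int (int (2 * 2 ^ nat n))" using assms by (simp add: lam_nat)
    then show ?thesis by (metis of_int_abs of_int_le_iff)
  qed
  then show ?thesis by (simp add: ucube_def cube_def)
qed

lemmas ucubeI = mem_ucube_iff[THEN iffD2, rule_format]
  and ucube_nth = mem_ucube_iff[THEN iffD1, rule_format]

text \<open>The box has at most \<open>(4 * lam n + 1) ^ 3\<close> points, which is below
  \<open>125 * lam n ^ 3\<close>. In the L2 bound 2 pi is replaced by 6.4, and 182 rounds up the
  square root of 32768 = 6.4^3 * 125.\<close>

lemma ucube_tpoly_bounds:
  assumes n: "0 < n" and F: "F \<subseteq> ucube n" and a: "\<And>k. k \<in> F \<Longrightarrow> norm (a k) \<le> B" and B: "0 \<le> B"
  shows "norm (tpoly F a x) \<le> 125 * lam n ^ 3 * B" and "l2norm (tpoly F a) \<le> 182 * (lam n * sqrt (lam n)) * B"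
proof -
  have l: "2 \<le> lam n" by (rule lam_ge_2[OF n])
  have N: "real (2 * 2 ^ nat n) = 2 * lam n" using n by (simp add: lam_nat)
  have cube_le: "(2 * real (2 * 2 ^ nat n) + 1) ^ 3 \<le> 125 * lam n ^ 3"
  proof -
    have "(2 * real (2 * 2 ^ nat n) + 1) ^ 3 \<le> (5 * lam n) ^ 3" unfolding N using l by (intro power_mono) auto
    then show ?thesis by (simp add: power_mult_distrib)
  qed
  have fin: "finite F" using F finite_ucube by (rule finite_subset)
  note ts = tpoly_sup[OF fin F[unfolded ucube_def] a B]
  have "norm (tpoly F a x) \<le> (2 * real (2 * 2 ^ nat n) + 1) ^ 3 * B" by (rule ts)
  also have "\<dots> \<le> 125 * lam n ^ 3 * B" by (intro mult_right_mono cube_le B)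
  finally show "norm (tpoly F a x) \<le> 125 * lam n ^ 3 * B" .
  have "(l2norm (tpoly F a))\<^sup>2 \<le> (2 * pi) ^ 3 * ((2 * real (2 * 2 ^ nat n) + 1) ^ 3 * B\<^sup>2)" by (rule ts)
  also have "\<dots> \<le> (2 * 3.2) ^ 3 * (125 * lam n ^ 3 * B\<^sup>2)"
    using pi_approx by (intro mult_mono mult_right_mono cube_le power_mono) auto
  also have "\<dots> = 32768 * (lam n ^ 3 * B\<^sup>2)" by (simp add: field_simps)
  also have "\<dots> \<le> 182\<^sup>2 * (lam n ^ 3 * B\<^sup>2)" using l by (intro mult_right_mono) auto
  also have "\<dots> = (182 * (lam n * sqrt (lam n)) * B)\<^sup>2"
    using l by (simp add: power_mult_distrib power2_eq_square power3_eq_cube)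
  finally show "l2norm (tpoly F a) \<le> 182 * (lam n * sqrt (lam n)) * B"
    by (rule power2_le_imp_le) (use l B in simp)
qed

lemma U_hat_cube:
  assumes "0 < c" "c < 1 / 100" "0 < n" "U_hat c n i k \<noteq> 0"
  shows "k \<in> ucube n"
  using U_hat_support(1)[OF assms(1,2,4)] by (intro ucubeI assms(3))

definition U_block :: "real \<Rightarrow> int \<Rightarrow> 3 \<Rightarrow> real^3 \<Rightarrow> complex" where
  "U_block c n i = tpoly (ucube n) (U_hat c n i)"

lemma cnj_tpoly: "cnj (tpoly F a x) = tpoly F (\<lambda>k. cnj (a (- k))) x" if "uminus ` F = F"
proof -
  have "cnj (tpoly F a x) = (\<Sum>k\<in>F. cnj (a k) * fexp (- k) x)" by (simp add: tpoly_def cnj_fexp)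
  also have "\<dots> = (\<Sum>k\<in>uminus ` F. cnj (a (- k)) * fexp k x)"
    by (subst sum.reindex) (auto simp: inj_on_def)
  finally show ?thesis using that by (simp add: tpoly_def)
qed

lemma uminus_cube: "uminus ` cube N = cube N"
  by (auto simp: mem_uminus_image cube_def)

lemma U_block_real: "complex_of_real (Re (U_block c n i x)) = U_block c n i x"
proof -
  have "cnj (U_block c n i x) = U_block c n i x"
    unfolding U_block_def by (subst cnj_tpoly) (auto simp: ucube_def uminus_cube U_hat_cnj)
  then show ?thesis by (metis Reals_cnj_iff of_real_Re)
qed

lemma U_high_low_nz:
  assumes "0 < c" "c < 1 / 100" "0 < n"
  shows "U_high_hat c n k \<noteq> 0 \<Longrightarrow> k \<in> ucube n" "U_low_hat c n k \<noteq> 0 \<Longrightarrow> k \<in> ucube n"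
proof -
  have *: "l \<in> ucube n" if "l \<in> block_A c n \<or> l \<in> block_B c n \<or> l \<in> block_C c n" for l
    using block_nth_le(1)[OF assms(1,2) that] by (intro ucubeI assms(3))
  have m: "l \<in> ucube n \<longleftrightarrow> - l \<in> ucube n" for l by (auto simp: cube_def ucube_def)
  have nots: "k \<notin> block_A c n \<and> - k \<notin> block_A c n \<and> k \<notin> block_B c n \<and> - k \<notin> block_B c n
      \<and> k \<notin> block_C c n \<and> - k \<notin> block_C c n" if "k \<notin> ucube n"
    using *[of k] *[of "- k"] m[of k] that by blast
  show "U_high_hat c n k \<noteq> 0 \<Longrightarrow> k \<in> ucube n" "U_low_hat c n k \<noteq> 0 \<Longrightarrow> k \<in> ucube n"
    using nots unfolding U_high_hat_def U_low_hat_def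
    by (cases "k \<in> ucube n"; simp add: indicator_def mem_uminus_image)+
qed

lemma U_block_eq:
  assumes "0 < c" "c < 1 / 100" "0 < n"
  shows "(trig_poly (U_high_hat c n) x + trig_poly (U_low_hat c n) x) $ i = U_block c n i x"
  unfolding vector_add_component U_block_def
  by (subst (1 2) trig_poly_nth[of "ucube n"])
     (auto simp: U_high_low_nz[OF assms] tpoly_def U_hat_def sum.distrib distrib_right)

text \<open>Both constants come from the coefficient bound 12 of \<open>U_hat_bound\<close>: 1500 =
  125 * 12, and 2200 rounds up 182 * 12. In L2 the amplitude \<open>1 / (lam n)\<^sup>2\<close>
  meets the square root of the number of frequencies, which yields the exponent -1/2.\<close>

lemma U_block_bounds:
  assumes n: "0 < n"
  shows "norm (U_block c n i x) \<le> 1500 * lam n" and "l2norm (U_block c n i) \<le> 2200 * lam n powr (- 1 / 2)"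
    and "L2 (U_block c n i)"
proof -
  have l: "0 < lam n" by (rule lam_pos)
  have "0 \<le> 12 / (lam n)\<^sup>2" by simp
  note ub = ucube_tpoly_bounds[where F="ucube n" and a="U_hat c n i", OF n order_refl U_hat_bound this]
  show "norm (U_block c n i x) \<le> 1500 * lam n"
    using ub(1)[of x] l unfolding U_block_def by (simp add: power2_eq_square power3_eq_cube)
  define s where "s = sqrt (lam n)"
  have s: "0 < s" "lam n = s\<^sup>2" using l by (simp_all add: s_def)
  have "l2norm (U_block c n i) \<le> 182 * (lam n * sqrt (lam n)) * (12 / (lam n)\<^sup>2)"
    using ub(2) unfolding U_block_def by simp
  also have "\<dots> = 2184 / s" unfolding s_def[symmetric] s(2) using s(1) by (simp add: power2_eq_square)
  also have "\<dots> \<le> 2200 / s" using s(1) by (intro divide_right_mono) auto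
  also have "\<dots> = 2200 * lam n powr (- 1 / 2)"
    using l by (simp add: s_def powr_half_sqrt powr_minus_divide)
  finally show "l2norm (U_block c n i) \<le> 2200 * lam n powr (- 1 / 2)" .
  show "L2 (U_block c n i)" unfolding U_block_def by (rule L2_tpoly)
qed

section \<open>Littlewood-Paley truncations\<close>

lemma fourier_coeff_nth:
  fixes v :: "real^3 \<Rightarrow> real^3"
  assumes v: "\<And>i. integrable torus (\<lambda>x. complex_of_real (v x $ i))"
  shows "fourier_coeff v k $ i = fc (\<lambda>x. complex_of_real (v x $ i)) k"
proof -
  let ?g = "\<lambda>i x. fexp (- k) x * complex_of_real (v x $ i)"
  have g: "integrable torus (?g i)" for i by (rule integrable_fexp_mult[OF v])
  have eq: "exp (- \<i> * complex_of_real (rvec k \<bullet> x)) *s cvec (v x) = (\<Sum>i\<in>UNIV. axis i (?g i x))" for x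
    by (auto simp: vec_eq_iff cvec_def fexp_def rvec_minus axis_def if_distrib cong: if_cong)
  have bl: "bounded_linear (axis i :: complex \<Rightarrow> complex^3)" for i
    by (auto simp: linear_iff vec_eq_iff axis_def intro!: linear_conv_bounded_linear[THEN iffD1])
  have int: "integrable torus (\<lambda>x. exp (- \<i> * complex_of_real (rvec k \<bullet> x)) *s cvec (v x))"
    unfolding eq by (intro Bochner_Integration.integrable_sum integrable_bounded_linear[OF bl] g)
  have "(\<integral>x. exp (- \<i> * complex_of_real (rvec k \<bullet> x)) *s cvec (v x) \<partial>torus) $ i =
    (\<integral>x. (exp (- \<i> * complex_of_real (rvec k \<bullet> x)) *s cvec (v x)) $ i \<partial>torus)"
    by (rule integral_bounded_linear[OF bounded_linear_vec_nth int, symmetric])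
  also have "\<dots> = (\<integral>x. ?g i x \<partial>torus)"
    by (simp add: cvec_def fexp_def rvec_minus)
  finally show ?thesis unfolding fourier_coeff_def fc_def vector_scaleR_component
    by (simp add: scaleR_conv_of_real[where 'a=complex])
qed

text \<open>By \<open>lp_symbol_telescope\<close>, the symbol of the sum of the blocks with index -1
  to \<open>m - 1\<close>: it is 1 up to frequency \<open>2 ^ m / 2\<close> and 0 from
  \<open>2 ^ m\<close> on.\<close>

definition low_symbol :: "(real^3 \<Rightarrow> real) \<Rightarrow> nat \<Rightarrow> int^3 \<Rightarrow> real" where
  "low_symbol chi m k = chi ((1 / 2 ^ m) *\<^sub>R rvec k)"

lemma lp_symbol_telescope:
  "(\<Sum>i\<le>m. lp_symbol chi (int i - 1) (rvec k)) = low_symbol chi m k"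
proof (induction m)
  case 0
  show ?case by (simp add: lp_symbol_def low_symbol_def)
next
  case (Suc m)
  have "lp_symbol chi (int (Suc m) - 1) (rvec k) = low_symbol chi (Suc m) k - low_symbol chi m k"
  proof -
    have 1: "lp_symbol chi (int (Suc m) - 1) (rvec k) = lp_phi chi ((1 / 2 ^ m) *\<^sub>R rvec k)"
      by (simp add: lp_symbol_def lam_nat inverse_eq_divide)
    have 2: "(1 / 2) * (1 / 2 ^ m) = (1 / 2 ^ Suc m :: real)" by simp
    show ?thesis unfolding 1 lp_phi_def low_symbol_def scaleR_scaleR 2 ..
  qed
  then show ?case using Suc by simp
qed

lemma low_symbol_low:
  assumes "lp_cutoff chi" "norm (rvec k) \<le> 2 ^ m / 2"
  shows "low_symbol chi m k = 1"
proof -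
  have "norm ((1 / 2 ^ m) *\<^sub>R rvec k) \<le> 1 / 2" using assms(2) by (simp add: field_simps)
  then show ?thesis using assms(1) unfolding lp_cutoff_def low_symbol_def by blast
qed

lemma low_symbol_high:
  assumes "lp_cutoff chi" "2 ^ m \<le> norm (rvec k)"
  shows "low_symbol chi m k = 0"
proof -
  have "norm ((1 / 2 ^ m) *\<^sub>R rvec k) \<ge> 1" using assms(2) by (simp add: field_simps)
  then show ?thesis using assms(1) unfolding lp_cutoff_def low_symbol_def by blast
qed

lemma low_symbol_cube:
  assumes "lp_cutoff chi" "low_symbol chi m k \<noteq> 0"
  shows "k \<in> cube (2 ^ m)"
  unfolding cube_def
proof safe
  fix i
  have "norm (rvec k) < 2 ^ m" using low_symbol_high[OF assms(1)] assms(2) by (meson not_less)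
  then have "\<bar>real_of_int (k $ i)\<bar> < 2 ^ m" using component_le_norm_cart[of "rvec k" i] by simp
  then have "real_of_int \<bar>k $ i\<bar> < real_of_int (int (2 ^ m))" by simp
  then show "\<bar>k $ i\<bar> \<le> int (2 ^ m)" by linarith
qed

lemma low_symbol_bounded:
  assumes "lp_cutoff chi"
  obtains K where "1 \<le> K" "\<And>m k. \<bar>low_symbol chi m k\<bar> \<le> K"
proof -
  have cont: "continuous_on UNIV chi"
  proof -
    have "iter_deriv [] chi differentiable (at x)" for x
      using assms unfolding lp_cutoff_def smooth_def by blast
    then show ?thesis
      by (intro continuous_at_imp_continuous_on ballI differentiable_imp_continuous_within) auto
  qed
  have "bounded (chi ` cball 0 1)"
    by (intro compact_imp_bounded compact_continuous_image continuous_on_subset[OF cont]) auto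
  then obtain B where "\<forall>y\<in>chi ` cball 0 1. norm y \<le> B" unfolding bounded_iff by blast
  then have B: "\<And>x. norm x \<le> 1 \<Longrightarrow> \<bar>chi x\<bar> \<le> B" by simp
  have "\<bar>chi x\<bar> \<le> 1 + \<bar>B\<bar>" for x
  proof (cases "norm x \<le> 1")
    case True
    then show ?thesis using B[of x] by linarith
  next
    case False
    then have "1 \<le> norm x" by simp
    then have "chi x = 0" using assms unfolding lp_cutoff_def by blast
    then show ?thesis by simp
  qed
  then show ?thesis using that[of "1 + \<bar>B\<bar>"] unfolding low_symbol_def by auto
qed

definition low_part :: "(real^3 \<Rightarrow> real) \<Rightarrow> nat \<Rightarrow> (real^3 \<Rightarrow> complex) \<Rightarrow> real^3 \<Rightarrow> complex" where
  "low_part chi m f = tpoly (cube (2 ^ m)) (\<lambda>k. complex_of_real (low_symbol chi m k) * fc f k)"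

lemma lp_block_nth:
  assumes chi: "lp_cutoff chi" and v: "\<And>i. integrable torus (\<lambda>x. complex_of_real (v x $ i))" and p: "p \<le> m"
  shows "lp_block chi (int p - 1) v x $ i =
    tpoly (cube (2 ^ m)) (\<lambda>k. complex_of_real (lp_symbol chi (int p - 1) (rvec k)) * fc (\<lambda>x. complex_of_real (v x $ i)) k) x"
proof -
  have nz: "k \<in> cube (2 ^ m)" if "lp_symbol chi (int p - 1) (rvec k) \<noteq> 0" for k
  proof -
    \<comment> \<open>The symbol of a block is the difference of two consecutive low symbols, so one
      of them is nonzero. For \<open>p = 0\<close> the truncated \<open>p - 1\<close> is again
      0.\<close>
    have "low_symbol chi p k \<noteq> 0 \<or> low_symbol chi (p - 1) k \<noteq> 0"
    proof (cases p)
      case 0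
      then show ?thesis using that lp_symbol_telescope[of chi k 0] by simp
    next
      case (Suc r)
      have "low_symbol chi (Suc r) k = low_symbol chi r k + lp_symbol chi (int (Suc r) - 1) (rvec k)"
        using lp_symbol_telescope[of chi k "Suc r"] lp_symbol_telescope[of chi k r] by simp
      then show ?thesis using that Suc by auto
    qed
    then have "k \<in> cube (2 ^ p) \<or> k \<in> cube (2 ^ (p - 1))" using low_symbol_cube[OF chi] by blast
    moreover have "cube (2 ^ p) \<subseteq> cube (2 ^ m)" "cube (2 ^ (p - 1)) \<subseteq> cube (2 ^ m)"
      using p by (intro cube_mono power_increasing; simp)+
    ultimately show ?thesis by blast
  qed
  show ?thesis unfolding lp_block_def
    by (subst trig_poly_nth[of "cube (2 ^ m)"]) (auto simp: nz fourier_coeff_nth[OF v] tpoly_def scaleR_conv_of_real[where 'a=complex])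
qed

text \<open>With the weight \<open>inverse (lam q)\<close>, the pointwise bounds on the blocks grow
  geometrically in \<open>q\<close>; a whole truncation thus costs no more than its top
  frequency.\<close>

lemma besov_low_part:
  assumes chi: "lp_cutoff chi" and v: "\<And>i. integrable torus (\<lambda>x. complex_of_real (v x $ i))"
    and b: "besov_norm chi v \<le> ennreal \<delta>" and \<delta>: "0 \<le> \<delta>"
  shows "AE x in torus. \<forall>i. norm (low_part chi m (\<lambda>x. complex_of_real (v x $ i)) x) \<le> 2 ^ m * \<delta>"
proof -
  have bl: "AE x in torus. norm (lp_block chi (int p - 1) v x) \<le> lam (int p - 1) * \<delta>" for p
  proof -
    have "ennreal (inverse (lam (int p - 1))) * Linf_norm (lp_block chi (int p - 1) v) \<le> ennreal \<delta>"
    proof (rule order_trans[OF _ b])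
      show "ennreal (inverse (lam (int p - 1))) * Linf_norm (lp_block chi (int p - 1) v) \<le> besov_norm chi v"
        unfolding besov_norm_def by (rule SUP_upper) simp
    qed
    then have "ennreal (lam (int p - 1)) * (ennreal (inverse (lam (int p - 1))) * Linf_norm (lp_block chi (int p - 1) v)) \<le> ennreal (lam (int p - 1)) * ennreal \<delta>"
      by (rule mult_left_mono) simp
    moreover have "ennreal (lam (int p - 1)) * (ennreal (inverse (lam (int p - 1))) * Linf_norm (lp_block chi (int p - 1) v)) = Linf_norm (lp_block chi (int p - 1) v)"
      using lam_pos[of "int p - 1"] by (simp add: mult.assoc[symmetric] ennreal_mult[symmetric])
    ultimately have "Linf_norm (lp_block chi (int p - 1) v) \<le> ennreal (lam (int p - 1) * \<delta>)"
      using lam_pos[of "int p - 1"] \<delta> by (simp add: ennreal_mult)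
    moreover have "AE x in torus. ennreal (norm (lp_block chi (int p - 1) v x)) \<le> Linf_norm (lp_block chi (int p - 1) v)"
      unfolding Linf_norm_def by (rule esssup_AE)
    moreover have "0 \<le> lam (int p - 1) * \<delta>" using lam_pos[of "int p - 1"] \<delta> by simp
    ultimately show ?thesis
      by (auto elim!: eventually_mono) (metis ennreal_le_iff order_trans)
  qed
  have "AE x in torus. \<forall>p\<in>{..m}. norm (lp_block chi (int p - 1) v x) \<le> lam (int p - 1) * \<delta>"
    by (rule AE_finite_allI) (auto simp: bl)
  then show ?thesis
  proof eventually_elim
    case (elim x)
    show ?case
    proof
      fix i
      have "low_part chi m (\<lambda>x. complex_of_real (v x $ i)) x = (\<Sum>p\<le>m. lp_block chi (int p - 1) v x $ i)"
      proof -
        have "(\<Sum>p\<le>m. lp_block chi (int p - 1) v x $ i) =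
          (\<Sum>p\<le>m. tpoly (cube (2 ^ m)) (\<lambda>k. complex_of_real (lp_symbol chi (int p - 1) (rvec k)) * fc (\<lambda>x. complex_of_real (v x $ i)) k) x)"
          by (intro sum.cong refl lp_block_nth chi v) auto
        also have "\<dots> = tpoly (cube (2 ^ m)) (\<lambda>k. (\<Sum>p\<le>m. complex_of_real (lp_symbol chi (int p - 1) (rvec k))) * fc (\<lambda>x. complex_of_real (v x $ i)) k) x"
          unfolding tpoly_def by (subst sum.swap) (simp add: sum_distrib_right)
        finally show ?thesis by (simp add: low_part_def lp_symbol_telescope flip: of_real_sum)
      qed
      also have "norm \<dots> \<le> (\<Sum>p\<le>m. lam (int p - 1) * \<delta>)"
        using elim by (intro sum_norm_le) (auto intro: order_trans[OF Finite_Cartesian_Product.norm_nth_le])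
      also have "\<dots> = (\<Sum>p\<le>m. lam (int p - 1)) * \<delta>" by (simp add: sum_distrib_right)
      \<comment> \<open>The block of index -1 contributes 1/2; the others contribute 1 + 2 + ... +
        \<open>2 ^ (m - 1)\<close>.\<close>
      also have "(\<Sum>p\<le>m. lam (int p - 1)) = 2 ^ m - 1 / 2"
        by (induction m) (auto simp: lam_nat lam_def power_int_def)
      also have "(2 ^ m - 1 / 2) * \<delta> \<le> 2 ^ m * \<delta>" using \<delta> by (intro mult_right_mono) auto
      finally show "norm (low_part chi m (\<lambda>x. complex_of_real (v x $ i)) x) \<le> 2 ^ m * \<delta>" .
    qed
  qed
qed

section \<open>Lacunary scales and the Fourier series of the initial datum\<close>

locale lacunary =
  fixes c :: real and q :: "nat \<Rightarrow> int"
  assumes c: "0 < c" "c < 1 / 100" and q0: "\<And>j. 0 < q j" and mono: "strict_mono q"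
    and gap: "\<And>j. (lam (q j))\<^sup>2 < lam (q (Suc j))"
begin

lemma q_ge: "int j + 1 \<le> q j"
proof (induction j)
  case 0
  show ?case using q0[of 0] by linarith
next
  case (Suc j)
  have "q j < q (Suc j)" using strict_monoD[OF mono, of j "Suc j"] by simp
  with Suc show ?case by linarith
qed

lemma lam_mono: "m \<le> n \<Longrightarrow> lam m \<le> lam n"
  unfolding lam_def by (rule power_int_increasing) auto

lemma lam_q_ge: "2 ^ (j + 1) \<le> lam (q j)"
  using lam_mono[OF q_ge[of j]] by (simp add: lam_nat nat_add_distrib)

lemma lam_q_double: "2 * lam (q j) \<le> lam (q (Suc j))"
proof -
  have "q j + 1 \<le> q (Suc j)" using strict_monoD[OF mono, of j "Suc j"] by simp
  from lam_mono[OF this] show ?thesis by (simp add: lam_add) (simp add: lam_def)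
qed

lemma lam_q_mono: "i \<le> j \<Longrightarrow> lam (q i) \<le> lam (q j)"
  using mono by (intro lam_mono) (simp add: strict_mono_less_eq)

lemma sum_lam_q: "(\<Sum>i\<le>m. lam (q i)) \<le> 2 * lam (q m)"
proof (induction m)
  case 0
  show ?case using lam_pos[of "q 0"] by simp
next
  case (Suc m)
  then show ?case using lam_q_double[of m] by simp
qed

lemma summable_blocks: "summable (\<lambda>j. l2norm (U_block c (q j) i))"
proof (rule summable_comparison_test)
  have "l2norm (U_block c (q j) i) \<le> 2200 * (2 powr (- 1 / 2)) ^ (j + 1)" for j
  proof -
    have "l2norm (U_block c (q j) i) \<le> 2200 * lam (q j) powr (- 1 / 2)" by (rule U_block_bounds[OF q0])
    also have "\<dots> \<le> 2200 * (2 ^ (j + 1)) powr (- 1 / 2)"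
      by (intro mult_left_mono powr_mono2') (use lam_q_ge[of j] in auto)
    also have "(2 ^ (j + 1)) powr (- 1 / 2) = (2 powr (- 1 / 2) :: real) ^ (j + 1)"
      by (simp only: powr_realpow[symmetric] zero_less_numeral powr_powr powr_gt_zero) (simp add: mult.commute)
    finally show ?thesis .
  qed
  then show "\<exists>N. \<forall>n\<ge>N. norm (l2norm (U_block c (q n) i)) \<le> 2200 * (2 powr (- 1 / 2)) ^ (n + 1)"
    by simp
  have "(2::real) powr (- 1 / 2) < 2 powr 0" by (rule powr_less_mono) auto
  then show "summable (\<lambda>j. 2200 * (2 powr (- 1 / 2)) ^ (j + 1) :: real)"
    by (intro summable_mult summable_ignore_initial_segment summable_geometric) simp
qed

lemma summable_blocks_L1: "summable (\<lambda>j. \<integral>x. norm (U_block c (q j) i x) \<partial>torus)"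
proof (rule summable_comparison_test[OF _ summable_mult[OF summable_blocks]])
  have "(\<integral>x. norm (U_block c (q j) i x) \<partial>torus) \<le> l2norm (\<lambda>_::real^3. 1::real) * l2norm (U_block c (q j) i)" for j
    using L2_prod_norm(2)[OF L2_const[of "1::real"] U_block_bounds(3)[OF q0]] by simp
  then show "\<exists>N. \<forall>n\<ge>N. norm (\<integral>x. norm (U_block c (q n) i x) \<partial>torus) \<le> l2norm (\<lambda>_::real^3. 1::real) * l2norm (U_block c (q n) i)"
    by simp
qed

text \<open>\<open>U_field\<close> is a pointwise series, so its values are meaningful only where
  the series converges. Monotone convergence gives this almost everywhere from the summable L1
  norms.\<close>

lemma AE_summable: "AE x in torus. summable (\<lambda>j. norm (U_block c (q j) i x))"
proof -
  have [measurable]: "U_block c (q j) i \<in> borel_measurable torus" for j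
    by (rule L2_measurable[OF U_block_bounds(3)[OF q0]])
  have "(\<integral>\<^sup>+x. (\<Sum>j. ennreal (norm (U_block c (q j) i x))) \<partial>torus) = (\<Sum>j. \<integral>\<^sup>+x. ennreal (norm (U_block c (q j) i x)) \<partial>torus)"
    by (rule nn_integral_suminf) measurable
  also have "\<dots> = (\<Sum>j. ennreal (\<integral>x. norm (U_block c (q j) i x) \<partial>torus))"
    by (intro suminf_cong nn_integral_eq_integral integrable_norm L2_integrable U_block_bounds(3)[OF q0]) auto
  also have "\<dots> \<noteq> \<infinity>"
    by (subst suminf_ennreal2[OF _ summable_blocks_L1]) auto
  finally have "AE x in torus. (\<Sum>j. ennreal (norm (U_block c (q j) i x))) \<noteq> \<infinity>"
    by (intro nn_integral_PInf_AE) measurable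
  then show ?thesis
    by eventually_elim (auto intro: summable_suminf_not_top)
qed

lemma U_field_AE: "AE x in torus. \<forall>i. complex_of_real (U_field c q x $ i) = (\<Sum>j. U_block c (q j) i x)"
proof -
  have "AE x in torus. \<forall>i\<in>UNIV. summable (\<lambda>j. norm (U_block c (q j) i x))"
    by (rule AE_finite_allI) (auto simp: AE_summable)
  then show ?thesis
  proof eventually_elim
    case (elim x)
    let ?v = "\<lambda>j. (\<chi> i. Re ((trig_poly (U_high_hat c (q j)) x + trig_poly (U_low_hat c (q j)) x) $ i)) :: real^3"
    have vi: "?v j $ i = Re (U_block c (q j) i x)" for i j
      by (simp only: vec_lambda_beta U_block_eq[OF c q0])
    have "summable ?v"
    proof (rule summable_norm_cancel, rule summable_comparison_test)
      show "summable (\<lambda>j. \<Sum>i\<in>UNIV. norm (U_block c (q j) i x))"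
        using elim by (intro summable_sum) auto
      have "norm (?v j) \<le> (\<Sum>i\<in>UNIV. norm (U_block c (q j) i x))" for j
      proof -
        have "norm (?v j) \<le> (\<Sum>i\<in>UNIV. \<bar>?v j $ i\<bar>)" by (rule norm_le_l1_cart)
        also have "\<dots> \<le> (\<Sum>i\<in>UNIV. norm (U_block c (q j) i x))"
          unfolding vi by (intro sum_mono abs_Re_le_cmod)
        finally show ?thesis .
      qed
      then show "\<exists>N. \<forall>n\<ge>N. norm (norm (?v n)) \<le> (\<Sum>i\<in>UNIV. norm (U_block c (q n) i x))" by simp
    qed
    then have "U_field c q x $ i = (\<Sum>j. Re (U_block c (q j) i x))" for i
      unfolding U_field_def vi[symmetric] by (rule bounded_linear.suminf[OF bounded_linear_vec_nth])
    then show ?case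
      using elim by (simp add: suminf_of_real summable_Re[OF summable_norm_cancel] U_block_real)
  qed
qed

lemma U_field_measurable: "U_field c q \<in> borel_measurable torus"
proof -
  have m: "(\<lambda>x. (\<chi> i. Re ((trig_poly (U_high_hat c (q j)) x + trig_poly (U_low_hat c (q j)) x) $ i)) :: real^3) \<in> borel_measurable torus" for j
    unfolding U_block_eq[OF c q0]
    by (intro L2_measurable L2_continuous continuous_intros) (simp add: U_block_def continuous_tpoly)
  show ?thesis unfolding U_field_def suminf_eq_lim
    by (intro borel_measurable_lim_metric borel_measurable_sum m)
qed

lemma U_field_integrable: "integrable torus (\<lambda>x. complex_of_real (U_field c q x $ i))"
  and U_field_fc: "fc (\<lambda>x. complex_of_real (U_field c q x $ i)) k = (\<Sum>j. U_hat c (q j) i k)"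
proof -
  have Ub: "integrable torus (U_block c (q j) i)" for j by (intro L2_integrable U_block_bounds(3)[OF q0])
  have [measurable]: "(\<lambda>x. U_field c q x $ i) \<in> borel_measurable torus"
    by (rule measurable_compose[OF U_field_measurable]) (auto intro!: borel_measurable_continuous_onI continuous_intros)
  have ae: "AE x in torus. complex_of_real (U_field c q x $ i) = (\<Sum>j. U_block c (q j) i x)"
    using U_field_AE by eventually_elim blast
  have "integrable torus (\<lambda>x. \<Sum>j. U_block c (q j) i x)"
    by (intro integrable_suminf Ub AE_summable summable_blocks_L1)
  then show int: "integrable torus (\<lambda>x. complex_of_real (U_field c q x $ i))"
    by (rule integrable_cong_AE_imp) (use ae in \<open>auto elim: eventually_mono\<close>)
  let ?g = "\<lambda>j x. fexp (- k) x * U_block c (q j) i x"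
  have "(\<integral>x. fexp (- k) x * complex_of_real (U_field c q x $ i) \<partial>torus) = (\<integral>x. (\<Sum>j. ?g j x) \<partial>torus)"
  proof (rule integral_cong_AE)
    show "AE x in torus. fexp (- k) x * complex_of_real (U_field c q x $ i) = (\<Sum>j. ?g j x)"
      using ae AE_summable[of i]
    proof eventually_elim
      case (elim x)
      then show ?case by (simp add: suminf_mult summable_norm_cancel)
    qed
    have [measurable]: "U_block c (q j) i \<in> borel_measurable torus" for j using Ub[of j] by auto
    show "(\<lambda>x. \<Sum>j. ?g j x) \<in> borel_measurable torus"
      unfolding suminf_eq_lim by (intro borel_measurable_lim_metric) measurable
  qed measurable
  also have "\<dots> = (\<Sum>j. \<integral>x. ?g j x \<partial>torus)"
    by (rule integral_suminf) (auto intro!: integrable_fexp_mult Ub AE_summable summable_blocks_L1 simp: norm_mult)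
  also have "\<dots> = (\<Sum>j. (2 * pi) ^ 3 * U_hat c (q j) i k)"
  proof (intro suminf_cong)
    fix j
    have "fc (U_block c (q j) i) k = U_hat c (q j) i k"
      unfolding U_block_def using U_hat_cube[OF c q0[of j], of i k] by (auto simp: fc_tpoly)
    then show "(\<integral>x. ?g j x \<partial>torus) = (2 * pi) ^ 3 * U_hat c (q j) i k"
      unfolding fc_fexp_mult by simp
  qed
  also have "\<dots> = (2 * pi) ^ 3 * (\<Sum>j. U_hat c (q j) i k)"
  proof (rule suminf_mult)
    \<comment> \<open>Block \<open>j\<close> starts at frequency \<open>lam (q j) / 4\<close>, so
      only finitely many blocks meet a given \<open>k\<close>.\<close>
    obtain J where J: "4 * norm (rvec k) < 2 ^ J" using real_arch_pow[of 2] by auto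
    have "U_hat c (q j) i k = 0" if "J \<le> j" for j
    proof (rule ccontr)
      assume "U_hat c (q j) i k \<noteq> 0"
      from U_hat_support(2)[OF c this] have "lam (q j) \<le> 4 * norm (rvec k)" by simp
      moreover have "(2::real) ^ J \<le> 2 ^ (j + 1)" using that by (intro power_increasing) auto
      ultimately show False using J lam_q_ge[of j] by linarith
    qed
    then show "summable (\<lambda>j. U_hat c (q j) i k)"
      by (intro summable_finite[of "{..<J}"]) (auto simp: not_less)
  qed
  finally show "fc (\<lambda>x. complex_of_real (U_field c q x $ i)) k = (\<Sum>j. U_hat c (q j) i k)"
    by (simp add: fc_def)
qed

lemma U_field_fc_low:
  assumes "norm (rvec k) < lam (q (Suc J)) / 4"
  shows "fc (\<lambda>x. complex_of_real (U_field c q x $ i)) k = (\<Sum>j\<le>J. U_hat c (q j) i k)"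
  unfolding U_field_fc
proof (rule suminf_finite)
  fix j assume "j \<notin> {..J}"
  then have "lam (q (Suc J)) \<le> lam (q j)" by (intro lam_q_mono) auto
  then show "U_hat c (q j) i k = 0" using U_hat_support(2)[OF c, of "q j" i k] assms by fastforce
qed simp

end

section \<open>The resonant interaction\<close>

lemma integral_tpoly3:
  fixes a b w :: "int^3 \<Rightarrow> complex"
  assumes "finite F" "finite G" "finite E"
  shows "(\<integral>x. tpoly F a x * tpoly G b x * tpoly E w x \<partial>torus) =
    (2 * pi) ^ 3 * (\<Sum>k\<in>F. \<Sum>l\<in>G. if - (k + l) \<in> E then a k * b l * w (- (k + l)) else 0)"
proof -
  have int: "integrable torus (\<lambda>x. a k * b l * (fexp (k + l) x * tpoly E w x))" for k l
    by (intro integrable_mult_right L2_integrable L2_fexp_mult L2_tpoly)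
  have "(\<integral>x. tpoly F a x * tpoly G b x * tpoly E w x \<partial>torus) =
    (\<integral>x. (\<Sum>k\<in>F. \<Sum>l\<in>G. a k * b l * (fexp (k + l) x * tpoly E w x)) \<partial>torus)"
  proof (rule Bochner_Integration.integral_cong[OF refl])
    fix x
    have "tpoly F a x * tpoly G b x = (\<Sum>k\<in>F. \<Sum>l\<in>G. a k * b l * fexp (k + l) x)"
      unfolding tpoly_def sum_product fexp_mult[symmetric] by (simp add: mult_ac)
    then have "tpoly F a x * tpoly G b x * z = (\<Sum>k\<in>F. \<Sum>l\<in>G. a k * b l * (fexp (k + l) x * z))" for z
      by (simp add: sum_distrib_right mult.assoc)
    then show "tpoly F a x * tpoly G b x * tpoly E w x = (\<Sum>k\<in>F. \<Sum>l\<in>G. a k * b l * (fexp (k + l) x * tpoly E w x))" .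
  qed
  also have "\<dots> = (\<Sum>k\<in>F. \<Sum>l\<in>G. a k * b l * (\<integral>x. fexp (k + l) x * tpoly E w x \<partial>torus))"
    by (simp only: Bochner_Integration.integral_sum[OF Bochner_Integration.integrable_sum[OF int]]
            Bochner_Integration.integral_sum[OF int] integral_mult_right_zero)
  also have "\<dots> = (\<Sum>k\<in>F. \<Sum>l\<in>G. (2 * pi) ^ 3 * (if - (k + l) \<in> E then a k * b l * w (- (k + l)) else 0))"
    unfolding fc_fexp_mult fc_tpoly[OF assms(3)] by (intro sum.cong refl) auto
  finally show ?thesis by (simp only: sum_distrib_left)
qed

lemma fexp_cos_sin: "fexp k x = complex_of_real (cos (rvec k \<bullet> x)) + \<i> * complex_of_real (sin (rvec k \<bullet> x))"
  unfolding fexp_def exp_Euler by (simp add: cos_of_real sin_of_real)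

text \<open>Even weights allow each cosine to be split evenly between \<open>k\<close> and
  \<open>- k\<close>. This, and \<open>tpoly_sin\<close> for odd weights, puts the real test field
  into the complex form where orthogonality applies.\<close>

lemma tpoly_cos:
  assumes D: "finite D" "D \<inter> uminus ` D = {}" and w: "\<And>k. w (- k) = w k"
  shows "complex_of_real (\<Sum>k\<in>D. cos (rvec k \<bullet> x) * w k) = tpoly (D \<union> uminus ` D) (\<lambda>k. complex_of_real (w k / 2)) x"
proof -
  have "tpoly (D \<union> uminus ` D) (\<lambda>k. complex_of_real (w k / 2)) x =
    (\<Sum>k\<in>D. complex_of_real (w k / 2) * fexp k x) + (\<Sum>k\<in>uminus ` D. complex_of_real (w k / 2) * fexp k x)"
    unfolding tpoly_def using D by (intro sum.union_disjoint) auto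
  also have "(\<Sum>k\<in>uminus ` D. complex_of_real (w k / 2) * fexp k x) = (\<Sum>k\<in>D. complex_of_real (w k / 2) * fexp (- k) x)"
    by (subst sum.reindex) (auto simp: inj_on_def w)
  also have "(\<Sum>k\<in>D. complex_of_real (w k / 2) * fexp k x) + \<dots> = (\<Sum>k\<in>D. complex_of_real (cos (rvec k \<bullet> x) * w k))"
    unfolding sum.distrib[symmetric]
    by (intro sum.cong refl) (simp add: fexp_cos_sin rvec_minus field_simps)
  finally show ?thesis by simp
qed

lemma tpoly_sin:
  assumes D: "finite D" "D \<inter> uminus ` D = {}" and w: "\<And>k. w (- k) = - w k"
  shows "complex_of_real (\<Sum>k\<in>D. sin (rvec k \<bullet> x) * w k) = tpoly (D \<union> uminus ` D) (\<lambda>k. - \<i> * complex_of_real (w k / 2)) x"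
proof -
  have "tpoly (D \<union> uminus ` D) (\<lambda>k. - \<i> * complex_of_real (w k / 2)) x =
    (\<Sum>k\<in>D. - \<i> * complex_of_real (w k / 2) * fexp k x) + (\<Sum>k\<in>uminus ` D. - \<i> * complex_of_real (w k / 2) * fexp k x)"
    unfolding tpoly_def using D by (intro sum.union_disjoint) auto
  also have "(\<Sum>k\<in>uminus ` D. - \<i> * complex_of_real (w k / 2) * fexp k x) = (\<Sum>k\<in>D. \<i> * complex_of_real (w k / 2) * fexp (- k) x)"
    by (subst sum.reindex) (auto simp: inj_on_def w)
  also have "(\<Sum>k\<in>D. - \<i> * complex_of_real (w k / 2) * fexp k x) + \<dots> = (\<Sum>k\<in>D. complex_of_real (sin (rvec k \<bullet> x) * w k))"
    unfolding sum.distrib[symmetric]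
    by (intro sum.cong refl) (simp add: fexp_cos_sin rvec_minus field_simps)
  finally show ?thesis by simp
qed

text \<open>The half-width \<open>2 * (c * lam n)\<close> exceeds the 3/2 of
  \<open>block_C_bounds\<close>, so every sum of an A and a B frequency lies inside.\<close>

definition box_D :: "real \<Rightarrow> int \<Rightarrow> (int^3) set" where
  "box_D c n = {k. \<bar>real_of_int (k $ 1) - lam n\<bar> \<le> 2 * (c * lam n) \<and> \<bar>real_of_int (k $ 2)\<bar> \<le> 2 * (c * lam n)
     \<and> \<bar>real_of_int (k $ 3) - lam n / 2\<bar> \<le> 2 * (c * lam n)}"

text \<open>Divergence-free, and close to the second basis vector on \<open>box_D c n\<close>.\<close>

definition dvec :: "int \<Rightarrow> int^3 \<Rightarrow> real^3" where
  "dvec n k = (\<chi> i. if i = 1 then - real_of_int (k $ 2) / lam n else if i = 2 then real_of_int (k $ 1) / lam n else 0)"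

definition sym_D :: "real \<Rightarrow> int \<Rightarrow> (int^3) set" where
  "sym_D c n = box_D c n \<union> uminus ` box_D c n"

lemma dvec_nth: "dvec n k $ 1 = - real_of_int (k $ 2) / lam n" "dvec n k $ 2 = real_of_int (k $ 1) / lam n" "dvec n k $ 3 = 0"
  by (simp_all add: dvec_def)

lemma dvec_div_free: "rvec k \<bullet> dvec n k = 0"
  by (simp add: inner_vec_def sum_3 dvec_nth)

lemma dvec_odd: "dvec n (- k) = - dvec n k"
  by (simp add: dvec_def vec_eq_iff)

lemma box_D_props:
  assumes c: "0 < c" "c < 1 / 100" and n: "0 < n"
  shows "finite (box_D c n)" "box_D c n \<inter> uminus ` box_D c n = {}" "sym_D c n \<subseteq> ucube n"
proof -
  note cl = c_lam_bound[OF c, of n]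
  have l: "2 \<le> lam n" by (rule lam_ge_2[OF n])
  have "box_D c n \<subseteq> ucube n"
  proof
    fix k assume "k \<in> box_D c n"
    then have "\<forall>j. \<bar>real_of_int (k $ j)\<bar> \<le> 2 * lam n"
      unfolding box_D_def mem_Collect_eq forall_3 using cl by (safe; linarith)
    then show "k \<in> ucube n" using n by (auto intro: ucubeI)
  qed
  then show "sym_D c n \<subseteq> ucube n" using uminus_cube unfolding sym_D_def ucube_def by blast
  then show "finite (box_D c n)" unfolding sym_D_def using finite_ucube finite_subset by blast
  have "False" if "k \<in> box_D c n" "- k \<in> box_D c n" for k
  proof -
    have "\<bar>real_of_int (k $ 1) - lam n\<bar> \<le> 2 * (c * lam n)" "\<bar>- real_of_int (k $ 1) - lam n\<bar> \<le> 2 * (c * lam n)"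
      using that by (auto simp: box_D_def)
    then show False using cl l by linarith
  qed
  then show "box_D c n \<inter> uminus ` box_D c n = {}" by (auto simp: mem_uminus_image)
qed

lemma dvec_bound:
  assumes "0 < n" "k \<in> ucube n" shows "\<bar>dvec n k $ i\<bar> \<le> 2"
proof -
  have "\<bar>dvec n k $ 1\<bar> \<le> 2" "\<bar>dvec n k $ 2\<bar> \<le> 2" "\<bar>dvec n k $ 3\<bar> \<le> 2"
    using ucube_nth[OF assms, of 1] ucube_nth[OF assms, of 2] lam_pos[of n]
    by (auto simp: dvec_nth abs_mult divide_le_eq)
  then show ?thesis using exhaust_3[of i] by auto
qed

text \<open>Fourier coefficient on \<open>sym_D\<close> of the \<open>j\<close>-th derivative of the
  \<open>i\<close>-th component of the test field; the half comes from writing a cosine as two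
  exponentials.\<close>

definition DV_hat :: "int \<Rightarrow> 3 \<Rightarrow> 3 \<Rightarrow> int^3 \<Rightarrow> complex" where
  "DV_hat n i j k = complex_of_real (real_of_int (k $ j) * dvec n k $ i / 2)"

lemma DV_hat_even: "DV_hat n i j (- k) = DV_hat n i j k"
  by (simp add: DV_hat_def dvec_odd)

lemma test_fields:
  assumes c: "0 < c" "c < 1 / 100" and n: "0 < n"
  shows "complex_of_real (test_DV (box_D c n) (dvec n) j x $ i) = tpoly (sym_D c n) (DV_hat n i j) x"
    and "complex_of_real (test_V (box_D c n) (dvec n) x $ i) = tpoly (sym_D c n) (\<lambda>k. - \<i> * complex_of_real (dvec n k $ i / 2)) x"
    and "complex_of_real (test_LV (box_D c n) (dvec n) x $ i) = tpoly (sym_D c n) (\<lambda>k. - \<i> * complex_of_real (- (norm (rvec k))\<^sup>2 * dvec n k $ i / 2)) x"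
proof -
  note D = box_D_props(1,2)[OF assms]
  show "complex_of_real (test_DV (box_D c n) (dvec n) j x $ i) = tpoly (sym_D c n) (DV_hat n i j) x"
    unfolding DV_hat_def[abs_def] sym_D_def
    by (subst tpoly_cos[OF D, symmetric]) (auto simp: test_DV_def trigf_def dvec_odd mult.assoc)
  show "complex_of_real (test_V (box_D c n) (dvec n) x $ i) = tpoly (sym_D c n) (\<lambda>k. - \<i> * complex_of_real (dvec n k $ i / 2)) x"
    unfolding sym_D_def
    by (subst tpoly_sin[OF D, symmetric]) (auto simp: test_V_def trigf_def dvec_odd)
  show "complex_of_real (test_LV (box_D c n) (dvec n) x $ i) = tpoly (sym_D c n) (\<lambda>k. - \<i> * complex_of_real (- (norm (rvec k))\<^sup>2 * dvec n k $ i / 2)) x"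
    unfolding sym_D_def
    by (subst tpoly_sin[OF D, symmetric]) (auto simp: test_LV_def trigf_def dvec_odd rvec_minus mult.assoc)
qed

text \<open>Instances of \<open>ucube_tpoly_bounds\<close>, with coefficients of size at most
  \<open>2 * lam n\<close> for the gradient, 1 for the field and \<open>12 * (lam n)\<^sup>2\<close>
  for its Laplacian.\<close>

lemma test_field_bounds:
  assumes c: "0 < c" "c < 1 / 100" and n: "0 < n"
  shows "norm (tpoly (sym_D c n) (DV_hat n i j) x) \<le> 250 * lam n ^ 4"
    and "l2norm (tpoly (sym_D c n) (DV_hat n i j)) \<le> 364 * ((lam n)\<^sup>2 * sqrt (lam n))"
    and "l2norm (\<lambda>x. test_V (box_D c n) (dvec n) x $ i) \<le> 182 * (lam n * sqrt (lam n))"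
    and "l2norm (\<lambda>x. test_LV (box_D c n) (dvec n) x $ i) \<le> 2184 * (lam n ^ 3 * sqrt (lam n))"
proof -
  have l: "0 < lam n" by (rule lam_pos)
  note sub = box_D_props(3)[OF assms]
  have d: "\<bar>dvec n k $ i\<bar> \<le> 2" if "k \<in> sym_D c n" for k i using dvec_bound[OF n] sub that by blast
  have k: "\<bar>real_of_int (k $ j)\<bar> \<le> 2 * lam n" if "k \<in> sym_D c n" for k j using ucube_nth[OF n] sub that by blast
  have 1: "norm (DV_hat n i j k) \<le> 2 * lam n" if "k \<in> sym_D c n" for k
  proof -
    have "\<bar>real_of_int (k $ j)\<bar> * \<bar>dvec n k $ i\<bar> \<le> 2 * lam n * 2"
      using l by (intro mult_mono k d that) auto
    then show ?thesis by (simp add: DV_hat_def norm_mult abs_mult)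
  qed
  have B: "0 \<le> 2 * lam n" using l by simp
  show "norm (tpoly (sym_D c n) (DV_hat n i j) x) \<le> 250 * lam n ^ 4"
    using ucube_tpoly_bounds(1)[OF n sub 1 B] by (simp add: power_eq_if)
  show "l2norm (tpoly (sym_D c n) (DV_hat n i j)) \<le> 364 * ((lam n)\<^sup>2 * sqrt (lam n))"
    using ucube_tpoly_bounds(2)[OF n sub 1 B] by (simp add: power2_eq_square mult_ac)
  have 2: "norm (- \<i> * complex_of_real (dvec n k $ i / 2)) \<le> 1" if "k \<in> sym_D c n" for k
    using d[OF that, of i] by (simp add: norm_mult)
  have "l2norm (tpoly (sym_D c n) (\<lambda>k. - \<i> * complex_of_real (dvec n k $ i / 2))) \<le> 182 * (lam n * sqrt (lam n)) * 1"
    by (rule ucube_tpoly_bounds(2)[OF n sub 2]) auto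
  then show "l2norm (\<lambda>x. test_V (box_D c n) (dvec n) x $ i) \<le> 182 * (lam n * sqrt (lam n))"
    unfolding l2norm_of_real[symmetric, of "\<lambda>x. test_V (box_D c n) (dvec n) x $ i"] test_fields(2)[OF assms] by simp
  have 3: "norm (- \<i> * complex_of_real (- (norm (rvec k))\<^sup>2 * dvec n k $ i / 2)) \<le> 12 * (lam n)\<^sup>2" if "k \<in> sym_D c n" for k
  proof -
    have "(norm (rvec k))\<^sup>2 = (\<Sum>j\<in>UNIV. \<bar>real_of_int (k $ j)\<bar>\<^sup>2)" by (simp add: norm_rvec_sq)
    also have "\<dots> \<le> (\<Sum>j\<in>(UNIV::3 set). (2 * lam n)\<^sup>2)" by (intro sum_mono power_mono k that) auto
    also have "\<dots> = 12 * (lam n)\<^sup>2" by (simp add: power_mult_distrib)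
    finally have "(norm (rvec k))\<^sup>2 * \<bar>dvec n k $ i\<bar> \<le> 12 * (lam n)\<^sup>2 * 2"
      using d[OF that, of i] by (intro mult_mono) auto
    then show ?thesis by (simp add: norm_mult norm_power abs_mult)
  qed
  have "l2norm (tpoly (sym_D c n) (\<lambda>k. - \<i> * complex_of_real (- (norm (rvec k))\<^sup>2 * dvec n k $ i / 2))) \<le> 182 * (lam n * sqrt (lam n)) * (12 * (lam n)\<^sup>2)"
    by (rule ucube_tpoly_bounds(2)[OF n sub 3]) auto
  then show "l2norm (\<lambda>x. test_LV (box_D c n) (dvec n) x $ i) \<le> 2184 * (lam n ^ 3 * sqrt (lam n))"
    unfolding l2norm_of_real[symmetric, of "\<lambda>x. test_LV (box_D c n) (dvec n) x $ i"] test_fields(3)[OF assms]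
    by (simp add: power2_eq_square power3_eq_cube mult_ac)
qed

text \<open>A perturbation of an exact case: for a = (0,1,0), b = (1,0,0) and (x,y,z) = (1,0,1/2)
  the first product is 1 and the second 0. Here a and b stand for the projected basis vectors at an
  A and a B frequency, and (x,y,z) for the normalised sum of these frequencies.\<close>

lemma interaction_numeric:
  fixes a1 a2 a3 b1 b2 b3 x y z :: real
  assumes "\<bar>a1\<bar> \<le> 1/50" "\<bar>a2 - 1\<bar> \<le> 1/50" "\<bar>a3\<bar> \<le> 1/50" "\<bar>b1 - 1\<bar> \<le> 1/50" "\<bar>b2\<bar> \<le> 1/50" "\<bar>b3\<bar> \<le> 1/50"
    "\<bar>x - 1\<bar> \<le> 1/50" "\<bar>y\<bar> \<le> 1/50" "\<bar>z - 1/2\<bar> \<le> 1/50"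
  shows "4/5 \<le> (- a1 * y + a2 * x) * (b1 * x + b2 * y + b3 * z) + (- b1 * y + b2 * x) * (a1 * x + a2 * y + a3 * z)"
proof -
  have pb: "\<bar>p * r\<bar> \<le> P * R" if "\<bar>p\<bar> \<le> P" "\<bar>r\<bar> \<le> R" for p r P R :: real
    unfolding abs_mult using that by (intro mult_mono) auto
  have lb: "P * R \<le> p * r" if "P \<le> p" "R \<le> r" "0 \<le> P" "0 \<le> R" for p r P R :: real
    using that by (intro mult_mono) auto
  have near: "\<bar>p\<bar> \<le> 51/50" "49/50 \<le> p" if "\<bar>p - 1\<bar> \<le> 1/50" for p :: real using that by linarith+
  have ub: "\<bar>z\<bar> \<le> 26/50" using assms(9) by linarith
  note ba = near(1)[OF assms(2)] and bb = near(1)[OF assms(4)] and bx = near(1)[OF assms(7)]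
  note la = near(2)[OF assms(2)] and lbb = near(2)[OF assms(4)] and lx = near(2)[OF assms(7)]
  have "19/20 \<le> - a1 * y + a2 * x"
    using pb[OF assms(1,8)] lb[OF la lx] unfolding abs_le_iff by simp
  moreover have "19/20 - 1/50 \<le> b1 * x + b2 * y + b3 * z"
    using lb[OF lbb lx] pb[OF assms(5,8)] pb[OF assms(6) ub] unfolding abs_le_iff by simp
  ultimately have 1: "(19/20) * (19/20 - 1/50) \<le> (- a1 * y + a2 * x) * (b1 * x + b2 * y + b3 * z)"
    by (intro lb) auto
  have "\<bar>- b1 * y + b2 * x\<bar> \<le> 1/10"
    using pb[OF bb assms(8)] pb[OF assms(5) bx] unfolding abs_le_iff by (intro conjI) simp_all
  moreover have "\<bar>a1 * x + a2 * y + a3 * z\<bar> \<le> 1/10"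
    using pb[OF assms(1) bx] pb[OF ba assms(8)] pb[OF assms(3) ub] unfolding abs_le_iff by (intro conjI) simp_all
  ultimately have 2: "\<bar>(- b1 * y + b2 * x) * (a1 * x + a2 * y + a3 * z)\<bar> \<le> (1/10) * (1/10)"
    by (rule pb)
  have "4/5 \<le> P + R" if "(19/20) * (19/20 - 1/50) \<le> P" "\<bar>R\<bar> \<le> (1/10) * (1/10)" for P R :: real
    using that by simp
  from this[OF 1 2] show ?thesis .
qed

text \<open>The projection removes only the component along \<xi>. If some coordinate dominates the
  \<open>j\<close>-th one, the \<open>j\<close>-th basis vector is nearly orthogonal to \<xi> and is
  almost preserved.\<close>

lemma leray_near:
  assumes "\<bar>\<xi> $ j\<bar> \<le> r * \<bar>\<xi> $ l\<bar>" "\<xi> $ l \<noteq> 0"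
  shows "\<bar>leray_symbol \<xi> $ i $ j - (if i = j then 1 else 0)\<bar> \<le> r"
proof -
  have \<xi>: "0 < norm \<xi>" using assms(2) by auto
  have r: "0 \<le> r"
  proof (rule ccontr)
    assume "\<not> 0 \<le> r"
    then have "r * \<bar>\<xi> $ l\<bar> < 0" using assms(2) by (simp add: mult_neg_pos)
    then show False using assms(1) by linarith
  qed
  have "\<bar>\<xi> $ i * \<xi> $ j\<bar> \<le> norm \<xi> * (r * norm \<xi>)"
    unfolding abs_mult using assms(1) component_le_norm_cart[of \<xi> l] r
    by (intro mult_mono component_le_norm_cart order_trans[OF assms(1)] mult_left_mono) auto
  then have "\<bar>\<xi> $ i * \<xi> $ j / (norm \<xi>)\<^sup>2\<bar> \<le> r" using \<xi> by (simp add: abs_mult divide_le_eq power2_eq_square mult_ac)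
  then show ?thesis unfolding leray_nth by simp
qed

text \<open>Contribution of the ordered pair \<open>k\<close>, \<open>l\<close> to the transport
  term of the block, up to the factor \<open>(2 * pi) ^ 3\<close>.\<close>

definition inter :: "real \<Rightarrow> int \<Rightarrow> int^3 \<Rightarrow> int^3 \<Rightarrow> complex" where
  "inter c n k l = (\<Sum>i\<in>UNIV. \<Sum>j\<in>UNIV. if - (k + l) \<in> sym_D c n then U_hat c n i k * U_hat c n j l * DV_hat n i j (- (k + l)) else 0)"

lemma uminus_sym_D: "- k \<in> sym_D c n \<longleftrightarrow> k \<in> sym_D c n"
  by (auto simp: sym_D_def mem_uminus_image)

lemma inter_cnj: "inter c n (- k) (- l) = cnj (inter c n k l)"
proof -
  have "- k + - l = - (k + l)" by simp
  then show ?thesis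
    unfolding inter_def by (simp only: uminus_sym_D DV_hat_even)
     (auto simp: U_hat_cnj[symmetric] DV_hat_def intro!: sum.cong)
qed

text \<open>The two amplitudes give \<open>1 / lam n ^ 4\<close> and the derivative a factor
  \<open>lam n\<close>. The numerical factor is the 4/5 of \<open>interaction_numeric\<close>,
  halved by the 1/2 in \<open>DV_hat\<close>. The ordering \<open>a\<close>, \<open>b\<close>
  dominates, and the reverse one is a small error.\<close>

lemma interaction_AB:
  assumes c: "0 < c" "c < 1 / 100" and n: "0 < n" and a: "a \<in> block_A c n" and b: "b \<in> block_B c n"
  shows "2 / 5 * (1 / lam n ^ 3) \<le> Re (inter c n a b + inter c n b a)"
proof -
  note cl = c_lam_bound[OF c, of n]
  have l: "2 \<le> lam n" by (rule lam_ge_2[OF n])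
  define \<Lambda> where "\<Lambda> = lam n"
  have L: "0 < \<Lambda>" using l by (simp add: \<Lambda>_def)
  note ab = a[unfolded block_A_iff] b[unfolded block_B_iff]
  \<comment> \<open>On the C block both the first and the third coordinate are large, while an A or
    B frequency has one of them near 0. The coefficients at \<open>a\<close> and \<open>b\<close>
    are therefore just the projected basis vectors.\<close>
  have notC: "\<not> k \<in> block_C c n" if "\<bar>real_of_int (k $ 1)\<bar> < lam n / 2 \<or> \<bar>real_of_int (k $ 3)\<bar> < lam n / 4" for k
    using that block_C_bounds[of k c n] cl by (auto; linarith)
  have a_eq: "U_hat c n i a = complex_of_real (leray_symbol (rvec a) $ i $ 2 / \<Lambda>\<^sup>2)" for i
  proof -
    have "a \<notin> block_C c n" "- a \<notin> block_C c n" by (rule notC, use ab cl l in \<open>simp, linarith\<close>)+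
    moreover have "a \<notin> block_B c n" "- a \<notin> block_B c n"
      unfolding block_B_iff uminus_vec_def vec_lambda_beta of_int_minus using ab cl l by linarith+
    ultimately show ?thesis using a by (simp add: U_hat_eq leray_e \<Lambda>_def scaleR_conv_of_real)
  qed
  have b_eq: "U_hat c n i b = complex_of_real (leray_symbol (rvec b) $ i $ 1 / \<Lambda>\<^sup>2)" for i
  proof -
    have "b \<notin> block_C c n" "- b \<notin> block_C c n" by (rule notC, use ab cl l in \<open>simp, linarith\<close>)+
    moreover have "b \<notin> block_A c n" "- b \<notin> block_A c n"
      unfolding block_A_iff uminus_vec_def vec_lambda_beta of_int_minus using ab cl l by linarith+
    ultimately show ?thesis using b by (simp add: U_hat_eq leray_e \<Lambda>_def scaleR_conv_of_real)
  qed
  have "a + b \<in> box_D c n"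
    unfolding box_D_def mem_Collect_eq plus_vec_def vec_lambda_beta of_int_add using ab cl by linarith
  then have "a + b \<in> sym_D c n" by (simp add: sym_D_def)
  then have in_D: "- (a + b) \<in> sym_D c n" by (simp only: uminus_sym_D)
  let ?al = "\<lambda>i. leray_symbol (rvec a) $ i $ 2" and ?be = "\<lambda>i. leray_symbol (rvec b) $ i $ 1" and ?k = "\<lambda>i. real_of_int ((a + b) $ i)"
  define x y z where "x = ?k 1 / \<Lambda>" and "y = ?k 2 / \<Lambda>" and "z = ?k 3 / \<Lambda>"
  have k: "?k 1 = x * \<Lambda>" "?k 2 = y * \<Lambda>" "?k 3 = z * \<Lambda>" using L by (simp_all add: x_def y_def z_def)
  have d: "dvec n (a + b) $ 1 = - y" "dvec n (a + b) $ 2 = x" "dvec n (a + b) $ 3 = 0"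
    by (simp_all only: dvec_nth x_def y_def \<Lambda>_def minus_divide_left)
  have "inter c n a b = complex_of_real (\<Sum>i\<in>UNIV. \<Sum>j\<in>UNIV. ?al i / \<Lambda>\<^sup>2 * (?be j / \<Lambda>\<^sup>2) * (?k j * dvec n (a + b) $ i / 2))"
    unfolding inter_def if_P[OF in_D] DV_hat_even a_eq b_eq unfolding DV_hat_def by (simp only: of_real_sum of_real_mult)
  moreover have "inter c n b a = complex_of_real (\<Sum>i\<in>UNIV. \<Sum>j\<in>UNIV. ?be i / \<Lambda>\<^sup>2 * (?al j / \<Lambda>\<^sup>2) * (?k j * dvec n (a + b) $ i / 2))"
    unfolding inter_def add.commute[of b a] if_P[OF in_D] DV_hat_even a_eq b_eq unfolding DV_hat_def by (simp only: of_real_sum of_real_mult)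
  ultimately have "Re (inter c n a b + inter c n b a) =
     (\<Sum>i\<in>UNIV. \<Sum>j\<in>UNIV. ?al i / \<Lambda>\<^sup>2 * (?be j / \<Lambda>\<^sup>2) * (?k j * dvec n (a + b) $ i / 2)) +
     (\<Sum>i\<in>UNIV. \<Sum>j\<in>UNIV. ?be i / \<Lambda>\<^sup>2 * (?al j / \<Lambda>\<^sup>2) * (?k j * dvec n (a + b) $ i / 2))" by simp
  also have "\<dots> = ((- ?al 1 * y + ?al 2 * x) * (?be 1 * x + ?be 2 * y + ?be 3 * z) + (- ?be 1 * y + ?be 2 * x) * (?al 1 * x + ?al 2 * y + ?al 3 * z)) * (1 / (2 * \<Lambda> ^ 3))"
    unfolding sum_3 k d using L by (simp add: field_simps power2_eq_square power3_eq_cube)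
  also have "\<dots> \<ge> 4 / 5 * (1 / (2 * \<Lambda> ^ 3))"
  proof (rule mult_right_mono[OF interaction_numeric])
    have ra: "\<bar>rvec a $ 2\<bar> \<le> 1/50 * \<bar>rvec a $ 1\<bar>" "rvec a $ 1 \<noteq> 0" using ab cl l by (simp, linarith)+
    have rb: "\<bar>rvec b $ 1\<bar> \<le> 1/50 * \<bar>rvec b $ 3\<bar>" "rvec b $ 3 \<noteq> 0" using ab cl l by (simp, linarith)+
    note na = leray_near[OF ra] and nb = leray_near[OF rb]
    show "\<bar>?al 1\<bar> \<le> 1/50" "\<bar>?al 2 - 1\<bar> \<le> 1/50" "\<bar>?al 3\<bar> \<le> 1/50" using na[of 1] na[of 2] na[of 3] by simp_all
    show "\<bar>?be 1 - 1\<bar> \<le> 1/50" "\<bar>?be 2\<bar> \<le> 1/50" "\<bar>?be 3\<bar> \<le> 1/50" using nb[of 1] nb[of 2] nb[of 3] by simp_all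
    have "\<bar>?k 1 - \<Lambda>\<bar> \<le> \<Lambda> / 50" "\<bar>?k 2\<bar> \<le> \<Lambda> / 50" "\<bar>?k 3 - \<Lambda> / 2\<bar> \<le> \<Lambda> / 50"
      using ab cl unfolding \<Lambda>_def plus_vec_def vec_lambda_beta of_int_add by linarith+
    then show "\<bar>x - 1\<bar> \<le> 1/50" "\<bar>y\<bar> \<le> 1/50" "\<bar>z - 1/2\<bar> \<le> 1/50"
      using L unfolding x_def y_def z_def abs_le_iff by (auto simp: field_simps)
  qed (use L in auto)
  finally show ?thesis by (simp add: \<Lambda>_def)
qed

text \<open>In units of \<open>lam n\<close>, the first and third coordinates of a frequency of U at
  this scale are near (1,0), (0,1/2) or (1,1/2), or the negative of one of these. The only way to
  reach (1,1/2) as a sum of two of these six points is (1,0) + (0,1/2).\<close>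

lemma interaction_support:
  assumes c: "0 < c" "c < 1 / 100" and n: "0 < n" and k: "U_hat c n i k \<noteq> 0" and l: "U_hat c n j l \<noteq> 0" and D: "k + l \<in> box_D c n"
  shows "k \<in> block_A c n \<and> l \<in> block_B c n \<or> k \<in> block_B c n \<and> l \<in> block_A c n"
proof -
  note cl = c_lam_bound[OF c, of n]
  define L where "L = lam n"
  have L: "2 \<le> L" unfolding L_def by (rule lam_ge_2[OF n])
  define m where "m = L / 50"
  have D1: "\<bar>real_of_int (k $ 1) + real_of_int (l $ 1) - L\<bar> \<le> m" "\<bar>real_of_int (k $ 3) + real_of_int (l $ 3) - L / 2\<bar> \<le> m"
    using D cl by (auto simp: box_D_def m_def L_def)
  have cases: "(p \<in> block_A c n \<and> \<bar>real_of_int (p $ 1) - L\<bar> \<le> m \<and> \<bar>real_of_int (p $ 3)\<bar> \<le> m) \<or>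
      (p \<in> block_B c n \<and> \<bar>real_of_int (p $ 1)\<bar> \<le> m \<and> \<bar>real_of_int (p $ 3) - L / 2\<bar> \<le> m) \<or>
      (\<bar>real_of_int (p $ 1) + L\<bar> \<le> m \<and> \<bar>real_of_int (p $ 3)\<bar> \<le> m) \<or>
      (\<bar>real_of_int (p $ 1)\<bar> \<le> m \<and> \<bar>real_of_int (p $ 3) + L / 2\<bar> \<le> m) \<or>
      (\<bar>real_of_int (p $ 1) - L\<bar> \<le> m \<and> \<bar>real_of_int (p $ 3) - L / 2\<bar> \<le> m) \<or>
      (\<bar>real_of_int (p $ 1) + L\<bar> \<le> m \<and> \<bar>real_of_int (p $ 3) + L / 2\<bar> \<le> m)"
    (is "?A \<or> ?B \<or> ?A' \<or> ?B' \<or> ?C \<or> ?C'") if "U_hat c n i p \<noteq> 0" for i p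
  proof -
    have cm: "c * L \<le> m / 2" "0 < m" using cl L by (simp_all add: m_def L_def)
    have "p \<in> block_A c n \<or> p \<in> block_B c n \<or> - p \<in> block_A c n \<or> - p \<in> block_B c n \<or> p \<in> block_C c n \<or> - p \<in> block_C c n"
      using U_hat_nz[OF that] by auto
    then show ?thesis
    proof (elim disjE)
      assume p: "p \<in> block_A c n"
      from p[unfolded block_A_iff, folded L_def] cm have ?A using p by (intro conjI; linarith?)
      then show ?thesis by blast
    next
      assume p: "p \<in> block_B c n"
      from p[unfolded block_B_iff, folded L_def] cm have ?B using p by (intro conjI; linarith?)
      then show ?thesis by blast
    next
      assume "- p \<in> block_A c n"
      from this[unfolded block_A_iff uminus_vec_def vec_lambda_beta of_int_minus, folded L_def] cm
      have ?A' by (intro conjI; linarith)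
      then show ?thesis by blast
    next
      assume "- p \<in> block_B c n"
      from this[unfolded block_B_iff uminus_vec_def vec_lambda_beta of_int_minus, folded L_def] cm
      have ?B' by (intro conjI; linarith)
      then show ?thesis by blast
    next
      assume "p \<in> block_C c n"
      from block_C_bounds[OF this, folded L_def] cm have ?C by (intro conjI; linarith)
      then show ?thesis by blast
    next
      assume "- p \<in> block_C c n"
      from block_C_bounds[OF this, unfolded uminus_vec_def vec_lambda_beta of_int_minus, folded L_def] cm
      have ?C' by (intro conjI; linarith)
      then show ?thesis by blast
    qed
  qed
  have m: "50 * m = L" "0 < m" using L by (simp_all add: m_def)
  show ?thesis using cases[OF k] cases[OF l] D1 m unfolding abs_le_iff
    by (elim disjE conjE; (linarith | blast))
qed

text \<open>If the sum lies in the reflected box, negating both frequencies reduces to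
  \<open>interaction_support\<close>; the supports are symmetric because the coefficients are
  Hermitian.\<close>

lemma inter_support:
  assumes c: "0 < c" "c < 1 / 100" and n: "0 < n" and nz: "inter c n k l \<noteq> 0"
  shows "(k \<in> block_A c n \<and> l \<in> block_B c n \<or> k \<in> block_B c n \<and> l \<in> block_A c n) \<or>
    (- k \<in> block_A c n \<and> - l \<in> block_B c n \<or> - k \<in> block_B c n \<and> - l \<in> block_A c n)"
proof -
  have D: "k + l \<in> sym_D c n"
    using nz uminus_sym_D[of "k + l" c n] unfolding inter_def by (auto split: if_splits)
  obtain i j where ij: "U_hat c n i k \<noteq> 0" "U_hat c n j l \<noteq> 0"
  proof -
    obtain i where "(\<Sum>j\<in>UNIV. if - (k + l) \<in> sym_D c n then U_hat c n i k * U_hat c n j l * DV_hat n i j (- (k + l)) else 0) \<noteq> 0"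
      using nz unfolding inter_def by (rule sum.not_neutral_contains_not_neutral)
    then obtain j where "(if - (k + l) \<in> sym_D c n then U_hat c n i k * U_hat c n j l * DV_hat n i j (- (k + l)) else 0) \<noteq> 0"
      by (rule sum.not_neutral_contains_not_neutral)
    then show ?thesis using that[of i j] by (auto split: if_splits)
  qed
  show ?thesis
  proof (cases "k + l \<in> box_D c n")
    case True
    then show ?thesis using interaction_support[OF c n ij] by blast
  next
    case False
    then have "- k + - l \<in> box_D c n" using D by (auto simp: sym_D_def mem_uminus_image)
    moreover have "U_hat c n i (- k) \<noteq> 0" "U_hat c n j (- l) \<noteq> 0" using ij U_hat_cnj[of c n] by (metis complex_cnj_zero_iff)+
    ultimately show ?thesis using interaction_support[OF c n] by blast
  qed
qed

text \<open>This sign lets \<open>main_term\<close> discard every pair outside A times B from a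
  lower bound.\<close>

lemma inter_nonneg:
  assumes c: "0 < c" "c < 1 / 100" and n: "0 < n"
  shows "0 \<le> Re (inter c n k l + inter c n l k)"
proof -
  have AB: "0 \<le> Re (inter c n a b + inter c n b a)" if "a \<in> block_A c n" "b \<in> block_B c n" for a b
    using interaction_AB[OF c n that] lam_pos[of n] by (intro order_trans[OF _ interaction_AB[OF c n that]]) auto
  show ?thesis
  proof (cases "inter c n k l = 0 \<and> inter c n l k = 0")
    case False
    then have "(k \<in> block_A c n \<and> l \<in> block_B c n \<or> k \<in> block_B c n \<and> l \<in> block_A c n) \<or>
      (- k \<in> block_A c n \<and> - l \<in> block_B c n \<or> - k \<in> block_B c n \<and> - l \<in> block_A c n)"
      using inter_support[OF c n] by blast
    then show ?thesis
    proof (elim disjE conjE)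
      assume "- k \<in> block_A c n" "- l \<in> block_B c n"
      from AB[OF this] show ?thesis by (simp only: inter_cnj plus_complex.simps cnj.simps)
    next
      assume "- k \<in> block_B c n" "- l \<in> block_A c n"
      from AB[OF this(2,1)] show ?thesis by (simp only: inter_cnj plus_complex.simps cnj.simps add.commute)
    next
      assume "k \<in> block_B c n" "l \<in> block_A c n"
      from AB[OF this(2,1)] show ?thesis by (simp only: add.commute)
    qed (rule AB)
  qed simp
qed

lemma card_shifted_cube:
  assumes "finite S" and "\<And>k. k \<in> cube N \<Longrightarrow> p + k \<in> S"
  shows "(2 * N + 1) ^ 3 \<le> card S"
proof -
  have "card ((+) p ` cube N) \<le> card S" using assms by (intro card_mono) auto
  then show ?thesis by (simp add: card_image card_cube)
qed

lemma block_finite: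
  assumes "0 < c" "c < 1 / 100" "0 < n"
  shows "block_A c n \<subseteq> ucube n" "block_B c n \<subseteq> ucube n"
  using block_nth_le(1)[OF assms(1,2)] ucubeI[OF assms(3)] by blast+

text \<open>An interval of half-length y about an integer contains 2 * floor y + 1 integers, which
  is at least y even when y < 1. The centres \<open>lam n\<close> and \<open>lam n / 2\<close> are
  integers because \<open>n\<close> is positive.\<close>

lemma block_card:
  assumes c: "0 < c" "c < 1 / 100" and n: "0 < n"
  shows "(c * lam n) ^ 3 \<le> real (card (block_A c n))" "(c * lam n / 2) ^ 3 \<le> real (card (block_B c n))"
proof -
  have le: "y ^ 3 \<le> real (card S)" if "0 < y" "(2 * nat \<lfloor>y\<rfloor> + 1) ^ 3 \<le> card S" for y :: real and S :: "(int^3) set"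
  proof -
    have "y \<le> 2 * real (nat \<lfloor>y\<rfloor>) + 1" using that(1) by linarith
    then have "y ^ 3 \<le> (2 * real (nat \<lfloor>y\<rfloor>) + 1) ^ 3" using that(1) by (intro power_mono) auto
    also have "\<dots> = real ((2 * nat \<lfloor>y\<rfloor> + 1) ^ 3)" by (simp add: add.commute)
    also have "\<dots> \<le> real (card S)" using that(2) by (rule of_nat_mono)
    finally show ?thesis .
  qed
  have cube: "\<bar>real_of_int (k $ i)\<bar> \<le> y" if "k \<in> cube (nat \<lfloor>y\<rfloor>)" "0 < y" for k y i
  proof -
    have "\<bar>k $ i\<bar> \<le> \<lfloor>y\<rfloor>" using that by (simp add: cube_def)
    then show ?thesis by linarith
  qed
  define m :: int where "m = 2 ^ (nat n - 1)"
  have m: "lam n = 2 * real_of_int m"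
  proof -
    have "Suc (nat n - 1) = nat n" using n by simp
    then have "(2::real) ^ nat n = 2 * 2 ^ (nat n - 1)" by (metis power_Suc)
    then show ?thesis using n by (simp add: lam_nat m_def)
  qed
  note fin = block_finite[OF assms, THEN finite_subset, OF finite_ucube]
  have y: "0 < c * lam n" "0 < c * lam n / 2" using c lam_pos[of n] by simp_all
  show "(c * lam n) ^ 3 \<le> real (card (block_A c n))"
  proof (rule le[OF y(1)], rule card_shifted_cube[OF fin(1)])
    fix k assume "k \<in> cube (nat \<lfloor>c * lam n\<rfloor>)"
    note k = cube[OF this y(1)]
    show "axis 1 (2 * m) + k \<in> block_A c n"
      unfolding block_A_iff using k[of 1] k[of 2] k[of 3] by (simp add: axis_def m)
  qed
  show "(c * lam n / 2) ^ 3 \<le> real (card (block_B c n))"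
  proof (rule le[OF y(2)], rule card_shifted_cube[OF fin(2)])
    fix k assume "k \<in> cube (nat \<lfloor>c * lam n / 2\<rfloor>)"
    note k = cube[OF this y(2)]
    show "axis 3 m + k \<in> block_B c n"
      unfolding block_B_iff using k[of 1] k[of 2] k[of 3] by (simp add: axis_def m)
  qed
qed

text \<open>Only triads made of one frequency from the first block and one from the second contribute, and
  each of them contributes with the same sign once the two orderings are added.\<close>

lemma main_term:
  assumes c: "0 < c" "c < 1 / 100" and n: "0 < n"
  shows "c ^ 6 * lam n ^ 3 \<le> Re (\<Sum>i\<in>UNIV. \<Sum>j\<in>UNIV. \<integral>x. U_block c n i x * U_block c n j x * tpoly (sym_D c n) (DV_hat n i j) x \<partial>torus)"
proof -
  let ?F = "ucube n"
  have fin: "finite (sym_D c n)" using box_D_props(3)[OF assms] finite_ucube by (rule finite_subset)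
  have e1: "(\<Sum>i\<in>UNIV. \<Sum>j\<in>UNIV. \<integral>x. U_block c n i x * U_block c n j x * tpoly (sym_D c n) (DV_hat n i j) x \<partial>torus)
    = (\<Sum>i\<in>UNIV. \<Sum>j\<in>UNIV. (2 * pi) ^ 3 * (\<Sum>k\<in>?F. \<Sum>l\<in>?F. if - (k + l) \<in> sym_D c n then U_hat c n i k * U_hat c n j l * DV_hat n i j (- (k + l)) else 0))"
    unfolding U_block_def by (simp only: integral_tpoly3[OF finite_ucube finite_ucube fin])
  have e2: "(\<Sum>i\<in>UNIV. \<Sum>j\<in>UNIV. (2 * pi) ^ 3 * (\<Sum>k\<in>?F. \<Sum>l\<in>?F. if - (k + l) \<in> sym_D c n then U_hat c n i k * U_hat c n j l * DV_hat n i j (- (k + l)) else 0))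
    = complex_of_real ((2 * pi) ^ 3) * (\<Sum>k\<in>?F. \<Sum>l\<in>?F. inter c n k l)"
  proof -
    have swap: "(\<Sum>i\<in>UNIV. \<Sum>j\<in>UNIV. \<Sum>k\<in>?F. \<Sum>l\<in>?F. f i j k l) = (\<Sum>k\<in>?F. \<Sum>l\<in>?F. \<Sum>i\<in>UNIV. \<Sum>j\<in>UNIV. f i j k l)" for f :: "3 \<Rightarrow> 3 \<Rightarrow> int^3 \<Rightarrow> int^3 \<Rightarrow> complex"
    proof -
      have "(\<Sum>i\<in>UNIV. \<Sum>j\<in>UNIV. \<Sum>k\<in>?F. \<Sum>l\<in>?F. f i j k l) = (\<Sum>i\<in>UNIV. \<Sum>k\<in>?F. \<Sum>j\<in>UNIV. \<Sum>l\<in>?F. f i j k l)"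
        by (intro sum.cong refl sum.swap)
      also have "\<dots> = (\<Sum>k\<in>?F. \<Sum>i\<in>UNIV. \<Sum>j\<in>UNIV. \<Sum>l\<in>?F. f i j k l)" by (rule sum.swap)
      also have "\<dots> = (\<Sum>k\<in>?F. \<Sum>i\<in>UNIV. \<Sum>l\<in>?F. \<Sum>j\<in>UNIV. f i j k l)" by (intro sum.cong refl sum.swap)
      also have "\<dots> = (\<Sum>k\<in>?F. \<Sum>l\<in>?F. \<Sum>i\<in>UNIV. \<Sum>j\<in>UNIV. f i j k l)" by (intro sum.cong refl sum.swap)
      finally show ?thesis .
    qed
    show ?thesis unfolding sum_distrib_left[symmetric] inter_def by (subst swap) simp
  qed
  have eq: "Re (\<Sum>i\<in>UNIV. \<Sum>j\<in>UNIV. \<integral>x. U_block c n i x * U_block c n j x * tpoly (sym_D c n) (DV_hat n i j) x \<partial>torus)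
     = (2 * pi) ^ 3 * (\<Sum>k\<in>?F. \<Sum>l\<in>?F. Re (inter c n k l))"
    unfolding e1 e2 times_complex.sel Re_complex_of_real Im_complex_of_real Re_sum by simp
  have "(\<Sum>k\<in>?F. \<Sum>l\<in>?F. Re (inter c n k l + inter c n l k)) = 2 * (\<Sum>k\<in>?F. \<Sum>l\<in>?F. Re (inter c n k l))"
    using sum.swap[of "\<lambda>k l. Re (inter c n l k)" ?F ?F] by (simp add: sum.distrib)
  moreover have "(\<Sum>k\<in>block_A c n. \<Sum>l\<in>block_B c n. 2 / 5 * (1 / lam n ^ 3)) \<le> (\<Sum>k\<in>?F. \<Sum>l\<in>?F. Re (inter c n k l + inter c n l k))"
  proof -
    have "(\<Sum>k\<in>block_A c n. \<Sum>l\<in>block_B c n. 2 / 5 * (1 / lam n ^ 3)) \<le> (\<Sum>k\<in>block_A c n. \<Sum>l\<in>block_B c n. Re (inter c n k l + inter c n l k))"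
      by (intro sum_mono interaction_AB[OF c n])
    also have "\<dots> \<le> (\<Sum>k\<in>block_A c n. \<Sum>l\<in>?F. Re (inter c n k l + inter c n l k))"
      by (intro sum_mono sum_mono2 finite_ucube block_finite[OF assms] inter_nonneg[OF assms])
    also have "\<dots> \<le> (\<Sum>k\<in>?F. \<Sum>l\<in>?F. Re (inter c n k l + inter c n l k))"
      by (intro sum_mono2 finite_ucube block_finite[OF assms] sum_nonneg inter_nonneg[OF assms])
    finally show ?thesis .
  qed
  moreover have "(\<Sum>k\<in>block_A c n. \<Sum>l\<in>block_B c n. 2 / 5 * (1 / lam n ^ 3)) = real (card (block_A c n)) * real (card (block_B c n)) * (2 / 5 * (1 / lam n ^ 3))"
    by simp
  moreover have "(c * lam n) ^ 3 * (c * lam n / 2) ^ 3 * (2 / 5 * (1 / lam n ^ 3)) \<le> real (card (block_A c n)) * real (card (block_B c n)) * (2 / 5 * (1 / lam n ^ 3))"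
    using c lam_pos[of n] by (intro mult_right_mono mult_mono block_card[OF assms]) auto
  moreover have "(c * lam n) ^ 3 * (c * lam n / 2) ^ 3 * (2 / 5 * (1 / lam n ^ 3)) = c ^ 6 * lam n ^ 3 / 20"
    using lam_pos[of n] by (simp add: field_simps power_mult_distrib power_eq_if)
  \<comment> \<open>1/40 is the product of 2/5 from each pair, 1/8 from the smaller B block and 1/2
    from the symmetrisation; \<open>(2 * pi) ^ 3\<close>, at least 216, absorbs it.\<close>
  ultimately have "c ^ 6 * lam n ^ 3 / 40 \<le> (\<Sum>k\<in>?F. \<Sum>l\<in>?F. Re (inter c n k l))" by linarith
  moreover have "(2 * 3) ^ 3 \<le> (2 * pi) ^ 3" using pi_gt3 by (intro power_mono) auto
  moreover have "0 \<le> c ^ 6 * lam n ^ 3 / 40" using c lam_pos[of n] by simp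
  ultimately have "(2 * 3) ^ 3 * (c ^ 6 * lam n ^ 3 / 40) \<le> (2 * pi) ^ 3 * (\<Sum>k\<in>?F. \<Sum>l\<in>?F. Re (inter c n k l))"
    by (intro mult_mono) auto
  moreover have "c ^ 6 * lam n ^ 3 \<le> (2 * 3) ^ 3 * (c ^ 6 * lam n ^ 3 / 40)" using c lam_pos[of n] by simp
  ultimately show ?thesis unfolding eq by linarith
qed

lemma trilinear_sup:
  fixes f g w :: "real^3 \<Rightarrow> complex"
  assumes f: "L2 f" "AE x in torus. norm (f x) \<le> B" "0 \<le> B" and g: "L2 g" and w: "L2 w"
  shows "integrable torus (\<lambda>x. f x * g x * w x)" and "norm (\<integral>x. f x * g x * w x \<partial>torus) \<le> B * l2norm g * l2norm w"
    and "integrable torus (\<lambda>x. g x * f x * w x)" and "norm (\<integral>x. g x * f x * w x \<partial>torus) \<le> B * l2norm g * l2norm w"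
proof -
  note L = L2_mult_bounded[OF L2_measurable[OF f(1)] f(2) g f(3)]
  show 1: "integrable torus (\<lambda>x. f x * g x * w x)" by (rule L2_mult_integrable(1)[OF L(1) w])
  have "norm (\<integral>x. f x * g x * w x \<partial>torus) \<le> l2norm (\<lambda>x. f x * g x) * l2norm w"
    by (rule L2_mult_integrable(2)[OF L(1) w])
  also have "\<dots> \<le> B * l2norm g * l2norm w" by (intro mult_right_mono L(2)) auto
  finally show 2: "norm (\<integral>x. f x * g x * w x \<partial>torus) \<le> B * l2norm g * l2norm w" .
  have eq: "g x * f x * w x = f x * g x * w x" for x by simp
  show "integrable torus (\<lambda>x. g x * f x * w x)" "norm (\<integral>x. g x * f x * w x \<partial>torus) \<le> B * l2norm g * l2norm w"
    unfolding eq by (fact 1, fact 2)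
qed

text \<open>\<open>U\<close> is the block at the current scale, and \<open>l\<close>, \<open>m\<close>, \<open>h\<close> are the low, intermediate and high
  frequencies of \<open>u - U\<close>.  The interaction of \<open>l\<close> with itself does not reach the frequencies of \<open>w\<close>.\<close>

lemma split_trilinear:
  fixes u U z l m h :: "'i \<Rightarrow> real^3 \<Rightarrow> complex" and w :: "real^3 \<Rightarrow> complex"
  assumes u: "\<And>i x. u i x = U i x + z i x + h i x" and z: "\<And>i x. z i x = l i x + m i x"
    and L2: "\<And>i. L2 (U i)" "\<And>i. L2 (z i)" "\<And>i. L2 (l i)" "\<And>i. L2 (m i)" "\<And>i. L2 (h i)" "L2 w"
    and sup: "\<And>i. AE x in torus. norm (U i x) \<le> S" "\<And>i. AE x in torus. norm (z i x) \<le> Z"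
      "\<And>i. AE x in torus. norm (l i x) \<le> Z" "AE x in torus. norm (w x) \<le> W"
    and nn: "0 \<le> S" "0 \<le> Z" "0 \<le> W" "0 \<le> e" "0 \<le> s" "0 \<le> \<mu>"
    and norms: "\<And>i. l2norm (U i) \<le> s" "\<And>i. l2norm (h i) \<le> e" "\<And>i. l2norm (m i) \<le> \<mu>" "l2norm w \<le> V"
    and ll: "(\<integral>x. l i x * l j x * w x \<partial>torus) = 0"
  shows "norm ((\<integral>x. u i x * u j x * w x \<partial>torus) - (\<integral>x. U i x * U j x * w x \<partial>torus))
    \<le> 2 * ((S + Z) * e * V) + W * e * e + 2 * (Z * s * V) + 2 * (Z * \<mu> * V)"
proof -
  let ?v = "\<lambda>i x. U i x + z i x"
  have Lv: "L2 (?v i)" for i by (intro L2_add L2)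
  have vs: "AE x in torus. norm (?v i x) \<le> S + Z" for i
    using sup(1)[of i] sup(2)[of i] by eventually_elim (rule norm_triangle_mono)
  have SZ: "0 \<le> S + Z" using nn by simp
  have V: "0 \<le> V" using norms(4) l2norm_nonneg order_trans by blast
  note Tv = trilinear_sup[OF Lv vs SZ L2(5) L2(6)]
  note Tz = trilinear_sup[OF L2(2) sup(2) nn(2) _ L2(6)]
  note Tl = trilinear_sup[OF L2(3) sup(3) nn(2) _ L2(6)]
  note Th = trilinear_bound[OF L2(5) L2(5) L2_measurable[OF L2(6)] sup(4) nn(3)]
  let ?T1 = "\<lambda>x. ?v i x * h j x * w x" and ?T2 = "\<lambda>x. h i x * ?v j x * w x" and ?T3 = "\<lambda>x. h i x * h j x * w x"
    and ?T4 = "\<lambda>x. U i x * z j x * w x" and ?T5 = "\<lambda>x. z i x * U j x * w x" and ?T6 = "\<lambda>x. z i x * m j x * w x"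
    and ?T7 = "\<lambda>x. m i x * l j x * w x" and ?T8 = "\<lambda>x. l i x * l j x * w x" and ?T0 = "\<lambda>x. U i x * U j x * w x"
  have int: "integrable torus ?T1" "integrable torus ?T2" "integrable torus ?T3" "integrable torus ?T4" "integrable torus ?T5"
    "integrable torus ?T6" "integrable torus ?T7" "integrable torus ?T8" "integrable torus ?T0"
    by (rule Tv Th Tz(3)[OF L2(1)] Tz(1)[OF L2(1)] Tz(1)[OF L2(4)] Tl(3)[OF L2(4)] Tl(1)[OF L2(3)]
       trilinear_sup(1)[OF L2(1) sup(1) nn(1) L2(1) L2(6)])+
  \<comment> \<open>First the high part is split off from both factors; what remains is
    \<open>U + z\<close> times itself. The product of \<open>z\<close> with itself is then written
    as z m + m l + l l, isolating the pair that \<open>w\<close> does not see.\<close>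
  have pt: "u i x * u j x * w x = ?T0 x + (?T1 x + (?T2 x + (?T3 x + (?T4 x + (?T5 x + (?T6 x + (?T7 x + ?T8 x)))))))" for x
    unfolding u z by (simp add: algebra_simps)
  have "(\<integral>x. u i x * u j x * w x \<partial>torus) = (\<integral>x. ?T0 x \<partial>torus) + ((\<integral>x. ?T1 x \<partial>torus) + ((\<integral>x. ?T2 x \<partial>torus) + ((\<integral>x. ?T3 x \<partial>torus) + ((\<integral>x. ?T4 x \<partial>torus)
     + ((\<integral>x. ?T5 x \<partial>torus) + ((\<integral>x. ?T6 x \<partial>torus) + ((\<integral>x. ?T7 x \<partial>torus) + (\<integral>x. ?T8 x \<partial>torus))))))))"
    unfolding pt by (simp only: Bochner_Integration.integral_add Bochner_Integration.integrable_add int)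
  then have eqn: "(\<integral>x. u i x * u j x * w x \<partial>torus) - (\<integral>x. ?T0 x \<partial>torus) = (\<integral>x. ?T1 x \<partial>torus) + ((\<integral>x. ?T2 x \<partial>torus) + ((\<integral>x. ?T3 x \<partial>torus) + ((\<integral>x. ?T4 x \<partial>torus)
     + ((\<integral>x. ?T5 x \<partial>torus) + ((\<integral>x. ?T6 x \<partial>torus) + (\<integral>x. ?T7 x \<partial>torus))))))"
    using ll by simp
  have "norm ((\<integral>x. ?T1 x \<partial>torus) + ((\<integral>x. ?T2 x \<partial>torus) + ((\<integral>x. ?T3 x \<partial>torus) + ((\<integral>x. ?T4 x \<partial>torus)
     + ((\<integral>x. ?T5 x \<partial>torus) + ((\<integral>x. ?T6 x \<partial>torus) + (\<integral>x. ?T7 x \<partial>torus))))))) \<le> (S + Z) * e * V + ((S + Z) * e * V + (W * e * e + (Z * s * V + (Z * s * V + (Z * \<mu> * V + Z * \<mu> * V)))))"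
  proof -
    have b: "B * l2norm f * l2norm w \<le> B * p * V" if "l2norm f \<le> p" "0 \<le> B" "0 \<le> p" for B p and f :: "real^3 \<Rightarrow> complex"
      using that norms(4) by (intro mult_mono mult_left_mono) auto
    have b3: "W * l2norm (h i) * l2norm (h j) \<le> W * e * e"
      using norms(2) nn by (intro mult_mono mult_left_mono) auto
    show ?thesis
      by (intro norm_triangle_le add_mono order_trans[OF Tv(2) b] order_trans[OF Tv(4) b] order_trans[OF Th(2) b3]
          order_trans[OF Tz(4)[OF L2(1)] b] order_trans[OF Tz(2)[OF L2(1)] b] order_trans[OF Tz(2)[OF L2(4)] b] order_trans[OF Tl(4)[OF L2(4)] b]
          norms nn SZ)
  qed
  also have "\<dots> = 2 * ((S + Z) * e * V) + W * e * e + 2 * (Z * s * V) + 2 * (Z * \<mu> * V)" by simp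
  finally show ?thesis unfolding eqn .
qed

section \<open>The estimate at a fixed time\<close>

lemma tpoly_support:
  assumes "finite F" "finite G" "\<And>k. a k \<noteq> 0 \<Longrightarrow> k \<in> F \<and> k \<in> G"
  shows "tpoly F a = tpoly G a"
  unfolding tpoly_def using assms by (intro ext sum.mono_neutral_cong) auto

lemma U_hat_norm_le:
  assumes "0 < c" "c < 1 / 100" "U_hat c n i k \<noteq> 0"
  shows "norm (rvec k) \<le> 4 * lam n"
proof (rule power2_le_imp_le)
  have "(norm (rvec k))\<^sup>2 = (\<Sum>j\<in>UNIV. \<bar>real_of_int (k $ j)\<bar>\<^sup>2)" by (simp add: norm_rvec_sq)
  also have "\<dots> \<le> (\<Sum>j\<in>(UNIV::3 set). (2 * lam n)\<^sup>2)"
    by (intro sum_mono power_mono U_hat_support(1)[OF assms]) auto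
  also have "\<dots> \<le> (4 * lam n)\<^sup>2" by (simp add: power_mult_distrib)
  finally show "(norm (rvec k))\<^sup>2 \<le> (4 * lam n)\<^sup>2" .
qed (use lam_pos[of n] in simp)

lemma sym_D_norm:
  assumes "0 < c" "c < 1 / 100" "k \<in> sym_D c n"
  shows "lam n / 2 < norm (rvec k)"
proof -
  note cl = c_lam_bound[OF assms(1,2), of n]
  have "\<bar>real_of_int (k $ 1) - lam n\<bar> \<le> 2 * (c * lam n) \<or> \<bar>- real_of_int (k $ 1) - lam n\<bar> \<le> 2 * (c * lam n)"
    using assms(3) by (auto simp: sym_D_def box_D_def mem_uminus_image)
  then have "lam n / 2 < \<bar>real_of_int (k $ 1)\<bar>" using cl by linarith
  then show ?thesis using component_le_norm_cart[of "rvec k" 1] by simp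
qed

lemma fc_diff:
  assumes "integrable torus f" "integrable torus g"
  shows "fc (\<lambda>x. f x - g x) k = fc f k - fc g k"
  using assms by (simp add: fc_def right_diff_distrib integrable_fexp_mult diff_divide_distrib)

lemma low_part_split:
  assumes "integrable torus f" "integrable torus g"
  shows "low_part chi m f x = low_part chi m (\<lambda>x. f x - g x) x + low_part chi m g x"
  unfolding low_part_def tpoly_def fc_diff[OF assms] by (simp add: sum.distrib[symmetric] algebra_simps)

lemma L2_low_part: "L2 (low_part chi m f)"
  unfolding low_part_def by (rule L2_tpoly)

lemma low_part_remainder:
  assumes chi: "lp_cutoff chi" and K: "\<And>m k. \<bar>low_symbol chi m k\<bar> \<le> K"
    and v: "L2 v" and g: "grad_sq v < \<infinity>"
  shows "l2norm (\<lambda>x. complex_of_real (v x $ i) - low_part chi m (\<lambda>x. complex_of_real (v x $ i)) x)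
     \<le> sqrt ((2 * pi) ^ 3 * enn2real (grad_sq v)) * (1 + K) / (2 ^ m / 2)"
  unfolding low_part_def
proof (rule multiplier_remainder)
  show "L2 (\<lambda>x. v x $ i)" by (rule L2_component[OF v])
  show "(\<Sum>k\<in>cube N. (norm (rvec k))\<^sup>2 * (norm (fc (\<lambda>x. complex_of_real (v x $ i)) k))\<^sup>2) \<le> enn2real (grad_sq v)" for N
    using grad_sq_bound[OF g] unfolding uhat_def .
  show "norm (1 - complex_of_real (low_symbol chi m k)) \<le> 1 + K" for k
    using norm_triangle_ineq4[of 1 "complex_of_real (low_symbol chi m k)"] K[of m k] by simp
  show "complex_of_real (low_symbol chi m k) = 1" if "norm (rvec k) \<le> 2 ^ m / 2" for k
    using low_symbol_low[OF chi that] by simp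
  show "complex_of_real (low_symbol chi m k) = 0" if "k \<notin> cube (2 ^ m)" for k
    using low_symbol_cube[OF chi] that by auto
qed auto

lemma complex_transport:
  assumes c: "0 < c" "c < 1 / 100" and n: "0 < n"
  shows "complex_of_real (transport (box_D c n) (dvec n) v) =
    (\<Sum>i\<in>UNIV. \<Sum>j\<in>UNIV. \<integral>x. complex_of_real (v x $ i) * complex_of_real (v x $ j) * tpoly (sym_D c n) (DV_hat n i j) x \<partial>torus)"
  unfolding transport_def of_real_sum
  by (simp only: of_real_mult[symmetric] integral_complex_of_real[symmetric] test_fields(1)[OF assms, symmetric])

text \<open>Two frequencies below \<open>lam n / 4\<close> cannot add up to one above
  \<open>lam n / 2\<close>, and all frequencies of the test field are above it.\<close>

lemma low_part_orthogonal:
  assumes chi: "lp_cutoff chi" and c: "0 < c" "c < 1 / 100" and m: "2 ^ m \<le> lam n / 4" and n: "0 < n"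
  shows "(\<integral>x. low_part chi m f x * low_part chi m g x * tpoly (sym_D c n) w x \<partial>torus) = 0"
    and "(\<integral>x. low_part chi m f x * tpoly (sym_D c n) w x \<partial>torus) = 0"
proof -
  have fin: "finite (sym_D c n)" using box_D_props(3)[OF c n] finite_ucube by (rule finite_subset)
  have 1: "low_symbol chi m k = 0 \<or> low_symbol chi m l = 0" if "- (k + l) \<in> sym_D c n" for k l
  proof (rule ccontr)
    assume "\<not> ?thesis"
    then have "norm (rvec k) < 2 ^ m" "norm (rvec l) < 2 ^ m" using low_symbol_high[OF chi] by (meson not_less)+
    moreover have "lam n / 2 < norm (rvec k) + norm (rvec l)"
      using sym_D_norm[OF c that] norm_triangle_ineq[of "rvec k" "rvec l"] by (simp only: rvec_minus rvec_add norm_minus_cancel)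
    ultimately show False using m by linarith
  qed
  show "(\<integral>x. low_part chi m f x * low_part chi m g x * tpoly (sym_D c n) w x \<partial>torus) = 0"
    unfolding low_part_def integral_tpoly3[OF finite_cube finite_cube fin]
    using 1 by (intro mult_eq_0_iff[THEN iffD2] disjI2 sum.neutral ballI) auto
  have 2: "low_symbol chi m k = 0" if "- k \<in> sym_D c n" for k
    using 1[of k 0] 1[of k k] that sym_D_norm[OF c that] low_symbol_high[OF chi, of m k] m lam_pos[of n]
    by (simp add: rvec_minus)
  show "(\<integral>x. low_part chi m f x * tpoly (sym_D c n) w x \<partial>torus) = 0"
    unfolding low_part_def integral_tpoly_mult[OF L2_tpoly] fc_tpoly[OF fin]
  proof (rule mult_eq_0_iff[THEN iffD2], rule disjI2, rule sum.neutral, rule ballI)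
    fix k
    show "complex_of_real (low_symbol chi m k) * fc f k * (if - k \<in> sym_D c n then w (- k) else 0) = 0"
      by (cases "- k \<in> sym_D c n") (simp_all add: 2)
  qed
qed

text \<open>The left-hand side is the bound of \<open>split_trilinear\<close> for the sizes in \<open>core_estimate\<close>, where
  \<open>r\<^sup>2 = \<lambda>\<close>.\<close>

lemma error_arith:
  fixes r g \<delta> Z :: real
  assumes r: "1 \<le> r" and g: "0 \<le> g" and \<delta>: "0 \<le> \<delta>" "\<delta> \<le> 1" and Z: "Z = 16 * r\<^sup>2 * \<delta> + 3000 * r"
  shows "2 * ((1500 * r\<^sup>2 + Z) * (g / r\<^sup>2) * (364 * (r\<^sup>2 * r\<^sup>2 * r))) + 250 * (r\<^sup>2) ^ 4 * (g / r\<^sup>2) * (g / r\<^sup>2)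
      + 2 * (Z * (2200 / r) * (364 * (r\<^sup>2 * r\<^sup>2 * r))) + 2 * (Z * (9 * g / r\<^sup>2 + 2200 / r) * (364 * (r\<^sup>2 * r\<^sup>2 * r)))
     \<le> 51251200 * \<delta> * r ^ 6 + 10 ^ 10 * r ^ 5 * (1 + g + g\<^sup>2)"
proof -
  have r0: "0 < r" using r by linarith
  have p: "r \<le> r\<^sup>2" "r ^ 4 \<le> r ^ 5" using r by (auto simp: power2_eq_square intro!: power_increasing)
  have "r\<^sup>2 * \<delta> \<le> r\<^sup>2" using \<delta> by (simp add: mult_left_le)
  then have Zle: "Z \<le> 3016 * r\<^sup>2" using p unfolding Z by linarith
  \<comment> \<open>The coefficient 3203200 = 4 * 2200 * 364 collects the terms pairing
    \<open>Z\<close> with \<open>2200 / r\<close>, and 51251200 is 16 times it. Only there does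
    \<open>Z\<close> meet \<open>r ^ 4\<close>, so this is where \<delta> survives at order
    \<open>r ^ 6\<close>; elsewhere \<open>Z\<close> meets \<open>g * r ^ 3\<close>.\<close>
  have eq: "2 * ((1500 * r\<^sup>2 + Z) * (g / r\<^sup>2) * (364 * (r\<^sup>2 * r\<^sup>2 * r))) + 250 * (r\<^sup>2) ^ 4 * (g / r\<^sup>2) * (g / r\<^sup>2)
      + 2 * (Z * (2200 / r) * (364 * (r\<^sup>2 * r\<^sup>2 * r))) + 2 * (Z * (9 * g / r\<^sup>2 + 2200 / r) * (364 * (r\<^sup>2 * r\<^sup>2 * r)))
     = 728 * (1500 * r\<^sup>2 + Z) * g * r ^ 3 + 250 * g\<^sup>2 * r ^ 4 + 3203200 * Z * r ^ 4 + 6552 * Z * g * r ^ 3"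
    using r0 by (simp add: field_simps power_eq_if)
  have 1: "(1500 * r\<^sup>2 + Z) * (g * r ^ 3) \<le> (4516 * r\<^sup>2) * (g * r ^ 3)" using Zle g r0 by (intro mult_right_mono) auto
  have 2: "Z * (g * r ^ 3) \<le> (3016 * r\<^sup>2) * (g * r ^ 3)" using Zle g r0 by (intro mult_right_mono) auto
  have 3: "g\<^sup>2 * r ^ 4 \<le> g\<^sup>2 * r ^ 5" using p(2) by (intro mult_left_mono) auto
  have 4: "Z * r ^ 4 = 16 * \<delta> * r ^ 6 + 3000 * r ^ 5" unfolding Z by (simp add: algebra_simps power_eq_if)
  have 5: "r\<^sup>2 * (g * r ^ 3) = g * r ^ 5" by (simp add: power_eq_if)
  have 6: "0 \<le> g * r ^ 5" "0 \<le> r ^ 5" "0 \<le> g\<^sup>2 * r ^ 5" using g r0 by auto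
  have 7: "10 ^ 10 * r ^ 5 * (1 + g + g\<^sup>2) = 10 ^ 10 * r ^ 5 + 10 ^ 10 * (g * r ^ 5) + 10 ^ 10 * (g\<^sup>2 * r ^ 5)"
    by (simp add: algebra_simps)
  have f1: "728 * (1500 * r\<^sup>2 + Z) * g * r ^ 3 \<le> 3287648 * (g * r ^ 5)"
  proof -
    have "728 * (1500 * r\<^sup>2 + Z) * g * r ^ 3 = 728 * ((1500 * r\<^sup>2 + Z) * (g * r ^ 3))" by simp
    moreover have "(4516 * r\<^sup>2) * (g * r ^ 3) = 4516 * (g * r ^ 5)" using 5 by simp
    ultimately show ?thesis using 1 by linarith
  qed
  have f2: "6552 * Z * g * r ^ 3 \<le> 19760832 * (g * r ^ 5)"
  proof -
    have "6552 * Z * g * r ^ 3 = 6552 * (Z * (g * r ^ 3))" by simp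
    moreover have "(3016 * r\<^sup>2) * (g * r ^ 3) = 3016 * (g * r ^ 5)" using 5 by simp
    ultimately show ?thesis using 2 by linarith
  qed
  have f4: "3203200 * Z * r ^ 4 = 51251200 * \<delta> * r ^ 6 + 9609600000 * r ^ 5" using 4 by simp
  have f3: "250 * g\<^sup>2 * r ^ 4 \<le> 250 * (g\<^sup>2 * r ^ 5)" using 3 by simp
  have "A + B + (X + 9609600000 * y) + C \<le> X + (10 ^ 10 * y + 10 ^ 10 * p + 10 ^ 10 * s)"
    if "A \<le> 3287648 * p" "C \<le> 19760832 * p" "B \<le> 250 * s" "0 \<le> p" "0 \<le> y" "0 \<le> s" for A B C X y p s :: real
    using that by simp
  from this[OF f1 f2 f3 6] show ?thesis unfolding eq 7 f4 .
qed

context lacunary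
begin

text \<open>Blocks up to \<open>J\<close> lie below frequency \<open>2 ^ m / 2\<close>, where the
  symbol is 1; later blocks start at or above \<open>2 ^ m\<close>, where it is 0.\<close>

lemma low_part_U:
  assumes chi: "lp_cutoff chi" and m: "2 ^ m \<le> lam (q (Suc J)) / 4" "8 * lam (q J) \<le> 2 ^ m"
  shows "low_part chi m (\<lambda>x. complex_of_real (U_field c q x $ i)) x = (\<Sum>j\<le>J. U_block c (q j) i x)"
proof -
  have le: "norm (rvec k) \<le> 2 ^ m / 2" if "j \<le> J" "U_hat c (q j) i k \<noteq> 0" for j k
    using U_hat_norm_le[OF c that(2)] lam_q_mono[OF that(1)] m(2) by linarith
  have coeff: "complex_of_real (low_symbol chi m k) * fc (\<lambda>x. complex_of_real (U_field c q x $ i)) k = (\<Sum>j\<le>J. U_hat c (q j) i k)" for k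
  proof (cases "\<exists>j\<le>J. U_hat c (q j) i k \<noteq> 0")
    case True
    then have k: "norm (rvec k) \<le> 2 ^ m / 2" using le by blast
    moreover have "(0::real) < 2 ^ m" by simp
    ultimately have "norm (rvec k) < lam (q (Suc J)) / 4" using m(1) by linarith
    then show ?thesis using low_symbol_low[OF chi k] by (simp add: U_field_fc_low)
  next
    case False
    then have 0: "(\<Sum>j\<le>J. U_hat c (q j) i k) = 0" by (intro sum.neutral) auto
    show ?thesis
    proof (cases "2 ^ m \<le> norm (rvec k)")
      case True
      then show ?thesis using low_symbol_high[OF chi True] 0 by simp
    next
      case False
      then have "norm (rvec k) < lam (q (Suc J)) / 4" using m(1) by linarith
      then show ?thesis by (simp add: U_field_fc_low 0)
    qed
  qed
  have "low_part chi m (\<lambda>x. complex_of_real (U_field c q x $ i)) x = (\<Sum>j\<le>J. tpoly (cube (2 ^ m)) (U_hat c (q j) i) x)"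
    unfolding low_part_def coeff tpoly_def sum_distrib_right by (rule sum.swap)
  also have "\<dots> = (\<Sum>j\<le>J. U_block c (q j) i x)"
  proof (intro sum.cong refl)
    fix j assume "j \<in> {..J}"
    then have "k \<in> cube (2 ^ m)" if "U_hat c (q j) i k \<noteq> 0" for k
      using le[of j k] that low_symbol_low[OF chi, of k m] low_symbol_cube[OF chi, of m k] by simp
    then have "tpoly (cube (2 ^ m)) (U_hat c (q j) i) = tpoly (ucube (q j)) (U_hat c (q j) i)"
      using U_hat_cube[OF c q0] by (intro tpoly_support) auto
    then show "tpoly (cube (2 ^ m)) (U_hat c (q j) i) x = U_block c (q j) i x" by (simp add: U_block_def)
  qed
  finally show ?thesis .
qed

lemma sum_U_block_bound: "norm (\<Sum>j\<le>J. U_block c (q j) i x) \<le> 3000 * lam (q J)"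
proof -
  have "norm (\<Sum>j\<le>J. U_block c (q j) i x) \<le> (\<Sum>j\<le>J. 1500 * lam (q j))"
    by (intro sum_norm_le U_block_bounds(1) q0)
  also have "\<dots> = 1500 * (\<Sum>j\<le>J. lam (q j))" by (simp add: sum_distrib_left)
  also have "\<dots> \<le> 3000 * lam (q J)" using sum_lam_q[of J] by simp
  finally show ?thesis .
qed

text \<open>In powers of \<open>r\<close>, the block has supremum of order \<open>r\<^sup>2\<close>
  and L2 norm of order \<open>1 / r\<close>, the high part has L2 norm at most
  \<open>g / r\<^sup>2\<close>, and the test gradient has L2 norm of order \<open>r ^ 5\<close>.
  Inserted into \<open>split_trilinear\<close>, these leave an error of order \<open>r ^ 6\<close>
  only with a factor \<delta>.\<close>

lemma core_estimate:
  assumes chi: "lp_cutoff chi" and K: "1 \<le> K" "\<And>m k. \<bar>low_symbol chi m k\<bar> \<le> K"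
    and v: "L2 v" and fin: "grad_sq v < \<infinity>" and \<delta>: "0 \<le> \<delta>" "\<delta> \<le> 1"
    and b: "besov_norm chi (\<lambda>x. v x - U_field c q x) \<le> ennreal \<delta>" and J: "4 \<le> J"
  defines "n \<equiv> q (Suc J)" and "g \<equiv> sqrt ((2 * pi) ^ 3 * enn2real (grad_sq v)) * (1 + K)"
  defines "r \<equiv> sqrt (lam n)"
  shows "c ^ 6 * r ^ 6 - 9 * (51251200 * \<delta> * r ^ 6 + 10 ^ 10 * r ^ 5 * (1 + g + g\<^sup>2)) \<le> transport (box_D c n) (dvec n) v"
    and "\<bar>\<integral>x. v x \<bullet> test_LV (box_D c n) (dvec n) x \<partial>torus\<bar> \<le> 52416 * g * r ^ 5"
proof -
  have n: "0 < n" unfolding n_def by (rule q0)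
  have lam: "lam n = r\<^sup>2" using lam_pos[of n] by (simp add: r_def)
  \<comment> \<open>\<open>4 \<le> J\<close> makes \<open>lam (q J)\<close> at least 32. With
    \<open>gap\<close> this gives the ratios 32 and 64 between neighbouring scales that
    \<open>low_part_U\<close> requires for \<open>ml\<close> and \<open>mh\<close>.\<close>
  have J1: "(32::real) \<le> 2 ^ (J + 1)" using power_increasing[of 5 "J + 1" "2::real"] J by simp
  then have lJ: "32 \<le> lam (q J)" using lam_q_ge[of J] by linarith
  have gapJ: "(lam (q J))\<^sup>2 < lam n" unfolding n_def by (rule gap)
  \<comment> \<open>Here the square in the lacunarity condition enters: all earlier blocks together
    are of order \<open>r\<close>, a full factor \<open>r\<close> below the current block.\<close>
  have lJr: "lam (q J) \<le> r" unfolding r_def using gapJ by (intro real_le_rsqrt) simp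
  have r1: "1 \<le> r" using lJ lJr by linarith
  have lo: "32 * lam (q J) \<le> lam n"
  proof -
    have "32 * lam (q J) \<le> (lam (q J))\<^sup>2" unfolding power2_eq_square using lJ by (intro mult_right_mono) auto
    then show ?thesis using gapJ by linarith
  qed
  have hi: "64 * lam n \<le> lam (q (Suc (Suc J)))"
  proof -
    have "64 * lam n \<le> (lam n)\<^sup>2" unfolding power2_eq_square using lo lJ lam_pos[of n] by (intro mult_right_mono) auto
    then show ?thesis using gap[of "Suc J"] by (simp add: n_def)
  qed
  define mh ml where "mh = nat n + 4" and "ml = nat n - 2"
    \<comment> \<open>The truncation \<open>low_part chi mh\<close> is exact up to frequency \<open>8\<lambda>\<close>, hence on the current and all earlier blocks,
      and vanishes on all later ones; \<open>low_part chi ml\<close> keeps the earlier blocks and removes the current one.\<close>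
  have mh: "2 ^ mh = 16 * lam n" using n by (simp add: mh_def lam_nat power_add)
  have ml: "2 ^ ml = lam n / 4"
  proof -
    \<comment> \<open>This excludes truncation in the natural-number subtraction that defines
      \<open>ml\<close>.\<close>
    have "2 \<le> nat n" using q_ge[of "Suc J"] J unfolding n_def by simp
    then have "(2::real) ^ nat n = 2 ^ (nat n - 2) * 2 ^ 2" by (metis le_add_diff_inverse2 power_add)
    then show ?thesis using n by (simp add: ml_def lam_nat)
  qed
  define V1 where "V1 = (\<lambda>i x. complex_of_real (v x $ i))"
  define U1 where "U1 = (\<lambda>i x. complex_of_real (U_field c q x $ i))"
  define Ub where "Ub = (\<lambda>i. U_block c n i)"
  define vh where "vh = (\<lambda>i. low_part chi mh (V1 i))"
  define l where "l = (\<lambda>i. low_part chi ml (V1 i))"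
  define h where "h = (\<lambda>i x. V1 i x - vh i x)"
  define z where "z = (\<lambda>i x. vh i x - Ub i x)"
  define m where "m = (\<lambda>i x. z i x - l i x)"
  define Z where "Z = 16 * r\<^sup>2 * \<delta> + 3000 * r"
  have LV1: "L2 (V1 i)" for i unfolding V1_def by (intro L2_of_real L2_component v)
  have iV: "integrable torus (V1 i)" for i by (rule L2_integrable[OF LV1])
  have iU: "integrable torus (U1 i)" for i unfolding U1_def by (rule U_field_integrable)
  have LU: "L2 (Ub i)" for i unfolding Ub_def by (rule U_block_bounds(3)[OF n])
  have Lvh: "L2 (vh i)" "L2 (l i)" for i unfolding vh_def l_def by (rule L2_low_part)+
  have Lh: "L2 (h i)" for i unfolding h_def by (intro L2_diff LV1 Lvh)
  have Lz: "L2 (z i)" for i unfolding z_def by (intro L2_diff LU Lvh)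
  have Lm: "L2 (m i)" for i unfolding m_def by (intro L2_diff Lz Lvh)
  have W1: "complex_of_real ((v x - U_field c q x) $ i) = V1 i x - U1 i x" for i x by (simp add: V1_def U1_def)
  have bes: "AE x in torus. \<forall>i. norm (low_part chi m (\<lambda>x. V1 i x - U1 i x) x) \<le> 2 ^ m * \<delta>" for m
    using besov_low_part[OF chi _ b \<delta>(1), of m] iV iU unfolding W1 by simp
  have lowU: "norm (\<Sum>j\<le>J. U_block c (q j) i x) \<le> 3000 * r" for i x
    using sum_U_block_bound[where J=J and i=i and x=x] lJr by linarith
  have zeq: "z i x = low_part chi mh (\<lambda>x. V1 i x - U1 i x) x + (\<Sum>j\<le>J. U_block c (q j) i x)" for i x
  proof -
    have "low_part chi mh (U1 i) x = (\<Sum>j\<le>Suc J. U_block c (q j) i x)"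
      unfolding U1_def by (rule low_part_U[OF chi]) (use hi lam_pos[of n] in \<open>simp_all add: mh n_def\<close>)
    then show ?thesis unfolding z_def vh_def Ub_def
      using low_part_split[OF iV[of i] iU[of i], of chi mh x] by (simp add: n_def)
  qed
  have leq: "l i x = low_part chi ml (\<lambda>x. V1 i x - U1 i x) x + (\<Sum>j\<le>J. U_block c (q j) i x)" for i x
  proof -
    have "low_part chi ml (U1 i) x = (\<Sum>j\<le>J. U_block c (q j) i x)"
      unfolding U1_def by (rule low_part_U[OF chi]) (use lo in \<open>simp_all add: ml n_def\<close>)
    then show ?thesis unfolding l_def using low_part_split[OF iV[of i] iU[of i], of chi ml x] by simp
  qed
  have zsup: "AE x in torus. norm (z i x) \<le> Z" for i
    using bes[of mh]
  proof eventually_elim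
    case (elim x)
    have "norm (z i x) \<le> 2 ^ mh * \<delta> + 3000 * r" unfolding zeq using elim lowU by (intro norm_triangle_mono) auto
    then show ?case by (simp add: Z_def mh lam mult_ac)
  qed
  have lsup: "AE x in torus. norm (l i x) \<le> Z" for i
    using bes[of ml]
  proof eventually_elim
    case (elim x)
    have "norm (l i x) \<le> 2 ^ ml * \<delta> + 3000 * r" unfolding leq using elim lowU by (intro norm_triangle_mono) auto
    moreover have "r\<^sup>2 / 4 * \<delta> \<le> 16 * r\<^sup>2 * \<delta>" using \<delta> by (intro mult_right_mono) auto
    ultimately show ?case unfolding Z_def ml lam by linarith
  qed
  have g0: "0 \<le> g" unfolding g_def using K by (intro mult_nonneg_nonneg) auto
  have hn: "l2norm (h i) \<le> g / r\<^sup>2" for i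
  proof -
    have "l2norm (h i) \<le> g / (2 ^ mh / 2)"
      using low_part_remainder[OF chi K(2) v fin, of i mh] unfolding h_def vh_def V1_def g_def by simp
    also have "\<dots> \<le> g / r\<^sup>2" unfolding mh lam using g0 r1 by (intro divide_left_mono) auto
    finally show ?thesis .
  qed
  have un: "l2norm (\<lambda>x. V1 i x - l i x) \<le> 8 * g / r\<^sup>2" for i
  proof -
    have "l2norm (\<lambda>x. V1 i x - l i x) \<le> g / (2 ^ ml / 2)"
      using low_part_remainder[OF chi K(2) v fin, of i ml] unfolding l_def V1_def g_def by simp
    also have "\<dots> = 8 * g / r\<^sup>2" unfolding ml lam by simp
    finally show ?thesis .
  qed
  have Un: "l2norm (Ub i) \<le> 2200 / r" for i
  proof -
    have "lam n powr (- 1 / 2) = 1 / r"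
      using lam_pos[of n] by (simp add: r_def powr_half_sqrt powr_minus_divide)
    then show ?thesis using U_block_bounds(2)[OF n, of c i] by (simp add: Ub_def)
  qed
  have mn: "l2norm (m i) \<le> 9 * g / r\<^sup>2 + 2200 / r" for i
  proof -
    \<comment> \<open>The intermediate part is the non-low part of \<open>v\<close> without its high
      part and without the block; each of the three already has a small L2 norm.\<close>
    have eq: "m i = (\<lambda>x. ((V1 i x - l i x) - h i x) - Ub i x)" by (auto simp: m_def z_def h_def)
    have "l2norm (m i) \<le> (l2norm (\<lambda>x. V1 i x - l i x) + l2norm (h i)) + l2norm (Ub i)"
      unfolding eq by (intro order_trans[OF L2_diff(2)] add_mono L2_diff LV1 Lvh Lh LU order_refl)
    also have "\<dots> \<le> (8 * g / r\<^sup>2 + g / r\<^sup>2) + 2200 / r" by (intro add_mono un hn Un)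
    finally show ?thesis by (simp add: add_divide_distrib[symmetric])
  qed
  note tf = test_field_bounds[OF c n]
  have "norm ((\<integral>x. V1 i x * V1 j x * tpoly (sym_D c n) (DV_hat n i j) x \<partial>torus) - (\<integral>x. Ub i x * Ub j x * tpoly (sym_D c n) (DV_hat n i j) x \<partial>torus))
    \<le> 51251200 * \<delta> * r ^ 6 + 10 ^ 10 * r ^ 5 * (1 + g + g\<^sup>2)" for i j
  proof -
    have "norm ((\<integral>x. V1 i x * V1 j x * tpoly (sym_D c n) (DV_hat n i j) x \<partial>torus) - (\<integral>x. Ub i x * Ub j x * tpoly (sym_D c n) (DV_hat n i j) x \<partial>torus))
      \<le> 2 * ((1500 * r\<^sup>2 + Z) * (g / r\<^sup>2) * (364 * (r\<^sup>2 * r\<^sup>2 * r))) + 250 * (r\<^sup>2) ^ 4 * (g / r\<^sup>2) * (g / r\<^sup>2)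
      + 2 * (Z * (2200 / r) * (364 * (r\<^sup>2 * r\<^sup>2 * r))) + 2 * (Z * (9 * g / r\<^sup>2 + 2200 / r) * (364 * (r\<^sup>2 * r\<^sup>2 * r)))"
    proof (rule split_trilinear[where z=z and l=l and m=m and h=h])
      show "V1 i x = Ub i x + z i x + h i x" for i x by (simp add: z_def h_def)
      show "z i x = l i x + m i x" for i x by (simp add: m_def)
      show "AE x in torus. norm (Ub i x) \<le> 1500 * r\<^sup>2" for i
        using U_block_bounds(1)[OF n] by (simp add: Ub_def lam[symmetric])
      show "AE x in torus. norm (tpoly (sym_D c n) (DV_hat n i j) x) \<le> 250 * (r\<^sup>2) ^ 4"
        using tf(1)[of i j] by (simp add: lam)
      show "l2norm (tpoly (sym_D c n) (DV_hat n i j)) \<le> 364 * (r\<^sup>2 * r\<^sup>2 * r)"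
        using tf(2)[of i j] r1 by (simp add: lam power2_eq_square)
      show "(\<integral>x. l i x * l j x * tpoly (sym_D c n) (DV_hat n i j) x \<partial>torus) = 0"
        unfolding l_def by (rule low_part_orthogonal(1)[OF chi c _ n]) (simp add: ml)
    qed (use zsup lsup LU Lz Lvh Lm Lh L2_tpoly Un hn mn g0 r1 \<delta> in \<open>auto simp: Z_def\<close>)
    also have "\<dots> \<le> 51251200 * \<delta> * r ^ 6 + 10 ^ 10 * r ^ 5 * (1 + g + g\<^sup>2)"
      by (rule error_arith[OF r1 g0 \<delta> Z_def])
    finally show ?thesis .
  qed
  note err = this
  let ?I = "\<lambda>i j. (\<integral>x. V1 i x * V1 j x * tpoly (sym_D c n) (DV_hat n i j) x \<partial>torus)"
  let ?M = "\<lambda>i j. (\<integral>x. Ub i x * Ub j x * tpoly (sym_D c n) (DV_hat n i j) x \<partial>torus)"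
  let ?E = "51251200 * \<delta> * r ^ 6 + 10 ^ 10 * r ^ 5 * (1 + g + g\<^sup>2)"
  have "norm ((\<Sum>i\<in>UNIV. \<Sum>j\<in>UNIV. ?I i j) - (\<Sum>i\<in>UNIV. \<Sum>j\<in>UNIV. ?M i j)) \<le> (\<Sum>i\<in>(UNIV::3 set). \<Sum>j\<in>(UNIV::3 set). ?E)"
    unfolding sum_subtractf[symmetric] by (intro sum_norm_le err)
  moreover have "(\<Sum>i\<in>(UNIV::3 set). \<Sum>j\<in>(UNIV::3 set). ?E) = 9 * ?E" by simp
  moreover have "(\<Sum>i\<in>UNIV. \<Sum>j\<in>UNIV. ?I i j) = complex_of_real (transport (box_D c n) (dvec n) v)"
    unfolding complex_transport[OF c n] V1_def ..
  ultimately have "norm (complex_of_real (transport (box_D c n) (dvec n) v) - (\<Sum>i\<in>UNIV. \<Sum>j\<in>UNIV. ?M i j)) \<le> 9 * ?E" by simp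
  then have "\<bar>transport (box_D c n) (dvec n) v - Re (\<Sum>i\<in>UNIV. \<Sum>j\<in>UNIV. ?M i j)\<bar> \<le> 9 * ?E"
    using abs_Re_le_cmod[of "complex_of_real (transport (box_D c n) (dvec n) v) - (\<Sum>i\<in>UNIV. \<Sum>j\<in>UNIV. ?M i j)"] by simp
  moreover have "c ^ 6 * r ^ 6 \<le> Re (\<Sum>i\<in>UNIV. \<Sum>j\<in>UNIV. ?M i j)"
    using main_term[OF c n] unfolding Ub_def lam by (simp add: power_mult[symmetric])
  ultimately show "c ^ 6 * r ^ 6 - 9 * ?E \<le> transport (box_D c n) (dvec n) v" by linarith
  define LV where "LV = (\<lambda>i x. complex_of_real (test_LV (box_D c n) (dvec n) x $ i))"
  have LLV: "L2 (LV i)" for i unfolding LV_def by (intro L2_of_real L2_component L2_continuous continuous_test)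
  have LVn: "l2norm (LV i) \<le> 2184 * ((r\<^sup>2) ^ 3 * r)" for i
    unfolding LV_def l2norm_of_real using tf(4)[of i] r1 by (simp add: lam)
  have vis: "norm (\<integral>x. V1 i x * LV i x \<partial>torus) \<le> 17472 * g * r ^ 5" for i
  proof -
    \<comment> \<open>The Laplacian of the test field has L2 norm of order \<open>r ^ 7\<close>.
      Replacing \<open>v\<close> by its non-low part, which does not change the integral, gains
      \<open>g / r\<^sup>2\<close> and leaves \<open>r ^ 5\<close>.\<close>
    have "(\<integral>x. l i x * LV i x \<partial>torus) = 0"
      unfolding l_def LV_def test_fields(3)[OF c n] by (rule low_part_orthogonal(2)[OF chi c _ n]) (simp add: ml)
    moreover have "(\<integral>x. (V1 i x - l i x) * LV i x \<partial>torus) = (\<integral>x. V1 i x * LV i x \<partial>torus) - (\<integral>x. l i x * LV i x \<partial>torus)"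
      unfolding left_diff_distrib by (intro Bochner_Integration.integral_diff L2_mult_integrable LV1 LLV Lvh)
    ultimately have "norm (\<integral>x. V1 i x * LV i x \<partial>torus) \<le> l2norm (\<lambda>x. V1 i x - l i x) * l2norm (LV i)"
      using L2_mult_integrable(2)[OF L2_diff(1)[OF LV1[of i] Lvh(2)[of i]] LLV[of i]] by simp
    also have "\<dots> \<le> (8 * g / r\<^sup>2) * (2184 * ((r\<^sup>2) ^ 3 * r))"
      by (intro mult_mono un LVn) (use g0 in auto)
    also have "\<dots> = 17472 * g * r ^ 5" using r1 by (simp add: field_simps power_eq_if)
    finally show ?thesis .
  qed
  have "complex_of_real (\<integral>x. v x \<bullet> test_LV (box_D c n) (dvec n) x \<partial>torus) = (\<Sum>i\<in>UNIV. \<integral>x. V1 i x * LV i x \<partial>torus)"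
  proof -
    have "complex_of_real (\<integral>x. v x \<bullet> test_LV (box_D c n) (dvec n) x \<partial>torus) = (\<integral>x. (\<Sum>i\<in>UNIV. V1 i x * LV i x) \<partial>torus)"
      unfolding integral_complex_of_real[symmetric] by (simp add: inner_vec_def V1_def LV_def)
    also have "\<dots> = (\<Sum>i\<in>UNIV. \<integral>x. V1 i x * LV i x \<partial>torus)"
      by (intro Bochner_Integration.integral_sum L2_mult_integrable LV1 LLV)
    finally show ?thesis .
  qed
  then have "\<bar>\<integral>x. v x \<bullet> test_LV (box_D c n) (dvec n) x \<partial>torus\<bar> = norm (\<Sum>i\<in>UNIV. \<integral>x. V1 i x * LV i x \<partial>torus)"
    by (metis norm_of_real real_norm_def)
  also have "\<dots> \<le> (\<Sum>i\<in>(UNIV::3 set). 17472 * g * r ^ 5)" by (intro sum_norm_le vis)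
  also have "\<dots> = 52416 * g * r ^ 5" by simp
  finally show "\<bar>\<integral>x. v x \<bullet> test_LV (box_D c n) (dvec n) x \<partial>torus\<bar> \<le> 52416 * g * r ^ 5" .
qed

end

section \<open>Conclusion\<close>

lemma test_V_l2norm:
  assumes c: "0 < c" "c < 1 / 100" and n: "0 < n"
  shows "l2norm (test_V (box_D c n) (dvec n)) \<le> 546 * (lam n * sqrt (lam n))"
proof (rule power2_le_imp_le)
  have "(l2norm (test_V (box_D c n) (dvec n)))\<^sup>2 = (\<Sum>i\<in>UNIV. (l2norm (\<lambda>x. test_V (box_D c n) (dvec n) x $ i))\<^sup>2)"
    by (intro l2norm_sq_vec L2_continuous continuous_test)
  also have "\<dots> \<le> (\<Sum>i\<in>(UNIV::3 set). (182 * (lam n * sqrt (lam n)))\<^sup>2)"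
    by (intro sum_mono power_mono test_field_bounds(3)[OF assms]) auto
  also have "\<dots> \<le> (546 * (lam n * sqrt (lam n)))\<^sup>2" by (simp add: power_mult_distrib)
  finally show "(l2norm (test_V (box_D c n) (dvec n)))\<^sup>2 \<le> (546 * (lam n * sqrt (lam n)))\<^sup>2" .
qed (use lam_pos[of n] in simp)

context lacunary
begin

text \<open>The denominator is \<open>18 \<cdot> 51251200\<close>, with the constant of \<open>error_arith\<close>: the nine pairs of components then
  absorb at most half of the main term.\<close>

definition delta0 :: real where
  "delta0 = c ^ 6 / 922521600"

lemma delta0: "0 < delta0" "delta0 \<le> 1"
proof -
  show "0 < delta0" using c by (simp add: delta0_def)
  have "c ^ 6 \<le> 1" using c by (intro power_le_one) auto
  then show "delta0 \<le> 1" by (simp add: delta0_def)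
qed

text \<open>The constant \<open>18 * 10 ^ 10\<close> is 9 * 2 * 10^10: nine pairs of components, and
  a factor 2 from absorbing \<open>g\<close> into \<open>1 + g\<^sup>2\<close>. The factor
  \<open>(2 * pi) ^ 3 * (1 + K)\<^sup>2\<close> translates \<open>g\<^sup>2\<close> into
  \<open>grad_sq\<close>; 52416 and 546 belong to the viscous and the time-derivative term.\<close>

lemma fixed_scale_bound:
  assumes chi: "lp_cutoff chi" and sol: "ns_weak_solution \<nu> T (U_field c q) u" and \<nu>: "0 < \<nu>"
    and K: "1 \<le> K" "\<And>m k. \<bar>low_symbol chi m k\<bar> \<le> K"
    and ab: "0 < a" "a < b" "b < T" and J: "4 \<le> J"
    and bes: "\<And>t. t \<in> {a..b} \<Longrightarrow> besov_norm chi (\<lambda>x. u t x - U_field c q x) \<le> ennreal delta0"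
    and E: "\<And>t. bump a b 0 0 t \<le> E" "\<And>t. \<bar>bump' a b 0 0 t\<bar> \<le> E"
  defines "r \<equiv> sqrt (lam (q (Suc J)))"
  shows "c ^ 6 / 2 * r ^ 6 * (\<integral>t. bump a b 0 0 t \<partial>time_measure T) \<le>
    E * ((18 * 10 ^ 10 + 52416 * \<nu>) * (1 + (2 * pi) ^ 3 * (1 + K)\<^sup>2) * r ^ 5 + 546 * r ^ 5)
      * (\<integral>t. 1 + (l2norm (u t))\<^sup>2 + enn2real (grad_sq (u t)) \<partial>time_measure T)"
proof -
  define n where "n = q (Suc J)"
  have n: "0 < n" unfolding n_def by (rule q0)
  have r: "r = sqrt (lam n)" by (simp add: r_def n_def)
  have r1: "1 \<le> r" using lam_ge_2[OF n] unfolding r by simp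
  have wc: "weakly_continuous T u" and h1: "L2_H1 T u" and ns: "ns_distributional \<nu> T u"
    using sol by (auto simp: ns_weak_solution_def)
  have L: "L2 (u t)" if "t \<in> {a..b}" for t using that ab by (intro weakly_continuous_L2[OF wc]) auto
  show ?thesis
  proof (rule ns_lower_bound[OF wc h1 ns _ ab E, where D="box_D c n" and d="dvec n"])
    show "rvec k \<bullet> dvec n k = 0" for k by (rule dvec_div_free)
    show "0 \<le> (18 * 10 ^ 10 + 52416 * \<nu>) * (1 + (2 * pi) ^ 3 * (1 + K)\<^sup>2) * r ^ 5" "0 \<le> 546 * r ^ 5"
      using \<nu> r1 by auto
    show "\<bar>\<integral>x. u t x \<bullet> test_V (box_D c n) (dvec n) x \<partial>torus\<bar> \<le> 546 * r ^ 5 * (1 + (l2norm (u t))\<^sup>2)" if t: "t \<in> {a..b}" for t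
    proof -
      have "0 \<le> (l2norm (u t) - 1)\<^sup>2" by simp
      then have "2 * l2norm (u t) \<le> 1 + (l2norm (u t))\<^sup>2" by (simp add: power2_diff)
      then have 1: "l2norm (u t) \<le> 1 + (l2norm (u t))\<^sup>2" using l2norm_nonneg[of "u t"] by linarith
      have "lam n * sqrt (lam n) = r ^ 3" using lam_pos[of n] by (simp add: r power3_eq_cube)
      then have "l2norm (test_V (box_D c n) (dvec n)) \<le> 546 * r ^ 3" using test_V_l2norm[OF c n] by simp
      also have "\<dots> \<le> 546 * r ^ 5" using r1 by (intro mult_left_mono power_increasing) auto
      finally have 2: "l2norm (test_V (box_D c n) (dvec n)) \<le> 546 * r ^ 5" .
      have "\<bar>\<integral>x. u t x \<bullet> test_V (box_D c n) (dvec n) x \<partial>torus\<bar> \<le> l2norm (u t) * l2norm (test_V (box_D c n) (dvec n))"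
        by (intro integrable_inner_L2(2) L t L2_continuous continuous_test)
      also have "\<dots> \<le> (1 + (l2norm (u t))\<^sup>2) * (546 * r ^ 5)" by (intro mult_mono 1 2) auto
      finally show ?thesis by (simp add: mult_ac)
    qed
    show "c ^ 6 / 2 * r ^ 6 - (18 * 10 ^ 10 + 52416 * \<nu>) * (1 + (2 * pi) ^ 3 * (1 + K)\<^sup>2) * r ^ 5 * (1 + (l2norm (u t))\<^sup>2 + enn2real (grad_sq (u t)))
      \<le> transport (box_D c n) (dvec n) (u t) + \<nu> * (\<integral>x. u t x \<bullet> test_LV (box_D c n) (dvec n) x \<partial>torus)"
      if t: "t \<in> {a..b}" and fin: "grad_sq (u t) < \<infinity>" for t
    proof -
      define G where "G = enn2real (grad_sq (u t))"
      define g where "g = sqrt ((2 * pi) ^ 3 * G) * (1 + K)"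
      define \<kappa> where "\<kappa> = (2 * pi) ^ 3 * (1 + K)\<^sup>2"
      define N where "N = (l2norm (u t))\<^sup>2"
      have nn: "0 \<le> G" "0 \<le> \<kappa>" "0 \<le> N" by (simp_all add: G_def \<kappa>_def N_def)
      note core = core_estimate[OF chi K L[OF t] fin less_imp_le[OF delta0(1)] delta0(2) bes[OF t] J, folded n_def, folded r G_def, folded g_def]
      have g2: "g\<^sup>2 = \<kappa> * G" using nn by (simp add: g_def \<kappa>_def power_mult_distrib)
      have h: "1 + g\<^sup>2 \<le> (1 + \<kappa>) * (1 + N + G)"
        unfolding g2 using nn by (simp add: algebra_simps)
      \<comment> \<open>The error has to be expressed through the dissipation, that is through
        \<open>g\<^sup>2\<close>; the linear term is absorbed by this square.\<close>
      have "0 \<le> (g - 1)\<^sup>2" by simp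
      then have "2 * g \<le> g\<^sup>2 + 1" by (simp add: power2_diff)
      then have g1: "g \<le> 1 + g\<^sup>2"
        using zero_le_power2[of g] by linarith
      then have g1': "1 + g + g\<^sup>2 \<le> 2 * (1 + g\<^sup>2)" by simp
      have r5: "0 \<le> r ^ 5" using r1 by simp
      define Y where "Y = (1 + \<kappa>) * r ^ 5 * (1 + N + G)"
      define Li where "Li = (\<integral>x. u t x \<bullet> test_LV (box_D c n) (dvec n) x \<partial>torus)"
      have "r ^ 5 * (1 + g + g\<^sup>2) \<le> r ^ 5 * (2 * ((1 + \<kappa>) * (1 + N + G)))"
        by (intro mult_left_mono r5 order_trans[OF g1'] h) auto
      also have "\<dots> = 2 * Y" unfolding Y_def by (simp only: mult_ac)
      finally have e1: "10 ^ 10 * r ^ 5 * (1 + g + g\<^sup>2) \<le> 10 ^ 10 * (2 * Y)"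
        unfolding mult.assoc by (intro mult_left_mono) auto
      have "g * r ^ 5 \<le> ((1 + \<kappa>) * (1 + N + G)) * r ^ 5" by (intro mult_right_mono r5 order_trans[OF g1 h])
      also have "\<dots> = Y" unfolding Y_def by (simp only: mult_ac)
      finally have "\<bar>Li\<bar> \<le> 52416 * Y" using core(2) unfolding Li_def by simp
      then have "- (52416 * Y) \<le> Li" by (simp add: abs_le_iff)
      then have "\<nu> * (- (52416 * Y)) \<le> \<nu> * Li" using \<nu> by (intro mult_left_mono) auto
      then have visc: "- (\<nu> * (52416 * Y)) \<le> \<nu> * Li" by simp
      have main: "c ^ 6 * r ^ 6 - 9 * (51251200 * delta0 * r ^ 6) = c ^ 6 / 2 * r ^ 6" by (simp add: delta0_def)
      have total: "(18 * 10 ^ 10 + 52416 * \<nu>) * (1 + \<kappa>) * r ^ 5 * (1 + N + G) = 9 * (10 ^ 10 * (2 * Y)) + \<nu> * (52416 * Y)"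
      proof -
        have "(18 * 10 ^ 10 + 52416 * \<nu>) * (1 + \<kappa>) * r ^ 5 * (1 + N + G) = (18 * 10 ^ 10 + 52416 * \<nu>) * Y"
          by (simp only: Y_def mult.assoc)
        then show ?thesis by (simp add: distrib_right)
      qed
      have "H - q \<le> t + v" if "- y \<le> v" "X - 9 * D = H" "q = 9 * w + y" "X - 9 * (D + w') \<le> t" "w' \<le> w"
        for H q t v y X D w w' :: real using that by simp
      from this[OF visc main total core(1) e1] have "c ^ 6 / 2 * r ^ 6 - (18 * 10 ^ 10 + 52416 * \<nu>) * (1 + \<kappa>) * r ^ 5 * (1 + N + G)
        \<le> transport (box_D c n) (dvec n) (u t) + \<nu> * Li" .
      then show ?thesis by (simp add: N_def G_def \<kappa>_def Li_def)
    qed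
  qed
qed

text \<open>On a fixed time interval \<open>fixed_scale_bound\<close> compares \<open>r ^ 6\<close>
  with \<open>r ^ 5\<close>, and its constants do not change with \<open>J\<close>. This would bound
  \<open>r\<close>, although the scales are unbounded.\<close>

lemma besov_limsup:
  assumes chi: "lp_cutoff chi" and \<nu>: "0 < \<nu>" and T: "0 < T" and sol: "ns_weak_solution \<nu> T (U_field c q) u"
  shows "ennreal delta0 \<le> Limsup (at_right 0) (\<lambda>t. besov_norm chi (\<lambda>x. u t x - U_field c q x))"
proof (rule ccontr)
  assume "\<not> ?thesis"
  then have "\<forall>\<^sub>F t in at_right 0. besov_norm chi (\<lambda>x. u t x - U_field c q x) < ennreal delta0"
    by (intro Limsup_lessD) simp
  then obtain b0 where b0: "0 < b0" "\<And>t. 0 < t \<Longrightarrow> t < b0 \<Longrightarrow> besov_norm chi (\<lambda>x. u t x - U_field c q x) < ennreal delta0"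
    unfolding eventually_at_right_field by blast
  \<comment> \<open>A fixed interval on which the Besov bound holds throughout and which stays away
    from both 0 and \<open>T\<close>.\<close>
  define a b where "a = min b0 T / 4" and "b = min b0 T / 2"
  have ab: "0 < a" "a < b" "b < T" "b < b0" using b0(1) T by (auto simp: a_def b_def min_def)
  have bes: "besov_norm chi (\<lambda>x. u t x - U_field c q x) \<le> ennreal delta0" if "t \<in> {a..b}" for t
    using b0(2)[of t] that ab by auto
  obtain K where K: "1 \<le> K" "\<And>m k. \<bar>low_symbol chi m k\<bar> \<le> K" using low_symbol_bounded[OF chi] by blast
  obtain E where E: "\<And>t. bump a b 0 0 t \<le> E" "\<And>t. \<bar>bump' a b 0 0 t\<bar> \<le> E" using bounded_bump by blast
  define P where "P = (\<integral>t. bump a b 0 0 t \<partial>time_measure T)"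
  define I where "I = (\<integral>t. 1 + (l2norm (u t))\<^sup>2 + enn2real (grad_sq (u t)) \<partial>time_measure T)"
  define C where "C = E * ((18 * 10 ^ 10 + 52416 * \<nu>) * (1 + (2 * pi) ^ 3 * (1 + K)\<^sup>2) + 546) * I"
  have P: "0 < P" unfolding P_def by (rule integral_bump_pos(2)[OF ab(1-3)])
  have le: "sqrt (lam (q (Suc J))) \<le> C / (c ^ 6 / 2 * P)" if "4 \<le> J" for J
  proof -
    define r where "r = sqrt (lam (q (Suc J)))"
    have r: "0 < r" using lam_pos by (simp add: r_def)
    have "c ^ 6 / 2 * r ^ 6 * P \<le> E * ((18 * 10 ^ 10 + 52416 * \<nu>) * (1 + (2 * pi) ^ 3 * (1 + K)\<^sup>2) * r ^ 5 + 546 * r ^ 5) * I"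
      unfolding P_def I_def r_def by (rule fixed_scale_bound[OF chi sol \<nu> K ab(1-3) that bes E])
    also have "\<dots> = C * r ^ 5" by (simp add: C_def algebra_simps)
    finally have "(r * (c ^ 6 / 2 * P)) * r ^ 5 \<le> C * r ^ 5" by (simp add: power_eq_if mult_ac)
    then have "r * (c ^ 6 / 2 * P) \<le> C" using r by simp
    then show ?thesis using P c by (simp add: r_def pos_le_divide_eq)
  qed
  obtain J0 where J0: "(C / (c ^ 6 / 2 * P))\<^sup>2 < 2 ^ J0" using real_arch_pow[of 2] by auto
  define J where "J = max 4 J0"
  have "(2::real) ^ J0 \<le> 2 ^ (Suc J + 1)" by (intro power_increasing) (auto simp: J_def)
  then have "(C / (c ^ 6 / 2 * P))\<^sup>2 < lam (q (Suc J))" using J0 lam_q_ge[of "Suc J"] by linarith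
  then have "C / (c ^ 6 / 2 * P) < sqrt (lam (q (Suc J)))" by (rule real_less_rsqrt)
  moreover have "sqrt (lam (q (Suc J))) \<le> C / (c ^ 6 / 2 * P)" by (rule le) (simp add: J_def)
  ultimately show False by linarith
qed

end

theorem proposition3p2:
  fixes chi :: "real^3 \<Rightarrow> real"
  assumes "lp_cutoff chi"
  shows "\<exists>\<epsilon>0 c0 :: real. 0 < \<epsilon>0 \<and> 0 < c0 \<and>
    (\<forall>\<epsilon> c :: real. \<forall>q :: nat \<Rightarrow> int.
      0 < \<epsilon> \<and> \<epsilon> < \<epsilon>0 \<and> 0 < c \<and> c < c0 \<and>
      (\<forall>j. 0 < q j) \<and> strict_mono q \<and> (\<forall>j. (lam (q j))\<^sup>2 / lam (q (Suc j)) < \<epsilon>) \<longrightarrow>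
      (\<forall>\<nu> T :: real. 0 < \<nu> \<and> 0 < T \<longrightarrow>
        (\<forall>u. ns_weak_solution \<nu> T (U_field c q) u \<longrightarrow>
          (\<exists>\<delta>::real. 0 < \<delta> \<and>
            Limsup (at_right 0) (\<lambda>t. besov_norm chi (\<lambda>x. u t x - U_field c q x)) \<ge> ennreal \<delta>)) \<and>
        (\<exists>\<delta>::real. 0 < \<delta> \<and>
          (\<forall>u. ns_weak_solution \<nu> T (U_field c q) u \<and> energy_inequality \<nu> T (U_field c q) u \<longrightarrow>
            Limsup (at_right 0) (\<lambda>t. besov_norm chi (\<lambda>x. u t x - U_field c q x)) \<ge> ennreal \<delta>))))"
proof -
  \<comment> \<open>Here \<delta> is chosen before \<nu>, T and u, so both forms of the conclusion
    follow from this statement.\<close>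
  have main: "\<exists>\<delta>>0. \<forall>\<nu> T u. 0 < \<nu> \<and> 0 < T \<and> ns_weak_solution \<nu> T (U_field c q) u \<longrightarrow>
      ennreal \<delta> \<le> Limsup (at_right 0) (\<lambda>t. besov_norm chi (\<lambda>x. u t x - U_field c q x))"
    if h: "0 < \<epsilon>" "\<epsilon> < 1" "0 < c" "c < 1 / 100" "\<forall>j. 0 < q j" "strict_mono q" "\<forall>j. (lam (q j))\<^sup>2 / lam (q (Suc j)) < \<epsilon>"
    for \<epsilon> c :: real and q :: "nat \<Rightarrow> int"
  proof -
    interpret lacunary c q
    proof
      fix j
      have "(lam (q j))\<^sup>2 / lam (q (Suc j)) < 1" using h(2) h(7)[rule_format, of j] by linarith
      then show "(lam (q j))\<^sup>2 < lam (q (Suc j))" using lam_pos[of "q (Suc j)"] by (simp add: divide_less_eq)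
    qed (use h in auto)
    show ?thesis using delta0(1) besov_limsup[OF assms] by blast
  qed
  show ?thesis
  \<comment> \<open>For \<epsilon> below 1 the ratio condition implies \<open>gap\<close>; 1/100 is
    the thinness of the blocks required by the locale.\<close>
  proof (rule exI[of _ 1], rule exI[of _ "1 / 100"], intro conjI allI impI)
    fix \<epsilon> c \<nu> T :: real and q :: "nat \<Rightarrow> int" and u
    assume h: "0 < \<epsilon> \<and> \<epsilon> < 1 \<and> 0 < c \<and> c < 1 / 100 \<and> (\<forall>j. 0 < q j) \<and> strict_mono q \<and> (\<forall>j. (lam (q j))\<^sup>2 / lam (q (Suc j)) < \<epsilon>)"
      and nT: "0 < \<nu> \<and> 0 < T"
    obtain \<delta> where \<delta>: "0 < \<delta>" "\<And>u. ns_weak_solution \<nu> T (U_field c q) u \<Longrightarrow>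
        ennreal \<delta> \<le> Limsup (at_right 0) (\<lambda>t. besov_norm chi (\<lambda>x. u t x - U_field c q x))"
      using main[of \<epsilon> c q] h nT by blast
    show "\<exists>\<delta>>0. ennreal \<delta> \<le> Limsup (at_right 0) (\<lambda>t. besov_norm chi (\<lambda>x. u t x - U_field c q x))"
      if "ns_weak_solution \<nu> T (U_field c q) u" using \<delta> that by blast
    show "\<exists>\<delta>>0. \<forall>u. ns_weak_solution \<nu> T (U_field c q) u \<and> energy_inequality \<nu> T (U_field c q) u \<longrightarrow>
            ennreal \<delta> \<le> Limsup (at_right 0) (\<lambda>t. besov_norm chi (\<lambda>x. u t x - U_field c q x))"
      using \<delta> by blast
  qed auto
qed

end
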